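(* For every fixed $\lambda>0$, $$\lim_{N\to\infty}\frac{\mathbb{E}[\omega_{N,\lambda}]}{\log N}=\frac{1}{2\lambda},$$ where $N$ ranges over the positive integers and $\omega_{N,\lambda}$ is the tree-completion time of the cylindrical Hastings--Levitov process with parameter $0$, cylinder width $N$ and particle size $\lambda$.
   Context: Fix an integer $N\ge 1$ (cylinder width) and a real $\lambda>0$ (particle size). Let $\mathbb{T}_N=\mathbb{R}/(2\pi N\mathbb{Z})=[0,2\pi N)$ be the base circle and $\mathbb{T}^N=\{z\in\mathbb{C}:\operatorname{Im}z>0\}/(z\sim z+2\pi N)$ the cylinder; $\mathbb{T}_N\times\{0\}$ denotes its boundary circle $\{\operatorname{Im}z=0\}$. Slit maps. The slit map centered at $0$ is the conformal map from $\mathbb{T}^N$ onto $\mathbb{T}^N\setminus[0,i\lambda]$ given by $$S^{N,\lambda}=f_N^{-1}\circ g^{-1}\circ\phi_\delta\circ g\circ f_N,\qquad f_N(z)=e^{-iz/N},\quad g(z)=i\frac{z-1}{z+1},\quad \phi_a(z)=\sqrt{z^2(1-a^2)-a^2}\ (a>0),$$ where $f_N$ maps $\mathbb{T}^N$ onto $\{|z|>1\}$, $g$ maps $\{|z|>1\}$ into the upper half-plane, the branch of the square root is the one for which $\phi_a$ maps the upper half-plane into itself, and $\delta=\delta(N,\lambda)=1-\frac{2}{e^{\lambda/N}+1}\in(0,1)$ (this is the value for which $S^{N,\lambda}(0)=i\lambda$). The map is extended continuously to the boundary circle $\mathbb{T}_N\times\{0\}$. For $x\in\mathbb{T}_N$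 the slit map centered at $x$ is its translate $$S^{N,\lambda}_x(z)=\operatorname{Re}(z)+S^{N,\lambda}(z-x)-\bigl(\operatorname{Re}(z-x)\bmod 2\pi N\bigr),$$ i.e. $S^{N,\lambda}_x(z)=x+S^{N,\lambda}(z-x)$ modulo $2\pi N$; it attaches a vertical slit of length $\lambda$ above $x$. The process $\mathrm{CHL}_N$. Let $P$ be a Poisson point process of intensity $1$ on $\mathbb{R}_+\times\mathbb{T}_N$ (with respect to Lebesgue measure). For $t>0$ the set $P\cap([0,t]\times\mathbb{T}_N)$ is a.s. finite; enumerate it as $(t_1,x_1),\dots,(t_n,x_n)$ with $0<t_1<\dots<t_n\le t$. The aggregate map at time $t$ is $\mathcal{C}^{N,\lambda}_t=S^{N,\lambda}_{x_1}\circ S^{N,\lambda}_{x_2}\circ\cdots\circ S^{N,\lambda}_{x_n}$ (the identity if $n=0$). Trees. The trees at time $t$ are the connected components of $\mathcal{C}^{N,\lambda}_t(\mathbb{T}_N\times\{0\})\setminus(\mathbb{T}_N\times\{0\})$; let $\mathcal{N}_t$ be their number. The tree-completion time $\omega_{N,\lambda}$ is the last time at which a new tree is born on the base circle, i.e. the last time at which $\mathcal{N}_t$ increases; equivalently, after time $\omega_{N,\lambda}$ every newly attached particle joins an already existing tree. *)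

theory Defs
  imports "HOL-Probability.Probability" "HOL-Library.Real_Mod"
begin

section \<open>The cylinder\<close>

text \<open>Points of the cylinder, boundary circle included, are represented by their unique
  representative with real part in \<open>[0, 2\<pi>N)\<close>.\<close>

definition cylinder :: "nat \<Rightarrow> complex set" where
  "cylinder N = {z. 0 \<le> Re z \<and> Re z < 2 * pi * real N \<and> 0 \<le> Im z}"

definition base_circle :: "nat \<Rightarrow> complex set" where
  "base_circle N = {z \<in> cylinder N. Im z = 0}"

definition cyl_proj :: "nat \<Rightarrow> complex \<Rightarrow> complex" where
  "cyl_proj N z = Complex (Re z rmod (2 * pi * real N)) (Im z)"

text \<open>The quotient topology: the strip carries the finest topology making \<open>cyl_proj N\<close>
  continuous on the closed upper half-plane. It differs from the topology of the strip
  as a subset of the plane, which does not glue the two vertical sides.\<close>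

definition cylinder_topology :: "nat \<Rightarrow> complex topology" where
  "cylinder_topology N = topology (\<lambda>U. U \<subseteq> cylinder N \<and>
     openin (top_of_set {z. 0 \<le> Im z}) {z. 0 \<le> Im z \<and> cyl_proj N z \<in> U})"

lemma openin_cylinder_topology:
  "openin (cylinder_topology N) U \<longleftrightarrow> U \<subseteq> cylinder N \<and>
     openin (top_of_set {z. 0 \<le> Im z}) {z. 0 \<le> Im z \<and> cyl_proj N z \<in> U}"
proof -
  let ?H = "top_of_set {z. 0 \<le> Im z}"
  let ?pre = "\<lambda>U. {z. 0 \<le> Im z \<and> cyl_proj N z \<in> U}"
  have inter: "?pre (S \<inter> T) = ?pre S \<inter> ?pre T" for S T by auto
  have union: "?pre (\<Union>K) = (\<Union>S\<in>K. ?pre S)" for K by auto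
  have "istopology (\<lambda>U. U \<subseteq> cylinder N \<and> openin ?H (?pre U))"
    unfolding istopology_def inter union by (auto intro!: openin_Int openin_Union)
  then show ?thesis
    by (simp add: cylinder_topology_def topology_inverse')
qed

lemma topspace_cylinder_topology:
  assumes "N \<ge> 1"
  shows "topspace (cylinder_topology N) = cylinder N"
proof -
  have "cyl_proj N z \<in> cylinder N" if "0 \<le> Im z" for z
    using that assms rmod_nonneg[of "2 * pi * real N" "Re z"] rmod_less[of "2 * pi * real N" "Re z"]
    by (simp add: cyl_proj_def cylinder_def)
  then have "{z. 0 \<le> Im z \<and> cyl_proj N z \<in> cylinder N} = {z. 0 \<le> Im z}"
    by auto
  then have "openin (cylinder_topology N) (cylinder N)"
    by (simp add: openin_cylinder_topology openin_subtopology_self)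
  then show ?thesis
    by (meson openin_cylinder_topology openin_subset openin_topspace subset_antisym)
qed

section \<open>Slit maps\<close>

definition f_map :: "nat \<Rightarrow> complex \<Rightarrow> complex" where
  "f_map N z = exp (- \<i> * z / of_nat N)"

definition g_map :: "complex \<Rightarrow> complex" where
  "g_map z = \<i> * (z - 1) / (z + 1)"

text \<open>\<open>\<i> * csqrt (- u)\<close> is the square root of \<open>u\<close> with nonnegative imaginary part; see
  \<open>phi_map_branch\<close>.\<close>

definition phi_map :: "real \<Rightarrow> complex \<Rightarrow> complex" where
  "phi_map a z = \<i> * csqrt (- (z\<^sup>2 * (1 - (of_real a)\<^sup>2) - (of_real a)\<^sup>2))"

lemma phi_map_branch:
  assumes "0 < a" "a < 1" "0 < Im z"
  shows "(phi_map a z)\<^sup>2 = z\<^sup>2 * (1 - (of_real a)\<^sup>2) - (of_real a)\<^sup>2"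
    and "0 < Im (phi_map a z)"
proof -
  let ?u = "z\<^sup>2 * (1 - (of_real a)\<^sup>2) - (of_real a)\<^sup>2"
  show sq: "(phi_map a z)\<^sup>2 = ?u"
    by (simp add: phi_map_def power_mult_distrib)
  have c: "1 - a\<^sup>2 > 0"
    using assms by (simp add: power_less_one_iff abs_square_less_1)
  have uw: "?u = of_real (1 - a\<^sup>2) * z\<^sup>2 - of_real (a\<^sup>2)"
    by simp
  have Reu: "Re ?u = (1 - a\<^sup>2) * ((Re z)\<^sup>2 - (Im z)\<^sup>2) - a\<^sup>2"
    unfolding uw by (simp add: Re_power2)
  have Imu: "Im ?u = (1 - a\<^sup>2) * (2 * Re z * Im z)"
    unfolding uw by (simp add: Im_power2)
  have Im_ge: "0 \<le> Im (phi_map a z)"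
    using csqrt_principal[of "- ?u"] by (auto simp: phi_map_def)
  have "Im (phi_map a z) \<noteq> 0"
  proof
    assume 0: "Im (phi_map a z) = 0"
    have "Re ?u = (Re (phi_map a z))\<^sup>2" "Im ?u = 0"
      using 0 by (simp_all add: sq[symmetric] Re_power2 Im_power2)
    moreover from this have "Re z = 0"
      using Imu c assms(3) by auto
    moreover have "(1 - a\<^sup>2) * (Im z)\<^sup>2 > 0" "a\<^sup>2 > 0"
      using c assms by auto
    moreover have "Re ?u = - ((1 - a\<^sup>2) * (Im z)\<^sup>2) - a\<^sup>2" if "Re z = 0"
      unfolding Reu using that by simp
    ultimately show False
      using zero_le_power2[of "Re (phi_map a z)"] by linarith
  qed
  with Im_ge show "0 < Im (phi_map a z)" by simp
qed

definition delta :: "nat \<Rightarrow> real \<Rightarrow> real" where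
  "delta N lam = 1 - 2 / (exp (lam / real N) + 1)"

text \<open>The conformal map on the open cylinder. Since \<open>f_map N\<close> is \<open>2\<pi>N\<close>-periodic, the
  definition makes sense on the whole open upper half-plane.\<close>

definition slit_interior :: "nat \<Rightarrow> real \<Rightarrow> complex \<Rightarrow> complex" where
  "slit_interior N lam z =
     inv_into (cylinder N) (f_map N)
       (inv_into {w. 1 < norm w} g_map
         (phi_map (delta N lam) (g_map (f_map N z))))"

text \<open>On the real line the value is the limit from inside, taken in the cylinder (in the plane
  the representatives may jump between the two vertical sides of the strip).\<close>

definition slit_map :: "nat \<Rightarrow> real \<Rightarrow> complex \<Rightarrow> complex" where
  "slit_map N lam z =
     (if 0 < Im z then slit_interior N lam z
      else (THE l. limitin (cylinder_topology N) (slit_interior N lam) l (at z within {w. 0 < Im w})))"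

definition slit_map_at :: "nat \<Rightarrow> real \<Rightarrow> real \<Rightarrow> complex \<Rightarrow> complex" where
  "slit_map_at N lam x z =
     cyl_proj N (of_real (Re z) + slit_map N lam (z - of_real x)
       - of_real (Re (z - of_real x) rmod (2 * pi * real N)))"

section \<open>Poisson point processes\<close>

text \<open>A (simple) Poisson point process with intensity measure \<open>\<mu>\<close> on the probability space \<open>M\<close>,
  as a random set of points.\<close>

definition poisson_point_process :: "'w measure \<Rightarrow> 'a measure \<Rightarrow> ('w \<Rightarrow> 'a set) \<Rightarrow> bool" where
  "poisson_point_process M \<mu> P \<longleftrightarrow>
     prob_space M \<and>
     (\<forall>w\<in>space M. P w \<subseteq> space \<mu>) \<and>
     (\<forall>A\<in>sets \<mu>. emeasure \<mu> A < \<infinity> \<longrightarrow>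
        (AE w in M. finite (P w \<inter> A)) \<and>
        (\<lambda>w. card (P w \<inter> A)) \<in> measurable M (count_space UNIV) \<and>
        (\<forall>k. measure M {w \<in> space M. card (P w \<inter> A) = k}
               = measure \<mu> A ^ k / fact k * exp (- measure \<mu> A))) \<and>
     (\<forall>F. finite F \<and> disjoint F \<and> (\<forall>A\<in>F. A \<in> sets \<mu> \<and> emeasure \<mu> A < \<infinity>) \<longrightarrow>
        prob_space.indep_vars M (\<lambda>_. count_space UNIV) (\<lambda>A w. card (P w \<inter> A)) F)"

text \<open>Lebesgue measure on \<open>\<real>\<^sub>+ \<times> [0, 2\<pi>N)\<close>; a point \<open>(t, x)\<close> is a particle arriving at time \<open>t\<close>
  above \<open>x\<close>.\<close>

definition space_time :: "nat \<Rightarrow> (real \<times> real) measure" where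
  "space_time N = restrict_space lborel ({0..} \<times> {0..<2 * pi * real N})"

section \<open>The process, its trees and the tree-completion time\<close>

definition arrivals :: "(real \<times> real) set \<Rightarrow> real \<Rightarrow> (real \<times> real) list" where
  "arrivals P t =
     (THE ps. sorted_wrt (\<lambda>p q. fst p < fst q) ps \<and> set ps = {p \<in> P. fst p \<le> t})"

definition aggregate_map :: "nat \<Rightarrow> real \<Rightarrow> (real \<times> real) set \<Rightarrow> real \<Rightarrow> complex \<Rightarrow> complex" where
  "aggregate_map N lam P t = foldr (\<lambda>(s, x) h. slit_map_at N lam x \<circ> h) (arrivals P t) id"

definition trees :: "nat \<Rightarrow> real \<Rightarrow> (real \<times> real) set \<Rightarrow> real \<Rightarrow> complex set set" where
  "trees N lam P t =
     connected_components_of (subtopology (cylinder_topology N)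
       (aggregate_map N lam P t ` base_circle N - base_circle N))"

definition num_trees :: "nat \<Rightarrow> real \<Rightarrow> (real \<times> real) set \<Rightarrow> real \<Rightarrow> nat" where
  "num_trees N lam P t = card (trees N lam P t)"

text \<open>The last time at which \<open>num_trees\<close> increases: \<open>num_trees\<close> increases at \<open>t\<close> if its value at \<open>t\<close>
  exceeds the values just before \<open>t\<close>. Being \<open>ennreal\<close>-valued, the supremum is \<open>\<infinity>\<close> if trees are
  born at arbitrarily late times.\<close>

definition tree_completion_time :: "nat \<Rightarrow> real \<Rightarrow> (real \<times> real) set \<Rightarrow> ennreal" where
  "tree_completion_time N lam P =
     (SUP t \<in> {t. 0 < t \<and> (\<forall>\<^sub>F s in at_left t. num_trees N lam P s < num_trees N lam P t)}. ennreal t)"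

end

theory Submission
  imports Defs "HOL-Real_Asymp.Real_Asymp"
begin

text \<open>In the coordinate of the exterior disc the slit map satisfies
  \<open>J(\<sigma>(w)) = c\<^sup>2 J(w)\<close> with \<open>J(w) = (w + 1)\<^sup>2 / w\<close> and \<open>c = cosh(\<lambda> / 2N)\<close>. On the boundary it
  sends an arc of length \<open>2h\<close> to the slit, where \<open>h \<rightarrow> \<lambda>\<close> as \<open>N \<rightarrow> \<infinity>\<close>, and is expanding off that arc. A particle
  starts a new tree iff it lands on the set of boundary points that the current aggregate map sends
  to the base circle. Let \<open>A\<close> be the length of this exposed set and \<open>L = 2\<pi>N\<close>. A particle at a
  uniform position multiplies \<open>A\<close> by \<open>1 - 2h/L\<close> on average, so \<open>E A\<^sub>t = L exp(-2ht)\<close>, and trees are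
  born at rate \<open>A\<^sub>t\<close>: this gives the upper bound. Since a particle decreases \<open>A\<close> by at most \<open>2h\<close>, the
  variance of \<open>A\<^sub>t\<close> is of order \<open>L exp(-2ht)\<close>. Hence \<open>A\<^sub>t\<close> is concentrated and large as long as
  \<open>2ht \<le> (1 - o(1)) log N\<close>, so a tree is born in \<open>[t, t + 1]\<close> with high probability. Expectations are
  computed by cutting time into slabs that contain at most one particle.\<close>

section \<open>The Joukowski map\<close>

text \<open>The choice of J is dictated by the Cayley transform: \<open>g_map\<close> satisfies g^2
  = 4/J - 1, while \<open>phi_map\<close> acts on squares by s + 1 -> (1 - a^2)(s + 1), so the
  conjugated map multiplies J by 1/(1 - delta^2) = c^2. Births can be read off from one boundary
  point because a new slit meets the closed old cluster at most in the image of its base point. The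
  exact mean comes from rotation invariance: for a fixed offset from the particle, the pushed angle
  is uniform when the particle is, whatever the exposed set looks like. The Poisson process is known
  only through counts on sets. With m slabs per unit of time it becomes a sequence of independent
  positions, and the slabs with two particles have total probability O(1/m), which vanishes as m
  grows with N fixed. Measurability of the completion time is never established: each bound passes
  through a measurable event that covers the birth event or is contained in it almost
  surely.\<close>

definition joukowski :: "complex \<Rightarrow> complex" where
  "joukowski w = (w + 1)\<^sup>2 / w"

text \<open>With w = s^2 one has J(w) = (s + 1/s)^2 and J(w) - 4 = (s - 1/s)^2, so s is half the sum
  of the two square roots. For v in the closed upper half-plane the principal branches select the
  preimage with norm at least 1 and nonnegative imaginary part.\<close>

definition joukowski_inv :: "complex \<Rightarrow> complex" where
  "joukowski_inv v = ((csqrt v + csqrt (v - 4)) / 2)\<^sup>2"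

lemma csqrt_sum_times_diff: "(csqrt v + csqrt (v - 4)) * (csqrt v - csqrt (v - 4)) = 4"
  by (simp add: algebra_simps flip: power2_eq_square)

lemma joukowski_inv_nonzero: "joukowski_inv v \<noteq> 0"
  using csqrt_sum_times_diff[of v] by (auto simp: joukowski_inv_def)

lemma joukowski_joukowski_inv: "joukowski (joukowski_inv v) = v"
proof -
  define p where "p = (csqrt v + csqrt (v - 4)) / 2"
  define q where "q = (csqrt v - csqrt (v - 4)) / 2"
  have pq: "p * q = 1"
    using csqrt_sum_times_diff[of v] by (simp add: p_def q_def)
  then have p0: "p \<noteq> 0" by auto
  have q: "q = 1 / p"
    using pq p0 by (simp add: field_simps)
  have "joukowski (p\<^sup>2) = (p + q)\<^sup>2"
    unfolding joukowski_def q using p0 by (simp add: field_simps power2_eq_square)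
  also have "p + q = csqrt v"
    by (simp add: p_def q_def field_simps)
  finally show ?thesis
    by (simp add: joukowski_inv_def p_def)
qed

lemma Im_csqrt_nonneg:
  assumes "0 \<le> Im v"
  shows "0 \<le> Im (csqrt v)"
  using assms complex_Re_le_cmod[of v] by (simp add: field_simps)

text \<open>Both square roots lie in the closed first quadrant, hence so does their sum, and
  squaring sends that quadrant into the closed upper half-plane.\<close>

lemma Im_joukowski_inv:
  assumes "0 \<le> Im v"
  shows "0 \<le> Im (joukowski_inv v)"
proof -
  have "0 \<le> Im (csqrt v + csqrt (v - 4))" "0 \<le> Re (csqrt v + csqrt (v - 4))"
    using Im_csqrt_nonneg[of v] Im_csqrt_nonneg[of "v - 4"] Re_csqrt[of v] Re_csqrt[of "v - 4"]
      assms by (auto simp del: csqrt.sel)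
  then show ?thesis
    by (simp add: joukowski_inv_def Im_power2 power_divide del: csqrt.sel plus_complex.sel)
qed

text \<open>Two points a, b of the closed first quadrant have nonnegative inner product, so |a - b|
  \<le> |a + b|. As (a + b)(a - b) = 4, the sum has norm at least 2.\<close>

lemma norm_joukowski_inv:
  assumes "0 \<le> Im v"
  shows "1 \<le> norm (joukowski_inv v)"
proof -
  define a b where "a = csqrt v" and "b = csqrt (v - 4)"
  have ab: "0 \<le> Re a" "0 \<le> Im a" "0 \<le> Re b" "0 \<le> Im b"
    using Im_csqrt_nonneg[of v] Im_csqrt_nonneg[of "v - 4"] Re_csqrt[of v] Re_csqrt[of "v - 4"]
      assms by (auto simp: a_def b_def simp del: csqrt.sel)
  have "(norm (a - b))\<^sup>2 \<le> (norm (a + b))\<^sup>2"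
    unfolding cmod_power2 using ab by (simp add: power2_eq_square algebra_simps)
  then have le: "norm (a - b) \<le> norm (a + b)"
    by (simp add: power2_le_iff_abs_le)
  have "(a + b) * (a - b) = 4"
    using csqrt_sum_times_diff[of v] by (simp add: a_def b_def)
  then have "norm (a + b) * norm (a - b) = 4"
    by (metis norm_mult norm_numeral)
  then have "4 \<le> norm (a + b) * norm (a + b)"
    using le by (metis mult_left_mono norm_ge_zero)
  then show ?thesis
    by (simp add: joukowski_inv_def norm_power norm_divide power_divide flip: a_def b_def)
      (simp add: power2_eq_square)
qed

text \<open>The principal root jumps across the negative axis, but not when that axis is approached
  from above. Multiplication by -i moves the upper half-plane to the right half-plane, which meets
  the cut only in 0; the factor \<open>csqrt \<i>\<close> undoes the rotation.\<close>

lemma continuous_on_csqrt_upper: "continuous_on {v. 0 \<le> Im v} csqrt"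
proof -
  have eq: "csqrt v = csqrt \<i> * csqrt (- \<i> * v)" if "0 \<le> Im v" for v
  proof (cases "v = 0")
    case False
    have "(csqrt \<i> * csqrt (- \<i> * v))\<^sup>2 = v"
      unfolding power_mult_distrib power2_csqrt by simp
    moreover have "0 < Re (csqrt \<i> * csqrt (- \<i> * v)) \<or>
       Re (csqrt \<i> * csqrt (- \<i> * v)) = 0 \<and> 0 \<le> Im (csqrt \<i> * csqrt (- \<i> * v))"
    proof -
      define d where "d = csqrt (- \<i> * v)"
      have d2: "d\<^sup>2 = - \<i> * v" by (simp add: d_def)
      have "Re (d\<^sup>2) = Im v" by (simp add: d2)
      then have "(Im d)\<^sup>2 \<le> (Re d)\<^sup>2"
        using that by (simp add: Re_power2)
      moreover have "0 \<le> Re d" unfolding d_def by (rule Re_csqrt)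
      ultimately have le: "\<bar>Im d\<bar> \<le> Re d"
        by (metis abs_le_square_iff abs_of_nonneg)
      have re: "Re (csqrt \<i> * d) = (Re d - Im d) / sqrt 2"
        and im: "Im (csqrt \<i> * d) = (Re d + Im d) / sqrt 2"
        by (simp_all add: field_simps)
      show ?thesis
        unfolding d_def[symmetric] re im using le by (auto simp: field_simps)
    qed
    ultimately show ?thesis by (rule csqrt_unique)
  qed simp
  have "continuous (at v within {v. 0 \<le> Im v}) (\<lambda>v. csqrt \<i> * csqrt (- \<i> * v))"
    if "0 \<le> Im v" for v
  proof (cases "v = 0")
    case True
    have "((\<lambda>x. csqrt (- \<i> * x)) \<longlongrightarrow> 0) (at 0)"
    proof (rule tendsto_norm_zero_cancel)
      have "((\<lambda>x::complex. sqrt (norm x)) \<longlongrightarrow> sqrt (norm (0::complex))) (at 0)"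
        by (intro tendsto_intros)
      then show "((\<lambda>x. norm (csqrt (- \<i> * x))) \<longlongrightarrow> 0) (at 0)"
        by (simp add: norm_mult)
    qed
    then have "((\<lambda>x. csqrt \<i> * csqrt (- \<i> * x)) \<longlongrightarrow> 0) (at 0)"
      by (rule tendsto_mult_right_zero)
    then have "continuous (at 0) (\<lambda>x. csqrt \<i> * csqrt (- \<i> * x))"
      by (simp add: continuous_at)
    then show ?thesis unfolding True by (rule continuous_at_imp_continuous_at_within)
  next
    case False
    have "- \<i> * v \<notin> \<real>\<^sub>\<le>\<^sub>0"
      using that False by (auto simp: complex_nonpos_Reals_iff complex_eq_iff)
    then have "continuous (at v) (\<lambda>v. csqrt (- \<i> * v))"
      using continuous_at_compose[of v "\<lambda>v. - \<i> * v" csqrt]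
      by (simp add: continuous_at_csqrt o_def)
    then have "continuous (at v) (\<lambda>v. csqrt \<i> * csqrt (- \<i> * v))"
      by (intro continuous_intros)
    then show ?thesis by (rule continuous_at_imp_continuous_at_within)
  qed
  then have "continuous_on {v. 0 \<le> Im v} (\<lambda>v. csqrt \<i> * csqrt (- \<i> * v))"
    by (simp add: continuous_on_eq_continuous_within)
  then show ?thesis
    by (rule continuous_on_eq) (use eq in auto)
qed

lemma continuous_on_joukowski_inv: "continuous_on {v. 0 \<le> Im v} joukowski_inv"
proof -
  have "continuous_on {v. 0 \<le> Im v} (\<lambda>v. csqrt (v - 4))"
    by (rule continuous_on_compose2[OF continuous_on_csqrt_upper]) (auto intro!: continuous_intros)
  then show ?thesis
    unfolding joukowski_inv_def[abs_def]
    by (intro continuous_intros continuous_on_csqrt_upper) auto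
qed

lemma joukowski_eq_cases:
  assumes "joukowski w = joukowski z" "w \<noteq> 0" "z \<noteq> 0"
  shows "w = z \<or> w * z = 1"
proof -
  have "(w - z) * (w * z - 1) = 0"
    using assms by (simp add: joukowski_def field_simps power2_eq_square)
  then show ?thesis by auto
qed

lemma joukowski_inj:
  assumes "joukowski w = joukowski z" "1 < norm w" "1 \<le> norm z"
  shows "w = z"
proof -
  have nz: "w \<noteq> 0" "z \<noteq> 0"
    using assms(2,3) by auto
  have "1 * norm z < norm w * norm z"
    using nz assms by (intro mult_strict_right_mono) auto
  then have "norm (w * z) > 1"
    using assms(3) by (simp add: norm_mult)
  then have "w * z \<noteq> 1" by auto
  then show ?thesis
    using joukowski_eq_cases[OF assms(1)] nz by blast
qed

lemma Im_joukowski: "Im (joukowski w) = Im w * (1 - 1 / (norm w)\<^sup>2)"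
proof (cases "w = 0")
  case False
  have "joukowski w = w + 1 / w + 2"
    using False by (simp add: joukowski_def field_simps power2_eq_square)
  then show ?thesis
    by (simp add: Im_divide cmod_power2 field_simps)
qed (simp add: joukowski_def)

lemma Im_joukowski_nonneg:
  assumes "0 \<le> Im w" "1 \<le> norm w"
  shows "0 \<le> Im (joukowski w)"
proof -
  have "1 / (norm w)\<^sup>2 \<le> 1"
    using one_le_power[OF assms(2), of 2] by (simp add: divide_le_eq)
  then show ?thesis using assms by (simp add: Im_joukowski)
qed

lemma cnj_joukowski: "joukowski (cnj w) = cnj (joukowski w)"
  by (simp add: joukowski_def)

lemma joukowski_unit:
  assumes "norm w = 1"
  shows "joukowski w = of_real (2 + 2 * Re w)"
proof -
  have "w \<noteq> 0" using assms by auto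
  then have "joukowski w = w + 1 / w + 2"
    by (simp add: joukowski_def field_simps power2_eq_square)
  also have "1 / w = cnj w"
    using assms by (simp add: divide_conv_cnj)
  finally show ?thesis by (simp add: complex_eq_iff)
qed

text \<open>Outside (0, 4) the two square roots are both real or both imaginary, so the square of
  their sum is real. This is what makes the two halves of \<open>disc_slit\<close> agree on the real
  axis.\<close>

lemma joukowski_inv_real:
  assumes "v \<le> 0 \<or> 4 \<le> v"
  shows "Im (joukowski_inv (of_real v)) = 0"
proof -
  consider "v \<le> 0" | "4 \<le> v" using assms by blast
  then show ?thesis
  proof cases
    case 1
    then have "csqrt (of_real v) = \<i> * sqrt \<bar>v\<bar>" "csqrt (of_real v - 4) = \<i> * sqrt \<bar>v - 4\<bar>"
      by (subst csqrt_of_real_nonpos; simp)+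
    then show ?thesis
      by (simp add: joukowski_inv_def Im_power2 power_divide)
  next
    case 2
    then have "csqrt (of_real v) = sqrt v" "csqrt (of_real v - 4) = sqrt (v - 4)"
      by (subst csqrt_of_real_nonneg; simp)+
    then show ?thesis
      by (simp add: joukowski_inv_def Im_power2 power_divide)
  qed
qed

text \<open>Here one root is real and the other imaginary, and their squared lengths v and 4 - v add
  up to 4.\<close>

lemma norm_joukowski_inv_unit:
  assumes "0 \<le> v" "v \<le> 4"
  shows "norm (joukowski_inv (of_real v)) = 1"
proof -
  have "csqrt (of_real v) = sqrt v" "csqrt (of_real v - 4) = \<i> * sqrt (4 - v)"
    using assms by (subst csqrt_of_real_nonneg csqrt_of_real_nonpos; simp)+
  then have "(norm (csqrt (of_real v) + csqrt (of_real v - 4)))\<^sup>2 = 4"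
    using assms by (simp add: cmod_power2)
  then show ?thesis
    by (simp add: joukowski_inv_def norm_power norm_divide power_divide)
qed

lemma joukowski_inv_joukowski_unit:
  assumes "norm s = 1" "0 \<le> Im s"
  shows "joukowski_inv (joukowski s) = s"
proof -
  define t where "t = joukowski_inv (joukowski s)"
  have s0: "s \<noteq> 0" using assms by auto
  have "joukowski t = joukowski s"
    by (simp add: t_def joukowski_joukowski_inv)
  then have "t = s \<or> t * s = 1"
    using joukowski_eq_cases s0 joukowski_inv_nonzero by (auto simp: t_def)
  moreover have "0 \<le> Im t"
    unfolding t_def by (intro Im_joukowski_inv Im_joukowski_nonneg) (use assms in auto)
  \<comment> \<open>On the unit circle the second solution 1/s is the conjugate of s. Both having
    nonnegative imaginary part forces them to be real and equal.\<close>
  moreover have "t = s" if "t * s = 1" "0 \<le> Im t"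
  proof -
    have "t = cnj s"
      using that assms s0 by (metis complex_div_cnj div_by_1 mult.commute mult_1 nonzero_mult_div_cancel_right of_real_1 one_power2)
    then show ?thesis using that assms by (simp add: complex_eq_iff)
  qed
  ultimately show ?thesis by (auto simp: t_def)
qed

section \<open>Slit maps of the exterior disc\<close>

text \<open>The map of the exterior disc that attaches a radial slit at 1. Since
  \<open>joukowski_inv\<close> always lands in the closed upper half-plane, the lower half is
  treated by reflection.\<close>

definition disc_slit :: "real \<Rightarrow> complex \<Rightarrow> complex" where
  "disc_slit c w =
     (if 0 \<le> Im w then joukowski_inv (of_real (c\<^sup>2) * joukowski w)
      else cnj (joukowski_inv (of_real (c\<^sup>2) * joukowski (cnj w))))"

lemma disc_slit_cnj:
  assumes "Im w \<noteq> 0"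
  shows "disc_slit c (cnj w) = cnj (disc_slit c w)"
  using assms by (simp add: disc_slit_def)

lemma joukowski_disc_slit: "joukowski (disc_slit c w) = of_real (c\<^sup>2) * joukowski w"
  by (simp add: disc_slit_def joukowski_joukowski_inv cnj_joukowski)

lemma Im_scaled_joukowski:
  assumes "1 \<le> norm w" "0 \<le> Im w"
  shows "0 \<le> Im (of_real (c\<^sup>2) * joukowski w)"
  using Im_joukowski_nonneg[OF assms(2,1)] by simp

lemma norm_disc_slit:
  assumes "1 \<le> norm w"
  shows "1 \<le> norm (disc_slit c w)"
  using assms norm_joukowski_inv[OF Im_scaled_joukowski[of w c]]
    norm_joukowski_inv[OF Im_scaled_joukowski[of "cnj w" c]]
  by (auto simp: disc_slit_def)

text \<open>The identity (x + 1)^2 = (x - 1)^2 + 4x keeps J out of (0, 4) on the real points of the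
  exterior disc, and a factor at least 1 does not bring it back. This serves the real axis, where
  the upper and lower formulas of \<open>disc_slit\<close> meet.\<close>

lemma joukowski_of_real:
  assumes "1 \<le> \<bar>x\<bar>"
  shows "joukowski (of_real x) = of_real ((x + 1)\<^sup>2 / x)"
    "(x + 1)\<^sup>2 / x \<le> 0 \<or> 4 \<le> (x + 1)\<^sup>2 / x"
proof -
  show "joukowski (of_real x) = of_real ((x + 1)\<^sup>2 / x)"
    by (simp add: joukowski_def)
  have e: "(x + 1)\<^sup>2 = (x - 1)\<^sup>2 + 4 * x"
    by (simp add: power2_eq_square algebra_simps)
  show "(x + 1)\<^sup>2 / x \<le> 0 \<or> 4 \<le> (x + 1)\<^sup>2 / x"
  proof (cases "x > 0")
    case True
    then show ?thesis by (simp add: e add_divide_distrib)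
  qed (simp add: divide_nonneg_nonpos)
qed

lemma mult_real_outside:
  assumes "1 \<le> (d::real)" "v \<le> 0 \<or> 4 \<le> v"
  shows "d * v \<le> 0 \<or> 4 \<le> d * v"
  using assms(2)
proof
  assume "4 \<le> v"
  then show ?thesis using assms(1) mult_mono[of 1 d 4 v] by simp
qed (use assms in \<open>simp add: mult_nonneg_nonpos\<close>)

text \<open>If an outside point landed on the circle, c^2 J(w) would lie in [0, 4], hence J(w) too.
  But every value in [0, 4] is already attained on the circle, and J is injective between the circle
  and the outside.\<close>

lemma norm_disc_slit_gt:
  assumes c: "1 < c" and w: "1 < norm w"
  shows "1 < norm (disc_slit c w)"
proof (rule ccontr)
  assume "\<not> 1 < norm (disc_slit c w)"
  then have n: "norm (disc_slit c w) = 1"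
    using norm_disc_slit[of w c] w by simp
  define r where "r = (2 + 2 * Re (disc_slit c w)) / c\<^sup>2"
  have "\<bar>Re (disc_slit c w)\<bar> \<le> 1"
    using n abs_Re_le_cmod by metis
  then have r: "0 \<le> r" "r * c\<^sup>2 \<le> 4"
    using c by (auto simp: r_def)
  have "r \<le> r * c\<^sup>2"
    using c r(1) by (simp add: mult_le_cancel_left1)
  then have r4: "r \<le> 4" using r by simp
  have "of_real (c\<^sup>2) * joukowski w = of_real (2 + 2 * Re (disc_slit c w))"
    using joukowski_unit[OF n] by (simp add: joukowski_disc_slit)
  then have J: "joukowski w = of_real r"
    using c by (simp add: r_def field_simps)
  have "joukowski w = joukowski (joukowski_inv (of_real r))"
    by (simp add: J joukowski_joukowski_inv)
  then have "w = joukowski_inv (of_real r)"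
    by (rule joukowski_inj) (use w norm_joukowski_inv_unit[OF r(1) r4] in auto)
  then show False
    using w norm_joukowski_inv_unit[OF r(1) r4] by simp
qed

text \<open>The boundary map glues conjugate points into the slit, so one of the two points has to
  be strictly outside. This asymmetric form is exactly what separates a new slit from the image of
  the circle.\<close>

lemma disc_slit_inj:
  assumes "1 < c" "disc_slit c w = disc_slit c z" "1 < norm w" "1 \<le> norm z"
  shows "w = z"
proof (rule joukowski_inj)
  have "of_real (c\<^sup>2) * joukowski w = of_real (c\<^sup>2) * joukowski z"
    using assms(2) by (metis joukowski_disc_slit)
  then show "joukowski w = joukowski z"
    using assms(1) by simp
qed (use assms in auto)

text \<open>Gluing along the closed upper and lower halves: they overlap in the real axis, where the
  value is real and thus its own conjugate.\<close>

lemma continuous_on_disc_slit: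
  assumes c: "1 \<le> c"
  shows "continuous_on {w. 1 \<le> norm w} (disc_slit c)"
proof -
  let ?E1 = "{w. 1 \<le> norm w \<and> 0 \<le> Im w}" and ?E2 = "{w. 1 \<le> norm w \<and> Im w \<le> 0}"
  let ?F1 = "\<lambda>w. joukowski_inv (of_real (c\<^sup>2) * joukowski w)"
  have j: "continuous_on {w. 1 \<le> norm w} (\<lambda>w. of_real (c\<^sup>2) * joukowski w)"
    unfolding joukowski_def[abs_def] by (intro continuous_intros) auto
  have 1: "continuous_on ?E1 ?F1"
    by (rule continuous_on_compose2[OF continuous_on_joukowski_inv continuous_on_subset[OF j]])
      (auto simp del: of_real_power intro!: Im_scaled_joukowski)
  have 2: "continuous_on ?E2 (\<lambda>w. cnj (?F1 (cnj w)))"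
    by (intro continuous_on_cnj continuous_on_compose2[OF 1]) (auto intro!: continuous_intros)
  have cl: "closed ?E1" "closed ?E2"
    by (auto intro!: closed_Collect_conj closed_Collect_le continuous_intros)
  have real: "?F1 w = cnj (?F1 (cnj w))" if h: "1 \<le> norm w" "Im w = 0" for w
  proof -
    obtain x where x: "w = of_real x"
      using h(2) complex_is_Real_iff Reals_cases by metis
    have ax: "1 \<le> \<bar>x\<bar>" using h by (simp add: x)
    define d where "d = (x + 1)\<^sup>2 / x"
    have d: "joukowski w = of_real d" "d \<le> 0 \<or> 4 \<le> d"
      unfolding x d_def using joukowski_of_real[OF ax] by auto
    have cw: "cnj w = w" by (simp add: x)
    have eq: "of_real (c\<^sup>2) * joukowski w = of_real (c\<^sup>2 * d)"
      by (simp add: d)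
    have "c\<^sup>2 * d \<le> 0 \<or> 4 \<le> c\<^sup>2 * d"
      using c by (intro mult_real_outside d(2)) simp
    then have "Im (?F1 w) = 0"
      unfolding eq by (rule joukowski_inv_real)
    then show ?thesis
      unfolding cw by (simp add: complex_eq_iff)
  qed
  have "continuous_on (?E1 \<union> ?E2) (\<lambda>w. if 0 \<le> Im w then ?F1 w else cnj (?F1 (cnj w)))"
  proof (rule continuous_on_If[OF cl 1 2])
    show "?F1 w = cnj (?F1 (cnj w))" if "w \<in> ?E1" "\<not> 0 \<le> Im w" for w
      using that by blast
    show "?F1 w = cnj (?F1 (cnj w))" if "w \<in> ?E2" "0 \<le> Im w" for w
      by (rule real) (use that in simp_all)
  qed
  moreover have "?E1 \<union> ?E2 = {w. 1 \<le> norm w}" by auto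
  ultimately show ?thesis
    by (simp add: disc_slit_def[abs_def])
qed

text \<open>The slit of \<^term>\<open>disc_slit c\<close>, without its base point \<open>1\<close>.\<close>

definition disc_slit_segment :: "real \<Rightarrow> complex set" where
  "disc_slit_segment c = (\<lambda>v. joukowski_inv (of_real v)) ` {4<..4 * c\<^sup>2}"

lemma continuous_on_joukowski_inv_real: "continuous_on S (\<lambda>v. joukowski_inv (of_real v))"
  by (rule continuous_on_compose2[OF continuous_on_joukowski_inv]) (auto intro!: continuous_intros)

lemma connected_disc_slit_segment: "connected (disc_slit_segment c)"
  unfolding disc_slit_segment_def
  by (intro connected_continuous_image continuous_on_joukowski_inv_real) simp

lemma joukowski_inv_4: "joukowski_inv 4 = 1"
proof -
  have "csqrt 4 = 2" by (rule csqrt_unique) auto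
  then show ?thesis by (simp add: joukowski_inv_def)
qed

lemma insert_disc_slit_segment:
  assumes "1 < c"
  shows "insert 1 (disc_slit_segment c) = (\<lambda>v. joukowski_inv (of_real v)) ` {4..4 * c\<^sup>2}"
proof -
  have "{4..4 * c\<^sup>2} = insert 4 {4<..4 * c\<^sup>2}"
    using assms one_less_power[OF assms, of 2] by auto
  then show ?thesis
    by (simp add: disc_slit_segment_def joukowski_inv_4)
qed

lemma connected_insert_disc_slit_segment:
  assumes "1 < c"
  shows "connected (insert 1 (disc_slit_segment c))"
  unfolding insert_disc_slit_segment[OF assms]
  by (intro connected_continuous_image continuous_on_joukowski_inv_real) simp

lemma compact_insert_disc_slit_segment:
  assumes "1 < c"
  shows "compact (insert 1 (disc_slit_segment c))"
  unfolding insert_disc_slit_segment[OF assms]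
  by (intro compact_continuous_image continuous_on_joukowski_inv_real) simp

lemma disc_slit_segment_nonempty: "1 < c \<Longrightarrow> disc_slit_segment c \<noteq> {}"
  using one_less_power[of c 2] by (auto simp: disc_slit_segment_def)

lemma norm_disc_slit_segment:
  assumes "z \<in> disc_slit_segment c"
  shows "1 < norm z"
proof -
  obtain v where v: "z = joukowski_inv (of_real v)" "4 < v"
    using assms by (auto simp: disc_slit_segment_def)
  have "norm z \<noteq> 1"
  proof
    assume n: "norm z = 1"
    have "complex_of_real v = of_real (2 + 2 * Re z)"
      using joukowski_unit[OF n] by (simp add: v joukowski_joukowski_inv)
    then have "v = 2 + 2 * Re z" by (simp only: of_real_eq_iff)
    then show False using n v(2) complex_Re_le_cmod[of z] by simp
  qed
  then show ?thesis
    using norm_joukowski_inv[of "of_real v"] v by simp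
qed

lemma cnj_disc_slit_segment:
  assumes "z \<in> disc_slit_segment c"
  shows "cnj z = z"
proof -
  obtain v where v: "z = joukowski_inv (of_real v)" "4 < v"
    using assms by (auto simp: disc_slit_segment_def)
  then show ?thesis
    using joukowski_inv_real[of v] by (simp add: complex_eq_iff)
qed

text \<open>On the circle J takes the values [0, 4], so c^2 J sweeps [0, 4 c^2]. Values up to 4 give
  points of the circle again; the others trace the slit up to its tip, the image of 1.\<close>

lemma disc_slit_circle:
  assumes c: "1 < c"
  shows "disc_slit c ` sphere 0 1 = sphere 0 1 \<union> disc_slit_segment c"
proof -
  have c2: "1 < c\<^sup>2" using one_less_power[OF c, of 2] by simp
  have half: "disc_slit c w \<in> sphere 0 1 \<union> disc_slit_segment c" if "norm w = 1" "0 \<le> Im w" for w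
  proof -
    define v where "v = c\<^sup>2 * (2 + 2 * Re w)"
    have "\<bar>Re w\<bar> \<le> 1" using that abs_Re_le_cmod by metis
    then have v: "0 \<le> v" "v \<le> 4 * c\<^sup>2"
      using mult_left_mono[of "2 + 2 * Re w" 4 "c\<^sup>2"] by (simp_all add: v_def mult.commute)
    have e: "disc_slit c w = joukowski_inv (of_real v)"
      using that by (simp add: disc_slit_def joukowski_unit v_def)
    show ?thesis
    proof (cases "v \<le> 4")
      case True
      then show ?thesis using norm_joukowski_inv_unit[OF v(1)] by (simp add: e)
    next
      case False
      then show ?thesis using v by (auto simp: e disc_slit_segment_def)
    qed
  qed
  have fwd: "disc_slit c w \<in> sphere 0 1 \<union> disc_slit_segment c" if "norm w = 1" for w
  proof (cases "0 \<le> Im w")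
    case False
    then have "cnj (disc_slit c w) \<in> sphere 0 1 \<union> disc_slit_segment c"
      using half[of "cnj w"] that by (simp add: disc_slit_cnj)
    then show ?thesis
      using cnj_disc_slit_segment[of "cnj (disc_slit c w)" c] by auto
  qed (use half that in simp)
  have pre: "\<exists>w. norm w = 1 \<and> 0 \<le> Im w \<and> disc_slit c w = joukowski_inv (of_real v)"
    if "0 \<le> v" "v \<le> 4 * c\<^sup>2" for v
  proof -
    define w where "w = joukowski_inv (of_real (v / c\<^sup>2))"
    have "0 \<le> v / c\<^sup>2" "v / c\<^sup>2 \<le> 4"
      using that c2 by (auto simp: divide_le_eq)
    then have n: "norm w = 1" "0 \<le> Im w"
      unfolding w_def by (simp only: norm_joukowski_inv_unit) (intro Im_joukowski_inv, simp)
    have "disc_slit c w = joukowski_inv (of_real (c\<^sup>2) * of_real (v / c\<^sup>2))"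
      using n by (simp add: disc_slit_def w_def joukowski_joukowski_inv)
    also have "of_real (c\<^sup>2) * of_real (v / c\<^sup>2) = complex_of_real v"
      using c by (simp flip: of_real_mult)
    finally show ?thesis using n by blast
  qed
  have up: "s \<in> disc_slit c ` sphere 0 1" if "norm s = 1" "0 \<le> Im s" for s
  proof -
    have "\<bar>Re s\<bar> \<le> 1" using that abs_Re_le_cmod by metis
    then have "0 \<le> 2 + 2 * Re s" "2 + 2 * Re s \<le> 4 * c\<^sup>2" using c2 by auto
    then obtain w where "norm w = 1" "disc_slit c w = joukowski_inv (of_real (2 + 2 * Re s))"
      using pre by blast
    moreover have "joukowski_inv (of_real (2 + 2 * Re s)) = s"
      using joukowski_inv_joukowski_unit[OF that] by (simp only: joukowski_unit[OF that(1)])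
    ultimately show ?thesis by (auto intro!: image_eqI[of s _ w])
  qed
  have circ: "s \<in> disc_slit c ` sphere 0 1" if "norm s = 1" for s
  proof (cases "0 \<le> Im s")
    case False
    then have "cnj s \<in> disc_slit c ` sphere 0 1"
      using that by (intro up) auto
    then obtain w where w: "norm w = 1" "cnj s = disc_slit c w" by auto
    \<comment> \<open>The reflection rule holds in the form used only off the real axis. A real w
      would be 1 or -1, with J equal to 4 or 0, and then its image would be real, against Im s <
      0.\<close>
    have "Im w \<noteq> 0"
    proof
      assume i: "Im w = 0"
      have "(Re w)\<^sup>2 = 1" using w(1) i cmod_power2[of w] by simp
      then have "Re w = 1 \<or> Re w = -1" by (simp only: power2_eq_1_iff)
      then have "2 + 2 * Re w = 0 \<or> 2 + 2 * Re w = 4" by auto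
      then obtain d where d: "joukowski w = complex_of_real d" "d = 0 \<or> d = 4"
        using joukowski_unit[OF w(1)] by blast
      have "disc_slit c w = joukowski_inv (of_real (c\<^sup>2 * d))"
        using i by (simp add: disc_slit_def d(1))
      moreover have "c\<^sup>2 * d \<le> 0 \<or> 4 \<le> c\<^sup>2 * d" using d(2) c2 by auto
      ultimately have "Im (cnj s) = 0"
        by (simp only: w(2) joukowski_inv_real)
      then show False using False by simp
    qed
    then have "disc_slit c (cnj w) = s"
      using disc_slit_cnj[of w c] w(2) by (metis complex_cnj_cnj)
    then show ?thesis using w(1) by (auto intro!: image_eqI[of s _ "cnj w"])
  qed (use up that in simp)
  have seg: "z \<in> disc_slit c ` sphere 0 1" if h: "z \<in> disc_slit_segment c" for z
  proof -
    obtain v where v: "z = joukowski_inv (of_real v)" "4 < v" "v \<le> 4 * c\<^sup>2"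
      using h by (auto simp: disc_slit_segment_def)
    then obtain w where "norm w = 1" "disc_slit c w = z"
      using pre[of v] by auto
    then show ?thesis by (auto intro!: image_eqI[of z _ w])
  qed
  show ?thesis
  proof (intro equalityI subsetI)
    show "z \<in> sphere 0 1 \<union> disc_slit_segment c" if "z \<in> disc_slit c ` sphere 0 1" for z
      using that fwd by (metis imageE mem_sphere_0)
    show "z \<in> disc_slit c ` sphere 0 1" if "z \<in> sphere 0 1 \<union> disc_slit_segment c" for z
      using that circ seg by (metis UnE mem_sphere_0)
  qed
qed

section \<open>Components\<close>

text \<open>Trees are defined in an abstract topology, whereas they are counted with
  \<open>components\<close> in the plane.\<close>

lemma connected_components_of_top_of_set:
  "connected_components_of (top_of_set S) = components S"
proof -
  have "connected_component_of (top_of_set S) = connected_component S"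
    by (intro ext) (auto simp: connected_component_of_def connected_component_def connectedin_subtopology)
  then show ?thesis
    by (simp add: connected_components_of_def components_def)
qed

text \<open>Each point of G lies in the component of p, so every component of the union meets S.
  Hence the old components map onto the new ones, and their number cannot grow.\<close>

lemma components_Un_attached:
  fixes S G :: "'a::topological_space set"
  assumes "finite (components S)" "p \<in> S" "connected (insert p G)"
  shows "finite (components (S \<union> G))" "card (components (S \<union> G)) \<le> card (components S)"
proof -
  \<comment> \<open>The map sends an old component to the new one that contains it; the chosen
    representative does not influence the value, as the next fact shows.\<close>
  define \<phi> where "\<phi> = (\<lambda>C. connected_component_set (S \<union> G) (SOME x. x \<in> C))"
  have eq: "\<phi> (connected_component_set S x) = connected_component_set (S \<union> G) x" if "x \<in> S" for x
  proof -
    have "x \<in> connected_component_set S x" using that by simp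
    then have "(SOME y. y \<in> connected_component_set S x) \<in> connected_component_set S x"
      by (rule someI)
    then have "(SOME y. y \<in> connected_component_set S x) \<in> connected_component_set (S \<union> G) x"
      using connected_component_mono[of S "S \<union> G" x] by auto
    then show ?thesis
      unfolding \<phi>_def by (rule connected_component_eq)
  qed
  have "components (S \<union> G) \<subseteq> \<phi> ` components S"
  proof
    fix C assume "C \<in> components (S \<union> G)"
    then obtain x where x: "x \<in> S \<union> G" "C = connected_component_set (S \<union> G) x"
      by (auto simp: components_def)
    have "\<exists>y\<in>S. C = connected_component_set (S \<union> G) y"
    proof (cases "x \<in> S")
      case False
      then have "x \<in> insert p G" using x by auto
      then have "insert p G \<subseteq> connected_component_set (S \<union> G) x"
        using assms by (intro connected_component_maximal) auto
      then have "p \<in> connected_component_set (S \<union> G) x" by auto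
      then show ?thesis
        using connected_component_eq x(2) assms(2) by metis
    qed (use x in auto)
    then obtain y where "y \<in> S" "C = \<phi> (connected_component_set S y)"
      using eq by metis
    then show "C \<in> \<phi> ` components S"
      by (auto simp: components_def)
  qed
  then show "finite (components (S \<union> G))" "card (components (S \<union> G)) \<le> card (components S)"
    using assms(1) by (meson finite_surj, meson surj_card_le)
qed

text \<open>Both pieces are relatively closed and disjoint, so no connected subset of the union
  meets both.\<close>

lemma components_Un_separated:
  fixes S G :: "'a::topological_space set"
  assumes cl: "closedin (top_of_set (S \<union> G)) S" "closedin (top_of_set (S \<union> G)) G"
    and dj: "S \<inter> G = {}" and G: "connected G" "G \<noteq> {}"
  shows "components (S \<union> G) = insert G (components S)"
proof -
  have sep: "T \<inter> S = {} \<or> T \<inter> G = {}" if "connected T" "T \<subseteq> S \<union> G" for T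
  proof -
    have "closedin (top_of_set T) (T \<inter> S)" "closedin (top_of_set T) (T \<inter> G)"
      using cl that(2) by (auto simp: closedin_closed; blast)+
    moreover have "(T \<inter> S) \<union> (T \<inter> G) = T" "(T \<inter> S) \<inter> (T \<inter> G) = {}"
      using that dj by auto
    ultimately show ?thesis
      using that(1) unfolding connected_closedin_eq by blast
  qed
  have 1: "connected_component_set (S \<union> G) x = connected_component_set S x" if "x \<in> S" for x
  proof
    show "connected_component_set (S \<union> G) x \<subseteq> connected_component_set S x"
    proof
      fix y assume "y \<in> connected_component_set (S \<union> G) x"
      then obtain T where T: "connected T" "T \<subseteq> S \<union> G" "x \<in> T" "y \<in> T"
        by (auto simp: connected_component_def)
      then have "T \<inter> G = {}" using sep[OF T(1,2)] that by auto
      then have "T \<subseteq> S" using T(2) by auto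
      then show "y \<in> connected_component_set S x"
        using T by (auto simp: connected_component_def)
    qed
  qed (auto intro!: connected_component_mono)
  have 2: "connected_component_set (S \<union> G) x = G" if "x \<in> G" for x
  proof
    show "connected_component_set (S \<union> G) x \<subseteq> G"
    proof
      fix y assume "y \<in> connected_component_set (S \<union> G) x"
      then obtain T where T: "connected T" "T \<subseteq> S \<union> G" "x \<in> T" "y \<in> T"
        by (auto simp: connected_component_def)
      then have "T \<inter> S = {}" using sep[OF T(1,2)] that by auto
      then show "y \<in> G" using T by auto
    qed
    show "G \<subseteq> connected_component_set (S \<union> G) x"
      using that G by (intro connected_component_maximal) auto
  qed
  have "components (S \<union> G) =
      connected_component_set (S \<union> G) ` S \<union> connected_component_set (S \<union> G) ` G"
    by (simp add: components_def image_Un)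
  also have "connected_component_set (S \<union> G) ` S = components S"
    using 1 by (auto simp: components_def)
  also have "connected_component_set (S \<union> G) ` G = {G}"
    using 2 G(2) by auto
  finally show ?thesis by simp
qed

section \<open>Compositions of rotated slit maps\<close>

definition rot_slit :: "real \<Rightarrow> complex \<Rightarrow> complex \<Rightarrow> complex" where
  "rot_slit c a w = a * disc_slit c (w / a)"

definition disc_aggregate :: "real \<Rightarrow> complex list \<Rightarrow> complex \<Rightarrow> complex" where
  "disc_aggregate c as = foldr (\<lambda>a h. rot_slit c a \<circ> h) as id"

lemma disc_aggregate_simps [simp]:
  "disc_aggregate c [] = id"
  "disc_aggregate c (a # as) = rot_slit c a \<circ> disc_aggregate c as"
  by (simp_all add: disc_aggregate_def)

lemma disc_aggregate_append: "disc_aggregate c (as @ bs) = disc_aggregate c as \<circ> disc_aggregate c bs"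
  by (induction as) (simp_all add: o_assoc)

lemma norm_rot_slit: "norm a = 1 \<Longrightarrow> 1 \<le> norm w \<Longrightarrow> 1 \<le> norm (rot_slit c a w)"
  by (simp add: rot_slit_def norm_mult norm_divide norm_disc_slit)

lemma norm_rot_slit_gt: "1 < c \<Longrightarrow> norm a = 1 \<Longrightarrow> 1 < norm w \<Longrightarrow> 1 < norm (rot_slit c a w)"
  by (simp add: rot_slit_def norm_mult norm_divide norm_disc_slit_gt)

lemma rot_slit_inj:
  assumes "1 < c" "norm a = 1" "rot_slit c a w = rot_slit c a z" "1 < norm w" "1 \<le> norm z"
  shows "w = z"
proof -
  have a: "a \<noteq> 0" using assms(2) by auto
  have "w / a = z / a"
    by (rule disc_slit_inj[OF assms(1)]) (use assms a in \<open>auto simp: rot_slit_def norm_divide\<close>)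
  then show ?thesis using a by simp
qed

lemma continuous_on_rot_slit:
  assumes "1 \<le> c" "norm a = 1"
  shows "continuous_on {w. 1 \<le> norm w} (rot_slit c a)"
  unfolding rot_slit_def[abs_def]
proof (intro continuous_on_mult continuous_on_const)
  show "continuous_on {w. 1 \<le> norm w} (\<lambda>w. disc_slit c (w / a))"
    by (rule continuous_on_compose2[OF continuous_on_disc_slit[OF assms(1)]])
      (use assms in \<open>auto intro!: continuous_intros simp: norm_divide\<close>)
qed

lemma rot_slit_circle:
  assumes "1 < c" "norm a = 1"
  shows "rot_slit c a ` sphere 0 1 = sphere 0 1 \<union> (\<lambda>z. a * z) ` disc_slit_segment c"
proof -
  have a: "a \<noteq> 0" using assms(2) by auto
  have s1: "(\<lambda>w. w / a) ` sphere 0 1 = sphere 0 1"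
    using assms(2) a by (auto simp: norm_divide norm_mult intro!: image_eqI[where x = "_ * a"])
  have s2: "(\<lambda>w. a * w) ` sphere 0 1 = sphere 0 1"
    using assms(2) a by (auto simp: norm_divide norm_mult intro!: image_eqI[where x = "_ / a"])
  have "rot_slit c a ` sphere 0 1 = (\<lambda>w. a * w) ` disc_slit c ` (\<lambda>w. w / a) ` sphere 0 1"
    by (simp add: rot_slit_def[abs_def] image_image)
  then show ?thesis
    by (simp add: s1 disc_slit_circle[OF assms(1)] image_Un s2)
qed

lemma norm_disc_aggregate:
  assumes "\<forall>a\<in>set as. norm a = 1" "1 \<le> norm w"
  shows "1 \<le> norm (disc_aggregate c as w)"
  using assms by (induction as) (simp_all add: norm_rot_slit)

lemma norm_disc_aggregate_gt:
  assumes "1 < c" "\<forall>a\<in>set as. norm a = 1" "1 < norm w"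
  shows "1 < norm (disc_aggregate c as w)"
  using assms by (induction as) (simp_all add: norm_rot_slit_gt)

lemma disc_aggregate_inj:
  assumes "1 < c" "\<forall>a\<in>set as. norm a = 1"
    and "disc_aggregate c as w = disc_aggregate c as z" "1 < norm w" "1 \<le> norm z"
  shows "w = z"
  using assms
proof (induction as)
  case (Cons a as)
  have "1 < norm (disc_aggregate c as w)" "1 \<le> norm (disc_aggregate c as z)"
    using Cons.prems by (auto intro!: norm_disc_aggregate_gt norm_disc_aggregate)
  moreover have "rot_slit c a (disc_aggregate c as w) = rot_slit c a (disc_aggregate c as z)"
    using Cons.prems(3) by simp
  ultimately have "disc_aggregate c as w = disc_aggregate c as z"
    using Cons.prems(1,2) rot_slit_inj[of c a] by simp
  then show ?case
    using Cons.IH Cons.prems by simp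
qed simp

lemma continuous_on_disc_aggregate:
  assumes "1 < c" "\<forall>a\<in>set as. norm a = 1"
  shows "continuous_on {w. 1 \<le> norm w} (disc_aggregate c as)"
  using assms
proof (induction as)
  case (Cons a as)
  have "continuous_on {w. 1 \<le> norm w} (\<lambda>w. rot_slit c a (disc_aggregate c as w))"
    by (rule continuous_on_compose2[OF continuous_on_rot_slit[of c a]])
      (use Cons in \<open>auto intro!: norm_disc_aggregate\<close>)
  then show ?case by (simp add: o_def)
qed simp

definition disc_trees :: "real \<Rightarrow> complex list \<Rightarrow> complex set set" where
  "disc_trees c as = components (disc_aggregate c as ` sphere 0 1 - sphere 0 1)"

lemma disc_trees_Nil: "disc_trees c [] = {}"
  by (simp add: disc_trees_def)

text \<open>The new slit is the image of the straight slit at \<open>a\<close> under the old aggregate map; it is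
  disjoint from the old cluster, and its only possible contact with it is the image of \<open>a\<close>.\<close>

context
  fixes c :: real and as :: "complex list" and a :: complex and K G
  assumes c: "1 < c" and as: "\<forall>a\<in>set as. norm a = 1" and a: "norm a = 1"
  defines "K \<equiv> disc_aggregate c as ` sphere 0 1 - sphere 0 1"
    and "G \<equiv> disc_aggregate c as ` (\<lambda>z. a * z) ` disc_slit_segment c"
begin

lemma norm_segment: "z \<in> disc_slit_segment c \<Longrightarrow> 1 < norm (a * z)"
  using a by (simp add: norm_mult norm_disc_slit_segment)

text \<open>The newest map acts first and sends the circle to the circle with a straight slit; the
  old aggregate map carries this to the old cluster together with G. As G lies strictly outside the
  disc, removing the circle leaves it intact.\<close>

lemma disc_aggregate_snoc_circle:
  "disc_aggregate c (as @ [a]) ` sphere 0 1 - sphere 0 1 = K \<union> G"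
proof -
  have "disc_aggregate c (as @ [a]) ` sphere 0 1 = disc_aggregate c as ` rot_slit c a ` sphere 0 1"
    by (simp add: disc_aggregate_append image_comp)
  also have "\<dots> = disc_aggregate c as ` sphere 0 1 \<union> G"
    by (simp add: rot_slit_circle[OF c a] image_Un G_def)
  finally have e: "disc_aggregate c (as @ [a]) ` sphere 0 1 = disc_aggregate c as ` sphere 0 1 \<union> G" .
  have "G \<inter> sphere 0 1 = {}"
    using norm_disc_aggregate_gt[OF c as norm_segment] by (force simp: G_def)
  then show ?thesis unfolding e K_def by auto
qed

lemma insert_G: "insert (disc_aggregate c as a) G =
    disc_aggregate c as ` (\<lambda>z. a * z) ` insert 1 (disc_slit_segment c)"
  by (simp add: G_def)

lemma segment_outside: "(\<lambda>z. a * z) ` insert 1 (disc_slit_segment c) \<subseteq> {w. 1 \<le> norm w}"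
  using norm_segment a by fastforce

lemma connected_G: "connected G"
  unfolding G_def
  by (intro connected_continuous_image continuous_intros connected_disc_slit_segment
      continuous_on_subset[OF continuous_on_disc_aggregate[OF c as]])
     (use segment_outside in auto)

lemma connected_insert_G: "connected (insert (disc_aggregate c as a) G)"
  unfolding insert_G
  by (intro connected_continuous_image continuous_intros connected_insert_disc_slit_segment[OF c]
      continuous_on_subset[OF continuous_on_disc_aggregate[OF c as]] segment_outside)

lemma compact_insert_G: "compact (insert (disc_aggregate c as a) G)"
  unfolding insert_G
  by (intro compact_continuous_image continuous_intros compact_insert_disc_slit_segment[OF c]
      continuous_on_subset[OF continuous_on_disc_aggregate[OF c as]] segment_outside)

lemma compact_cluster: "compact (disc_aggregate c as ` sphere 0 1)"
  by (intro compact_continuous_image continuous_on_subset[OF continuous_on_disc_aggregate[OF c as]]) auto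

text \<open>A common point would have one preimage on the circle and one strictly outside, which
  \<open>disc_aggregate_inj\<close> excludes.\<close>

lemma G_disjoint: "disc_aggregate c as ` sphere 0 1 \<inter> G = {}"
proof (rule ccontr)
  assume "disc_aggregate c as ` sphere 0 1 \<inter> G \<noteq> {}"
  then obtain x where x: "x \<in> disc_aggregate c as ` sphere 0 1" "x \<in> G"
    by blast
  from x(1) obtain w where w: "x = disc_aggregate c as w" "norm w = 1" by auto
  from x(2) obtain z where z: "x = disc_aggregate c as (a * z)" "z \<in> disc_slit_segment c"
    by (auto simp: G_def)
  have "a * z = w"
    by (rule disc_aggregate_inj[OF c as]) (use w z norm_segment in auto)
  then show False
    using w norm_segment[OF z(2)] by simp
qed

text \<open>Everything depends on the image of a, the base point of the new slit. If it lies on the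
  circle it is removed with the circle, so G is relatively closed and becomes a component of its
  own. Otherwise it belongs to K and G hangs on the component containing it.\<close>

lemma finite_disc_trees_snoc:
  assumes fin: "finite (disc_trees c as)"
  shows "finite (disc_trees c (as @ [a]))"
    and "norm (disc_aggregate c as a) = 1 \<Longrightarrow> card (disc_trees c (as @ [a])) = Suc (card (disc_trees c as))"
    and "norm (disc_aggregate c as a) \<noteq> 1 \<Longrightarrow> card (disc_trees c (as @ [a])) \<le> card (disc_trees c as)"
proof -
  have tr: "disc_trees c as = components K" "disc_trees c (as @ [a]) = components (K \<union> G)"
    by (simp_all only: disc_trees_def disc_aggregate_snoc_circle) (simp add: K_def)
  have KG: "K \<inter> G = {}" using G_disjoint by (auto simp: K_def)
  have Gne: "G \<noteq> {}" using disc_slit_segment_nonempty[OF c] by (simp add: G_def)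
  have new: "disc_trees c (as @ [a]) = insert G (disc_trees c as)" "G \<notin> disc_trees c as"
    if n: "norm (disc_aggregate c as a) = 1"
  proof -
    have "closedin (top_of_set (K \<union> G)) ((K \<union> G) \<inter> disc_aggregate c as ` sphere 0 1)"
      by (intro closedin_closed_Int compact_imp_closed compact_cluster)
    also have "(K \<union> G) \<inter> disc_aggregate c as ` sphere 0 1 = K"
      using G_disjoint by (auto simp: K_def)
    finally have clK: "closedin (top_of_set (K \<union> G)) K" .
    have "closedin (top_of_set (K \<union> G)) ((K \<union> G) \<inter> insert (disc_aggregate c as a) G)"
      by (intro closedin_closed_Int compact_imp_closed compact_insert_G)
    also have "(K \<union> G) \<inter> insert (disc_aggregate c as a) G = G"
      using n KG by (auto simp: K_def)
    finally have clG: "closedin (top_of_set (K \<union> G)) G" .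
    show "disc_trees c (as @ [a]) = insert G (disc_trees c as)"
      unfolding tr by (intro components_Un_separated clK clG KG connected_G Gne)
    show "G \<notin> disc_trees c as"
      using KG Gne in_components_subset[of G K] by (auto simp: tr)
  qed
  have old: "finite (disc_trees c (as @ [a]))"
     "card (disc_trees c (as @ [a])) \<le> card (disc_trees c as)"
    if "norm (disc_aggregate c as a) \<noteq> 1"
  proof -
    have "disc_aggregate c as a \<in> K"
      using that a by (simp add: K_def)
    then show "finite (disc_trees c (as @ [a]))"
      "card (disc_trees c (as @ [a])) \<le> card (disc_trees c as)"
      using components_Un_attached[OF _ _ connected_insert_G] fin unfolding tr by auto
  qed
  show "finite (disc_trees c (as @ [a]))"
    using new(1) old(1) fin by (cases "norm (disc_aggregate c as a) = 1") auto
  show "card (disc_trees c (as @ [a])) = Suc (card (disc_trees c as))"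
    if "norm (disc_aggregate c as a) = 1"
    using new[OF that] fin by simp
  show "card (disc_trees c (as @ [a])) \<le> card (disc_trees c as)"
    if "norm (disc_aggregate c as a) \<noteq> 1"
    using old[OF that] by simp
qed

end

lemma finite_disc_trees:
  assumes "1 < c" "\<forall>a\<in>set as. norm a = 1"
  shows "finite (disc_trees c as)"
  using assms(2)
  by (induction as rule: rev_induct) (auto simp: disc_trees_Nil intro!: finite_disc_trees_snoc(1)[OF assms(1)])

lemma disc_trees_increase_iff:
  assumes "1 < c" "\<forall>a\<in>set as. norm a = 1" "norm a = 1"
  shows "card (disc_trees c as) < card (disc_trees c (as @ [a])) \<longleftrightarrow> norm (disc_aggregate c as a) = 1"
  using finite_disc_trees_snoc(2,3)[OF assms finite_disc_trees[OF assms(1,2)]] by force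

section \<open>The cylinder as the exterior of the unit disc\<close>

lemma norm_f_map: "norm (f_map N z) = exp (Im z / real N)"
  by (simp add: f_map_def)

lemma f_map_add: "f_map N (z + w) = f_map N z * f_map N w"
proof -
  have "- \<i> * (z + w) / of_nat N = - \<i> * z / of_nat N + - \<i> * w / of_nat N"
    by (simp add: ring_distribs add_divide_distrib diff_divide_distrib)
  then show ?thesis by (simp only: f_map_def exp_add)
qed

lemma f_map_diff: "f_map N (z - w) = f_map N z / f_map N w"
proof -
  have "- \<i> * (z - w) / of_nat N = - \<i> * z / of_nat N - (- \<i> * w / of_nat N)"
    by (simp add: ring_distribs add_divide_distrib diff_divide_distrib)
  then show ?thesis by (simp only: f_map_def exp_diff)
qed

lemma f_map_nonzero [simp]: "f_map N z \<noteq> 0"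
  by (simp add: f_map_def)

lemma continuous_on_f_map: "continuous_on S (f_map N)"
  unfolding f_map_def[abs_def] by (cases "N = 0") (auto intro!: continuous_intros)

context
  fixes N :: nat
  assumes N: "1 \<le> N"
begin

lemma f_map_period: "f_map N (of_real (2 * pi * real N * of_int k)) = 1"
proof -
  have "Im (- \<i> * of_real (2 * pi * real N * of_int k) / of_nat N) = of_int (2 * (- k)) * pi"
    "Re (- \<i> * of_real (2 * pi * real N * of_int k) / of_nat N) = 0"
    using N by (simp_all add: Im_divide_of_nat Re_divide_of_nat)
  then show ?thesis
    unfolding f_map_def exp_eq_1 by (intro conjI exI)
qed

lemma cyl_proj_eq: obtains k :: int where "cyl_proj N z = z - of_real (2 * pi * real N * of_int k)"
proof
  show "cyl_proj N z = z - of_real (2 * pi * real N * of_int \<lfloor>Re z / \<bar>2 * pi * real N\<bar>\<rfloor>)"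
    by (simp add: cyl_proj_def rmod_def complex_eq_iff)
qed

lemma f_map_cyl_proj: "f_map N (cyl_proj N z) = f_map N z"
  by (rule cyl_proj_eq[of z]) (simp only: f_map_diff f_map_period div_by_1)

lemma cyl_proj_in_cylinder: "0 \<le> Im z \<Longrightarrow> cyl_proj N z \<in> cylinder N"
  using N rmod_nonneg[of "2 * pi * real N" "Re z"] rmod_less[of "2 * pi * real N" "Re z"]
  by (simp add: cyl_proj_def cylinder_def)

lemma f_map_eqD:
  assumes "f_map N z = f_map N w" "0 \<le> Re z" "Re z < 2 * pi * real N" "0 \<le> Re w" "Re w < 2 * pi * real N"
  shows "z = w"
proof -
  obtain n :: int where n: "- \<i> * z / of_nat N = - \<i> * w / of_nat N + of_real (real_of_int (2 * n) * pi) * \<i>"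
    using assms(1) unfolding f_map_def exp_eq by blast
  then have "z = w - of_real (2 * pi * real N * of_int n)"
    using N by (simp add: field_simps complex_eq_iff)
  then have re: "Re z = Re w - 2 * pi * real N * of_int n" and im: "Im z = Im w"
    by (simp_all add: complex_eq_iff)
  have "\<bar>2 * pi * real N * of_int n\<bar> < 2 * pi * real N"
    using re assms(2-) by linarith
  then have "\<bar>real_of_int n\<bar> < 1"
    using N by (simp add: abs_mult)
  then have "n = 0" by linarith
  then show ?thesis using re im by (simp add: complex_eq_iff)
qed

lemma inj_on_f_map: "inj_on (f_map N) (cylinder N)"
proof (rule inj_onI)
  fix z w assume "z \<in> cylinder N" "w \<in> cylinder N" "f_map N z = f_map N w"
  then show "z = w"
    using f_map_eqD[of z w] by (auto simp: cylinder_def)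
qed

text \<open>A preimage of w, computed by a logarithm relative to the value at z. It yields
  surjectivity with any z, and a local inverse when w is close to the value at z.\<close>

lemma f_map_Ln:
  assumes "w \<noteq> 0"
  shows "f_map N (z + \<i> * of_nat N * Ln (w / f_map N z)) = w"
proof -
  have "f_map N (\<i> * of_nat N * Ln (w / f_map N z)) = w / f_map N z"
    using N assms by (simp add: f_map_def)
  then show ?thesis by (simp add: f_map_add)
qed

lemma f_map_ge_1_iff: "1 \<le> norm (f_map N z) \<longleftrightarrow> 0 \<le> Im z"
  using N by (simp add: norm_f_map zero_le_divide_iff)

lemma f_map_gt_1_iff: "1 < norm (f_map N z) \<longleftrightarrow> 0 < Im z"
  using N by (simp add: norm_f_map zero_less_divide_iff)

lemma f_map_eq_1_iff: "norm (f_map N z) = 1 \<longleftrightarrow> Im z = 0"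
  using N by (simp add: norm_f_map)

lemma f_map_image: "f_map N ` cylinder N = {w. 1 \<le> norm w}"
proof (intro equalityI subsetI)
  fix w :: complex assume w: "w \<in> {w. 1 \<le> norm w}"
  then have "w \<noteq> 0" by auto
  then obtain z where z: "f_map N z = w"
    using f_map_Ln by blast
  then have "cyl_proj N z \<in> cylinder N"
    using w f_map_ge_1_iff[of z] by (intro cyl_proj_in_cylinder) auto
  then show "w \<in> f_map N ` cylinder N"
    using z f_map_cyl_proj[of z] by (metis imageI)
qed (auto simp: f_map_ge_1_iff cylinder_def)

lemma f_map_base_circle: "f_map N ` base_circle N = sphere 0 1"
proof (intro equalityI subsetI)
  fix w :: complex assume "w \<in> sphere 0 1"
  moreover from this obtain z where "z \<in> cylinder N" "f_map N z = w"
    using f_map_image by (auto simp: set_eq_iff image_iff Bex_def) (metis order_refl)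
  ultimately show "w \<in> f_map N ` base_circle N"
    using f_map_eq_1_iff[of z] by (auto simp: base_circle_def)
qed (auto simp: f_map_eq_1_iff base_circle_def)

text \<open>Open sets of the cylinder are tested by their preimages in the half-plane, where
  \<open>f_map\<close> is periodic and continuous. Openness needs local inverses, since the strip is
  cut open along its vertical sides.\<close>

lemma homeomorphic_map_f_map:
  "homeomorphic_map (cylinder_topology N) (top_of_set {w. 1 \<le> norm w}) (f_map N)"
proof (rule bijective_open_imp_homeomorphic_map)
  let ?E = "{w::complex. 1 \<le> norm w}"
  show "continuous_map (cylinder_topology N) (top_of_set ?E) (f_map N)"
    unfolding continuous_map_def
  proof (intro conjI allI impI)
    show "f_map N \<in> topspace (cylinder_topology N) \<rightarrow> topspace (top_of_set ?E)"
      using f_map_image by (auto simp: topspace_cylinder_topology[OF N])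
    fix U assume U: "openin (top_of_set ?E) U"
    have "{z. 0 \<le> Im z \<and> cyl_proj N z \<in> {x \<in> topspace (cylinder_topology N). f_map N x \<in> U}}
        = {z. 0 \<le> Im z} \<inter> f_map N -` U"
      using cyl_proj_in_cylinder by (auto simp: topspace_cylinder_topology[OF N] f_map_cyl_proj)
    moreover have "openin (top_of_set {z. 0 \<le> Im z}) ({z. 0 \<le> Im z} \<inter> f_map N -` U)"
      by (rule continuous_openin_preimage[OF continuous_on_f_map _ U]) (auto simp: f_map_ge_1_iff)
    ultimately show "openin (cylinder_topology N) {x \<in> topspace (cylinder_topology N). f_map N x \<in> U}"
      by (auto simp: openin_cylinder_topology topspace_cylinder_topology[OF N])
  qed
  show "open_map (cylinder_topology N) (top_of_set ?E) (f_map N)"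
    unfolding open_map_def
  proof (intro allI impI)
    fix U assume "openin (cylinder_topology N) U"
    then have U: "U \<subseteq> cylinder N"
      and pre: "openin (top_of_set {z. 0 \<le> Im z}) {z. 0 \<le> Im z \<and> cyl_proj N z \<in> U}"
      by (auto simp: openin_cylinder_topology)
    show "openin (top_of_set ?E) (f_map N ` U)"
      unfolding openin_contains_ball
    proof (intro conjI ballI)
      show "f_map N ` U \<subseteq> ?E" using U f_map_image by auto
      fix w assume "w \<in> f_map N ` U"
      then obtain z where z: "z \<in> U" "w = f_map N z" by auto
      have w0: "w \<noteq> 0" by (simp add: z)
      have zc: "cyl_proj N z = z" "0 \<le> Im z"
        using z U by (auto simp: cyl_proj_def cylinder_def complex_eq_iff subset_iff rmod_idem)
      obtain e where e: "e > 0" "ball z e \<inter> {z. 0 \<le> Im z} \<subseteq> {z. 0 \<le> Im z \<and> cyl_proj N z \<in> U}"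
        using pre z zc unfolding openin_contains_ball by auto
      \<comment> \<open>The local inverse through z. The logarithm is evaluated near 1, away from
        its cut, so it is continuous at w even when z sits on the seam of the strip;
        \<open>cyl_proj\<close> brings the result back.\<close>
      define \<psi> where "\<psi> = (\<lambda>v. z + \<i> * of_nat N * Ln (v / w))"
      have "isCont \<psi> w"
        unfolding \<psi>_def using w0 by (intro continuous_intros) auto
      moreover have "\<psi> w = z" using w0 by (simp add: \<psi>_def)
      ultimately obtain d where d: "d > 0" "\<And>v. dist v w < d \<Longrightarrow> dist (\<psi> v) z < e"
        using e(1) unfolding continuous_at_eps_delta by metis
      have "ball w d \<inter> ?E \<subseteq> f_map N ` U"
      proof
        fix v assume v: "v \<in> ball w d \<inter> ?E"
        have f: "f_map N (\<psi> v) = v"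
          unfolding \<psi>_def z(2) by (rule f_map_Ln) (use v in auto)
        then have "0 \<le> Im (\<psi> v)" using v f_map_ge_1_iff[of "\<psi> v"] by auto
        moreover have "\<psi> v \<in> ball z e" using d(2)[of v] v by (simp add: dist_commute)
        ultimately have "cyl_proj N (\<psi> v) \<in> U" using e(2) by auto
        then show "v \<in> f_map N ` U"
          using f f_map_cyl_proj[of "\<psi> v"] by (metis imageI)
      qed
      then show "\<exists>e>0. ball w e \<inter> ?E \<subseteq> f_map N ` U" using d(1) by blast
    qed
  qed
  show "f_map N ` topspace (cylinder_topology N) = topspace (top_of_set ?E)"
    by (simp add: topspace_cylinder_topology[OF N] f_map_image)
  show "inj_on (f_map N) (topspace (cylinder_topology N))"
    by (simp add: topspace_cylinder_topology[OF N] inj_on_f_map)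
qed

lemma inv_f_map:
  assumes "1 \<le> norm w"
  shows "inv_into (cylinder N) (f_map N) w \<in> cylinder N"
    and "f_map N (inv_into (cylinder N) (f_map N) w) = w"
proof -
  have w: "w \<in> f_map N ` cylinder N" using assms by (simp add: f_map_image)
  from inv_into_into[OF w] f_inv_into_f[OF w]
  show "inv_into (cylinder N) (f_map N) w \<in> cylinder N"
    and "f_map N (inv_into (cylinder N) (f_map N) w) = w" .
qed

lemma continuous_map_inv_f_map:
  "continuous_map (top_of_set {w. 1 \<le> norm w}) (cylinder_topology N) (inv_into (cylinder N) (f_map N))"
proof -
  obtain g where hm: "homeomorphic_maps (cylinder_topology N) (top_of_set {w. 1 \<le> norm w}) (f_map N) g"
    using homeomorphic_map_f_map homeomorphic_map_maps by blast
  then have g: "continuous_map (top_of_set {w. 1 \<le> norm w}) (cylinder_topology N) g"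
    "f_map N (g x) = x" if "1 \<le> norm x" for x
    using that by (auto simp: homeomorphic_maps_def)
  show ?thesis
  proof (rule continuous_map_eq[OF g(1)[of 1]], simp)
    fix w assume w: "w \<in> topspace (top_of_set {w::complex. 1 \<le> norm w})"
    then have "g w \<in> cylinder N"
      using g(1)[of 1] topspace_cylinder_topology[OF N] by (auto simp: continuous_map_def Pi_iff)
    moreover have "f_map N (g w) = f_map N (inv_into (cylinder N) (f_map N) w)"
      using g(2)[of w] inv_f_map(2)[of w] w by simp
    ultimately show "g w = inv_into (cylinder N) (f_map N) w"
      using inv_f_map(1)[of w] w by (simp add: inj_onD[OF inj_on_f_map])
  qed
qed

end

section \<open>The slit map in exterior disc coordinates\<close>

definition slit_factor :: "nat \<Rightarrow> real \<Rightarrow> real" where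
  "slit_factor N lam = cosh (lam / (2 * real N))"

lemma slit_factor_gt_1: "1 \<le> N \<Longrightarrow> 0 < lam \<Longrightarrow> 1 < slit_factor N lam"
  using cosh_real_strict_mono[of 0 "lam / (2 * real N)"] by (simp add: slit_factor_def)

text \<open>Since delta = tanh(lam / 2N), this is 1 - tanh^2 = 1 / cosh^2.\<close>

lemma delta_slit_factor: "1 - (delta N lam)\<^sup>2 = 1 / (slit_factor N lam)\<^sup>2"
proof -
  define t where "t = exp (lam / (2 * real N))"
  have t: "t > 0" by (simp add: t_def)
  have "exp (lam / real N) = t\<^sup>2"
    by (simp add: t_def power2_eq_square flip: exp_add)
  then have d: "delta N lam = 1 - 2 / (t\<^sup>2 + 1)"
    by (simp add: delta_def)
  have s: "slit_factor N lam = (t\<^sup>2 + 1) / (2 * t)"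
    using t by (simp add: slit_factor_def cosh_def t_def exp_minus field_simps power2_eq_square)
  have p: "t\<^sup>2 + 1 > 0" by (simp add: add_nonneg_pos)
  have "(t\<^sup>2 + 1)\<^sup>2 * (1 - (delta N lam)\<^sup>2) = (t\<^sup>2 + 1)\<^sup>2 - (t\<^sup>2 - 1)\<^sup>2"
  proof -
    have "(t\<^sup>2 + 1) * delta N lam = t\<^sup>2 - 1"
      unfolding d using p by (simp add: field_simps)
    then have "((t\<^sup>2 + 1) * delta N lam)\<^sup>2 = (t\<^sup>2 - 1)\<^sup>2" by simp
    then show ?thesis by (simp only: power_mult_distrib) (simp add: right_diff_distrib)
  qed
  also have "\<dots> = (2 * t)\<^sup>2" by (simp add: power2_eq_square algebra_simps)
  finally have "1 - (delta N lam)\<^sup>2 = (2 * t)\<^sup>2 / (t\<^sup>2 + 1)\<^sup>2"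
    using p by (simp add: eq_divide_eq mult.commute)
  then show ?thesis
    unfolding s by (simp add: power_divide)
qed

lemma delta_bounds:
  assumes "1 \<le> N" "0 < lam"
  shows "0 < delta N lam" "delta N lam < 1"
proof -
  define y where "y = exp (lam / real N)"
  have "y > 1" using assms by (simp add: y_def)
  then show "0 < delta N lam" "delta N lam < 1"
    by (simp_all add: delta_def flip: y_def)
qed

lemma Im_g_map:
  assumes "1 < norm w"
  shows "0 < Im (g_map w)"
proof -
  have n: "w \<noteq> -1" using assms by auto
  then have n1: "norm (w + 1) > 0" by (simp add: add_eq_0_iff2)
  have "Im (g_map w) = Re ((w - 1) * cnj (w + 1)) / (norm (w + 1))\<^sup>2"
    by (simp add: g_map_def complex_div_cnj[of _ "w + 1"] algebra_simps Re_divide Im_divide cmod_power2 diff_divide_distrib add_divide_distrib)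
  also have "Re ((w - 1) * cnj (w + 1)) = (norm w)\<^sup>2 - 1"
    unfolding cmod_power2 by (simp add: algebra_simps power2_eq_square)
  finally show ?thesis
    using assms n1 by (simp add: one_less_power)
qed

lemma g_map_power2:
  assumes "1 < norm w"
  shows "(g_map w)\<^sup>2 = 4 / joukowski w - 1"
proof -
  have n: "w + 1 \<noteq> 0" "w \<noteq> 0" using assms by (auto simp: add_eq_0_iff2)
  then show ?thesis
    by (simp add: g_map_def joukowski_def power_mult_distrib power_divide field_simps)
      (simp add: power2_eq_square algebra_simps)
qed

lemma inj_on_g_map: "inj_on g_map {w. 1 < norm w}"
proof (rule inj_onI)
  fix w z assume "w \<in> {w. 1 < norm w}" "z \<in> {w. 1 < norm w}" and eq: "g_map w = g_map z"
  then have "w + 1 \<noteq> 0" "z + 1 \<noteq> 0" by (auto simp: add_eq_0_iff2)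
  then show "w = z" using eq by (simp add: g_map_def field_simps)
qed

context
  fixes N :: nat and lam :: real
  assumes N: "1 \<le> N" and lam: "0 < lam"
begin

text \<open>By \<open>g_map_power2\<close> the squares of both sides agree. Both sides lie in the
  open upper half-plane, which settles the sign.\<close>

lemma g_map_disc_slit:
  assumes "1 < norm w"
  shows "g_map (disc_slit (slit_factor N lam) w) = phi_map (delta N lam) (g_map w)"
proof -
  let ?c = "slit_factor N lam" and ?d = "delta N lam"
  have c: "?c > 1" using N lam by (rule slit_factor_gt_1)
  have w': "1 < norm (disc_slit ?c w)" using norm_disc_slit_gt[OF c assms] .
  have "1 - (complex_of_real ?d)\<^sup>2 = of_real (1 - ?d\<^sup>2)" by simp
  then have d: "1 - (complex_of_real ?d)\<^sup>2 = 1 / (of_real ?c)\<^sup>2"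
    unfolding delta_slit_factor by simp
  then have d2: "(complex_of_real ?d)\<^sup>2 = 1 - 1 / (of_real ?c)\<^sup>2"
    by (simp add: algebra_simps)
  have "(g_map (disc_slit ?c w))\<^sup>2 = 4 / (of_real (?c\<^sup>2) * joukowski w) - 1"
    by (simp only: g_map_power2[OF w'] joukowski_disc_slit)
  also have "\<dots> = (g_map w)\<^sup>2 * (1 - (of_real ?d)\<^sup>2) - (of_real ?d)\<^sup>2"
  proof -
    have "4 / (of_real (?c\<^sup>2) * joukowski w) = 4 / joukowski w * (1 / (of_real ?c)\<^sup>2)"
      by (simp add: mult.commute)
    then show ?thesis
      unfolding d unfolding d2 g_map_power2[OF assms] by (simp only: ring_distribs mult_1_left) simp
  qed
  also have "\<dots> = (phi_map ?d (g_map w))\<^sup>2"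
    by (rule phi_map_branch(1)[OF delta_bounds[OF N lam] Im_g_map[OF assms], symmetric])
  finally have "g_map (disc_slit ?c w) = phi_map ?d (g_map w) \<or>
      g_map (disc_slit ?c w) = - phi_map ?d (g_map w)"
    by (simp add: power2_eq_iff)
  moreover have "0 < Im (phi_map ?d (g_map w))"
    by (rule phi_map_branch(2)[OF delta_bounds[OF N lam] Im_g_map[OF assms]])
  ultimately show ?thesis
    using Im_g_map[OF w'] by auto
qed

lemma slit_interior_eq:
  assumes "0 < Im z"
  shows "slit_interior N lam z =
    inv_into (cylinder N) (f_map N) (disc_slit (slit_factor N lam) (f_map N z))"
proof -
  have f: "1 < norm (f_map N z)" using assms f_map_gt_1_iff[OF N] by auto
  have "inv_into {w. 1 < norm w} g_map (g_map (disc_slit (slit_factor N lam) (f_map N z)))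
      = disc_slit (slit_factor N lam) (f_map N z)"
    using norm_disc_slit_gt[OF slit_factor_gt_1[OF N lam] f]
    by (intro inv_into_f_f inj_on_g_map) auto
  then show ?thesis
    by (simp add: slit_interior_def g_map_disc_slit[OF f])
qed

text \<open>The limit is computed in the exterior disc, where \<open>disc_slit\<close> is continuous
  up to the boundary, and then carried back by the inverse homeomorphism.\<close>

lemma limitin_slit_interior:
  assumes "Im z = 0"
  shows "limitin (cylinder_topology N) (slit_interior N lam)
    (inv_into (cylinder N) (f_map N) (disc_slit (slit_factor N lam) (f_map N z))) (at z within {w. 0 < Im w})"
proof -
  let ?d = "\<lambda>z. disc_slit (slit_factor N lam) (f_map N z)"
  have "continuous_on {z. 0 \<le> Im z} ?d"
    by (rule continuous_on_compose2[OF continuous_on_disc_slit continuous_on_f_map])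
      (use slit_factor_gt_1[OF N lam] f_map_ge_1_iff[OF N] in auto)
  then have "(?d \<longlongrightarrow> ?d z) (at z within {z. 0 \<le> Im z})"
    using assms by (simp add: continuous_on)
  then have t: "(?d \<longlongrightarrow> ?d z) (at z within {z. 0 < Im z})"
    by (rule tendsto_within_subset) auto
  have "limitin (top_of_set {w. 1 \<le> norm w}) ?d (?d z) (at z within {z. 0 < Im z})"
    unfolding limitin_subtopology
  proof (intro conjI)
    have "1 \<le> norm (?d w)" if "0 \<le> Im w" for w
      using that by (intro norm_disc_slit) (simp add: f_map_ge_1_iff[OF N])
    then show "?d z \<in> {w. 1 \<le> norm w}"
      "\<forall>\<^sub>F w in at z within {z. 0 < Im z}. ?d w \<in> {w. 1 \<le> norm w}"
      using assms by (simp_all add: eventually_at_filter)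
  qed (use t in simp)
  from continuous_map_limit[OF continuous_map_inv_f_map[OF N] this]
  have "limitin (cylinder_topology N) (inv_into (cylinder N) (f_map N) \<circ> ?d)
    (inv_into (cylinder N) (f_map N) (?d z)) (at z within {w. 0 < Im w})" .
  then show ?thesis
    by (rule limitin_transform_eventually[rotated])
      (auto simp: eventually_at_filter slit_interior_eq)
qed

text \<open>For boundary points the definite description has to be shown to denote. Existence is the
  preceding lemma; for uniqueness, two limits have the same image under \<open>f_map\<close>,
  because the plane is Hausdorff and the filter nontrivial, and \<open>f_map\<close> is injective on
  the cylinder.\<close>

lemma slit_map_eq:
  assumes "0 \<le> Im z"
  shows "slit_map N lam z =
    inv_into (cylinder N) (f_map N) (disc_slit (slit_factor N lam) (f_map N z))"
proof (cases "0 < Im z")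
  case False
  then have z: "Im z = 0" using assms by simp
  let ?F = "at z within {w. 0 < Im w}"
  have nt: "?F \<noteq> bot"
  proof -
    have "z islimpt {w. 0 < Im w}"
      unfolding islimpt_approachable
    proof (intro allI impI)
      fix e :: real assume "e > 0"
      then show "\<exists>x'\<in>{w. 0 < Im w}. x' \<noteq> z \<and> dist x' z < e"
        using z by (intro bexI[of _ "z + \<i> * of_real (e / 2)"]) (auto simp: dist_norm norm_mult)
    qed
    then show ?thesis by (simp add: trivial_limit_within)
  qed
  have "(THE l. limitin (cylinder_topology N) (slit_interior N lam) l ?F) =
      inv_into (cylinder N) (f_map N) (disc_slit (slit_factor N lam) (f_map N z))" (is "_ = ?l")
  proof (rule the_equality)
    show "limitin (cylinder_topology N) (slit_interior N lam) ?l ?F"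
      by (rule limitin_slit_interior[OF z])
    fix l assume l: "limitin (cylinder_topology N) (slit_interior N lam) l ?F"
    have cm: "continuous_map (cylinder_topology N) (top_of_set {w. 1 \<le> norm w}) (f_map N)"
      using homeomorphic_imp_continuous_map[OF homeomorphic_map_f_map[OF N]] .
    have "((f_map N \<circ> slit_interior N lam) \<longlongrightarrow> f_map N l) ?F"
      "((f_map N \<circ> slit_interior N lam) \<longlongrightarrow> f_map N ?l) ?F"
      using continuous_map_limit[OF cm l] continuous_map_limit[OF cm limitin_slit_interior[OF z]]
      by (auto simp: limitin_subtopology)
    then have "f_map N l = f_map N ?l"
      by (rule tendsto_unique[OF nt])
    moreover have "l \<in> cylinder N" "?l \<in> cylinder N"
      using limitin_topspace[OF l] limitin_topspace[OF limitin_slit_interior[OF z]]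
      by (simp_all add: topspace_cylinder_topology[OF N])
    ultimately show "l = ?l"
      by (rule inj_onD[OF inj_on_f_map[OF N]])
  qed
  then show ?thesis using False by (simp add: slit_map_def)
qed (simp add: slit_map_def slit_interior_eq)

text \<open>Translation by x becomes rotation by the image of x. The real parts in the definition
  combine to x plus a multiple of the period, which \<open>f_map\<close> does not see.\<close>

lemma slit_map_at:
  assumes "0 \<le> Im z"
  shows "slit_map_at N lam x z \<in> cylinder N"
    and "f_map N (slit_map_at N lam x z) = rot_slit (slit_factor N lam) (f_map N (of_real x)) (f_map N z)"
proof -
  let ?s = "slit_map N lam (z - of_real x)"
  have s: "?s \<in> cylinder N"
    "f_map N ?s = disc_slit (slit_factor N lam) (f_map N z / f_map N (of_real x))"
  proof -
    have z: "0 \<le> Im (z - of_real x)" using assms by simp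
    then have "1 \<le> norm (disc_slit (slit_factor N lam) (f_map N (z - of_real x)))"
      by (intro norm_disc_slit) (simp only: f_map_ge_1_iff[OF N])
    from inv_f_map[OF N this] show "?s \<in> cylinder N"
      "f_map N ?s = disc_slit (slit_factor N lam) (f_map N z / f_map N (of_real x))"
      unfolding slit_map_eq[OF z] f_map_diff[symmetric] .
  qed
  let ?r = "Re (z - of_real x)"
  define k where "k = \<lfloor>?r / \<bar>2 * pi * real N\<bar>\<rfloor>"
  have "of_real (Re z) + ?s - of_real (?r rmod (2 * pi * real N))
      = of_real x + ?s + of_real (2 * pi * real N * of_int k)"
    by (simp add: rmod_def k_def)
  then have e: "slit_map_at N lam x z = cyl_proj N (of_real x + ?s + of_real (2 * pi * real N * of_int k))"
    by (simp only: slit_map_at_def)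
  show "slit_map_at N lam x z \<in> cylinder N"
    unfolding e using s by (intro cyl_proj_in_cylinder[OF N]) (simp add: cylinder_def)
  show "f_map N (slit_map_at N lam x z) = rot_slit (slit_factor N lam) (f_map N (of_real x)) (f_map N z)"
    by (simp only: e f_map_cyl_proj[OF N] f_map_add f_map_period[OF N] s rot_slit_def mult_1_right)
qed

definition attachment_points :: "(real \<times> real) list \<Rightarrow> complex list" where
  "attachment_points ps = map (\<lambda>p. f_map N (of_real (snd p))) ps"

lemma foldr_slit_map_at:
  assumes "z \<in> cylinder N"
  shows "foldr (\<lambda>(s, x) h. slit_map_at N lam x \<circ> h) ps id z \<in> cylinder N \<and>
    f_map N (foldr (\<lambda>(s, x) h. slit_map_at N lam x \<circ> h) ps id z) =
      disc_aggregate (slit_factor N lam) (attachment_points ps) (f_map N z)"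
proof (induction ps)
  case (Cons p ps)
  then show ?case
    using slit_map_at by (auto simp: attachment_points_def cylinder_def case_prod_beta)
qed (use assms in \<open>simp add: attachment_points_def\<close>)

text \<open>Components correspond bijectively under the homeomorphism \<open>f_map\<close>, so the
  trees can be counted in the exterior disc.\<close>

lemma num_trees_eq:
  "num_trees N lam Q t = card (disc_trees (slit_factor N lam) (attachment_points (arrivals Q t)))"
proof -
  let ?A = "aggregate_map N lam Q t" and ?f = "f_map N" and ?E = "{w::complex. 1 \<le> norm w}"
  let ?D = "disc_aggregate (slit_factor N lam) (attachment_points (arrivals Q t))"
  define X where "X = ?A ` base_circle N - base_circle N"
  have A: "?A z \<in> cylinder N" "?f (?A z) = ?D (?f z)" if "z \<in> cylinder N" for z
    using foldr_slit_map_at[OF that, of "arrivals Q t"] by (simp_all add: aggregate_map_def)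
  have bc: "base_circle N \<subseteq> cylinder N" by (auto simp: base_circle_def)
  have Ab: "?A ` base_circle N \<subseteq> cylinder N" using A bc by auto
  have X: "X \<subseteq> cylinder N" using Ab by (auto simp: X_def)
  have "?f ` X = ?f ` ?A ` base_circle N - ?f ` base_circle N"
    unfolding X_def by (rule inj_on_image_set_diff[OF inj_on_f_map[OF N]]) (use Ab bc in auto)
  also have "?f ` ?A ` base_circle N = ?D ` ?f ` base_circle N"
    using A bc by (force simp: image_image)
  finally have fX: "?f ` X = ?D ` sphere 0 1 - sphere 0 1"
    by (simp add: f_map_base_circle[OF N])
  have "homeomorphic_map (subtopology (cylinder_topology N) X) (subtopology (top_of_set ?E) (?f ` X)) ?f"
    by (rule homeomorphic_map_subtopologies[OF homeomorphic_map_f_map[OF N]])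
      (use X f_map_image[OF N] in \<open>auto simp: topspace_cylinder_topology[OF N]\<close>)
  moreover have "subtopology (top_of_set ?E) (?f ` X) = top_of_set (?f ` X)"
  proof -
    have "?E \<inter> ?f ` X = ?f ` X" using X f_map_image[OF N] by auto
    then show ?thesis by (simp add: subtopology_subtopology)
  qed
  ultimately have "components (?f ` X) = (image ?f) ` connected_components_of (subtopology (cylinder_topology N) X)"
    by (metis homeomorphic_map_connected_components_of connected_components_of_top_of_set)
  moreover have "inj_on (image ?f) (connected_components_of (subtopology (cylinder_topology N) X))"
  proof (rule inj_on_subset[OF inj_on_image_Pow])
    show "inj_on ?f (cylinder N)" by (rule inj_on_f_map[OF N])
    show "connected_components_of (subtopology (cylinder_topology N) X) \<subseteq> Pow (cylinder N)"
      using X connected_components_of_subset by fastforce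
  qed
  ultimately have "card (components (?f ` X)) = card (trees N lam Q t)"
    by (simp add: card_image trees_def X_def)
  then show ?thesis
    by (simp add: num_trees_def disc_trees_def fX)
qed

end

section \<open>The action on boundary angles\<close>

text \<open>The boundary action in angles: J at angle u equals (2 cos(u / 2N))^2, so scaling by c^2
  replaces cos(u / 2N) by c times it. The clamp makes the formula continuous on the whole line; it
  is active exactly at the angles that are sent strictly into the slit.\<close>

definition base_map :: "nat \<Rightarrow> real \<Rightarrow> real \<Rightarrow> real" where
  "base_map N c u = 2 * real N * arccos (max (-1) (min 1 (c * cos (u / (2 * real N)))))"

text \<open>The solution of c cos(u / 2N) = 1: half the length of the arc that is folded into the
  slit.\<close>

definition arc_radius :: "nat \<Rightarrow> real \<Rightarrow> real" where
  "arc_radius N c = 2 * real N * arccos (1 / c)"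

text \<open>The interval is closed because its end points go to the base point of the slit, which is
  still on the circle.\<close>

definition survives :: "nat \<Rightarrow> real \<Rightarrow> real \<Rightarrow> real \<Rightarrow> bool" where
  "survives N c x y \<longleftrightarrow> (y - x) rmod (2 * pi * real N) \<in> {arc_radius N c..2 * pi * real N - arc_radius N c}"

definition pushed :: "nat \<Rightarrow> real \<Rightarrow> real \<Rightarrow> real \<Rightarrow> real" where
  "pushed N c x y = (x + base_map N c ((y - x) rmod (2 * pi * real N))) rmod (2 * pi * real N)"

text \<open>Particles are listed with the most recent one first: the latest slit map acts first on a
  boundary point.\<close>

fun exposed :: "nat \<Rightarrow> real \<Rightarrow> real list \<Rightarrow> real \<Rightarrow> bool" where
  "exposed N c [] y \<longleftrightarrow> True"
| "exposed N c (x # xs) y \<longleftrightarrow> survives N c x y \<and> exposed N c xs (pushed N c x y)"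

context
  fixes N :: nat and c :: real
  assumes N: "1 \<le> N" and c: "1 < c"
begin

lemma f_map_rmod: "f_map N (of_real (x rmod (2 * pi * real N))) = f_map N (of_real x)"
proof -
  have "complex_of_real (x rmod (2 * pi * real N)) = cyl_proj N (of_real x)"
    by (simp add: cyl_proj_def complex_eq_iff)
  then show ?thesis by (simp add: f_map_cyl_proj[OF N])
qed

lemma Re_f_map_of_real: "Re (f_map N (of_real u)) = cos (u / real N)"
  and Im_f_map_of_real: "Im (f_map N (of_real u)) = - sin (u / real N)"
  and norm_f_map_of_real: "norm (f_map N (of_real u)) = 1"
  by (simp_all add: f_map_def Re_exp Im_exp Re_divide_of_nat Im_divide_of_nat)

lemma joukowski_f_map: "joukowski (f_map N (of_real u)) = of_real ((2 * cos (u / (2 * real N)))\<^sup>2)"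
proof -
  have "2 + 2 * cos (u / real N) = (2 * cos (u / (2 * real N)))\<^sup>2"
    using cos_double_cos[of "u / (2 * real N)"] by (simp add: power_mult_distrib)
  then show ?thesis
    by (simp only: joukowski_unit[OF norm_f_map_of_real] Re_f_map_of_real)
qed

lemma arccos_inverse: "0 < arccos (1 / c)" "arccos (1 / c) < pi / 2"
proof -
  have *: "0 < 1 / c" "1 / c < 1" using c by auto
  then have "- 1 \<le> 1 / c" by linarith
  then show "0 < arccos (1 / c)" "arccos (1 / c) < pi / 2"
    using arccos_less_arccos[of "1 / c" 1, OF _ *(2)] arccos_less_arccos[of 0 "1 / c", OF _ *(1)] *(2)
    by auto
qed

lemma arc_radius_bounds: "0 < arc_radius N c" "2 * arc_radius N c < 2 * pi * real N"
  using arccos_inverse N mult_strict_left_mono[of "arccos (1 / c)" "pi / 2" "4 * real N"] by (auto simp: arc_radius_def)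

lemma scaled_cos_le_1_iff:
  assumes "0 \<le> u" "u < 2 * pi * real N"
  shows "\<bar>c * cos (u / (2 * real N))\<bar> \<le> 1 \<longleftrightarrow> u \<in> {arc_radius N c..2 * pi * real N - arc_radius N c}"
proof -
  define \<theta> \<beta> where "\<theta> = u / (2 * real N)" and "\<beta> = arccos (1 / c)"
  have \<theta>: "0 \<le> \<theta>" "\<theta> \<le> pi" using assms N by (auto simp: \<theta>_def field_simps)
  have \<beta>: "0 \<le> \<beta>" "\<beta> \<le> pi" "cos \<beta> = 1 / c"
    using arccos_inverse c cos_arccos[of "1 / c"] order_trans[of "-1" 0 "1 / c"] by (auto simp: \<beta>_def)
  have "\<bar>c * cos \<theta>\<bar> \<le> 1 \<longleftrightarrow> cos \<theta> \<le> 1 / c \<and> - (1 / c) \<le> cos \<theta>"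
    using c by (auto simp: abs_le_iff field_simps)
  also have "cos \<theta> \<le> 1 / c \<longleftrightarrow> \<beta> \<le> \<theta>"
    using cos_mono_le_eq[OF \<theta> \<beta>(1,2)] \<beta>(3) by simp
  also have "- (1 / c) = cos (pi - \<beta>)" using \<beta>(3) by simp
  also have "cos (pi - \<beta>) \<le> cos \<theta> \<longleftrightarrow> \<theta> \<le> pi - \<beta>"
    using \<theta> \<beta> by (intro cos_mono_le_eq) auto
  also have "\<beta> \<le> \<theta> \<longleftrightarrow> arc_radius N c \<le> u"
    using N by (simp add: \<beta>_def \<theta>_def arc_radius_def field_simps)
  also have "\<theta> \<le> pi - \<beta> \<longleftrightarrow> u \<le> 2 * pi * real N - arc_radius N c"
    using N by (simp add: \<beta>_def \<theta>_def arc_radius_def field_simps)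
  finally show ?thesis by (simp add: \<theta>_def)
qed

text \<open>A Joukowski value determines a point of the circle up to conjugation. The half-plane is
  the same on both sides because C = c cos \<theta> has the sign of cos \<theta>, and the imaginary
  parts carry the opposite sign of C and of cos \<theta>.\<close>

lemma disc_slit_f_map:
  assumes "0 \<le> u" "u < 2 * pi * real N"
  shows "norm (disc_slit c (f_map N (of_real u))) = 1 \<longleftrightarrow> u \<in> {arc_radius N c..2 * pi * real N - arc_radius N c}"
    and "u \<in> {arc_radius N c..2 * pi * real N - arc_radius N c} \<Longrightarrow>
      disc_slit c (f_map N (of_real u)) = f_map N (of_real (base_map N c u))"
proof -
  define \<theta> where "\<theta> = u / (2 * real N)"
  define C where "C = c * cos \<theta>"
  define w where "w = f_map N (of_real u)"
  have \<theta>: "0 \<le> \<theta>" "\<theta> < pi" using assms N by (auto simp: \<theta>_def field_simps)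
  have sin: "0 \<le> sin \<theta>" using \<theta> by (intro sin_ge_zero) auto
  have w1: "norm w = 1" by (simp add: w_def norm_f_map_of_real)
  have Jw: "joukowski w = of_real ((2 * cos \<theta>)\<^sup>2)"
    unfolding w_def joukowski_f_map \<theta>_def ..
  have cJ: "of_real (c\<^sup>2) * joukowski w = of_real ((2 * C)\<^sup>2)"
    by (simp add: Jw C_def power_mult_distrib)
  have iff: "\<bar>C\<bar> \<le> 1 \<longleftrightarrow> u \<in> {arc_radius N c..2 * pi * real N - arc_radius N c}"
    using scaled_cos_le_1_iff[OF assms] by (simp add: C_def \<theta>_def)
  have Imw: "Im w = - 2 * (sin \<theta> * cos \<theta>)"
    using sin_double[of \<theta>] by (simp add: w_def Im_f_map_of_real \<theta>_def)
  have eq: "disc_slit c w = f_map N (complex_of_real (base_map N c u))" if C1: "\<bar>C\<bar> \<le> 1"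
  proof -
    define s where "s = f_map N (of_real (base_map N c u))"
    have b: "base_map N c u = 2 * real N * arccos C"
      using C1 by (simp add: base_map_def C_def \<theta>_def)
    have s1: "norm s = 1" by (simp add: s_def norm_f_map_of_real)
    have "base_map N c u / (2 * real N) = arccos C" using N by (simp add: b)
    then have Js: "joukowski s = of_real ((2 * C)\<^sup>2)"
      unfolding s_def joukowski_f_map using C1 by (simp add: abs_le_iff)
    have "base_map N c u / real N = 2 * arccos C" using N by (simp add: b)
    then have "Im s = - sin (2 * arccos C)"
      by (simp add: s_def Im_f_map_of_real)
    also have "\<dots> = - 2 * (sqrt (1 - C\<^sup>2) * C)"
      using C1 by (simp add: sin_double sin_arccos_abs abs_le_iff)
    finally have Ims: "Im s = - 2 * (sqrt (1 - C\<^sup>2) * C)" .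
    have sq: "0 \<le> sqrt (1 - C\<^sup>2)"
      using C1 by (simp add: abs_square_le_1)
    show ?thesis
    proof (cases "0 \<le> Im w")
      case True
      \<comment> \<open>The degenerate case is Im w = 0 with a positive cosine. It forces \<theta> =
        0, where C = c > 1 contradicts the assumed bound on C.\<close>
      have "C \<le> 0"
      proof (rule ccontr)
        assume "\<not> C \<le> 0"
        then have cpos: "cos \<theta> > 0" using c by (simp add: C_def not_le zero_less_mult_iff)
        then have "sin \<theta> = 0"
          using True sin unfolding Imw by (simp add: mult_le_0_iff)
        then have "\<theta> = 0" using \<theta> sin_gt_zero[of \<theta>] by force
        then show False using C1 c by (simp add: C_def)
      qed
      then have "0 \<le> Im s" unfolding Ims using sq by (simp add: mult_nonneg_nonpos)
      then have "joukowski_inv (joukowski s) = s"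
        by (rule joukowski_inv_joukowski_unit[OF s1])
      then show ?thesis
        unfolding w_def[symmetric] s_def[symmetric] using True by (simp only: disc_slit_def cJ Js if_True)
    next
      case False
      then have "0 < sin \<theta> * cos \<theta>" unfolding Imw by linarith
      then have "0 \<le> C" using sin c by (simp add: C_def zero_less_mult_iff)
      then have "0 \<le> Im (cnj s)" using sq by (simp add: Ims)
      then have "joukowski_inv (joukowski (cnj s)) = cnj s"
        by (intro joukowski_inv_joukowski_unit) (simp_all add: s1)
      moreover have "of_real (c\<^sup>2) * joukowski (cnj w) = joukowski (cnj s)"
        using cJ Js Jw by (simp add: cnj_joukowski)
      ultimately show ?thesis
        using False by (simp add: disc_slit_def flip: w_def s_def)
    qed
  qed
  have ne: "norm (disc_slit c w) \<noteq> 1" if "\<not> \<bar>C\<bar> \<le> 1"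
  proof
    assume n: "norm (disc_slit c w) = 1"
    have "complex_of_real ((2 * C)\<^sup>2) = of_real (2 + 2 * Re (disc_slit c w))"
      using joukowski_unit[OF n] by (simp only: joukowski_disc_slit cJ)
    then have "(2 * C)\<^sup>2 = 2 + 2 * Re (disc_slit c w)"
      by (simp only: of_real_eq_iff)
    also have "\<dots> \<le> 4" using complex_Re_le_cmod[of "disc_slit c w"] n by simp
    finally have "C\<^sup>2 \<le> 1" by (simp add: power_mult_distrib)
    then show False using that by (simp add: abs_square_le_1)
  qed
  show "u \<in> {arc_radius N c..2 * pi * real N - arc_radius N c} \<Longrightarrow>
      disc_slit c (f_map N (of_real u)) = f_map N (of_real (base_map N c u))"
    using eq by (simp only: iff w_def)
  show "norm (disc_slit c (f_map N (of_real u))) = 1 \<longleftrightarrow> u \<in> {arc_radius N c..2 * pi * real N - arc_radius N c}"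
    using eq ne norm_f_map_of_real iff unfolding w_def by metis
qed

lemma rot_slit_f_map:
  "norm (rot_slit c (f_map N (of_real x)) (f_map N (of_real y))) = 1 \<longleftrightarrow> survives N c x y"
  "survives N c x y \<Longrightarrow> rot_slit c (f_map N (of_real x)) (f_map N (of_real y)) = f_map N (of_real (pushed N c x y))"
proof -
  define u where "u = (y - x) rmod (2 * pi * real N)"
  have u: "0 \<le> u" "u < 2 * pi * real N"
    using N by (auto simp: u_def rmod_nonneg rmod_less)
  have "f_map N (of_real y) / f_map N (of_real x) = f_map N (of_real u)"
    by (simp add: u_def f_map_rmod flip: f_map_diff)
  then have r: "rot_slit c (f_map N (of_real x)) (f_map N (of_real y)) =
      f_map N (of_real x) * disc_slit c (f_map N (of_real u))"
    by (simp add: rot_slit_def)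
  show "norm (rot_slit c (f_map N (of_real x)) (f_map N (of_real y))) = 1 \<longleftrightarrow> survives N c x y"
    using disc_slit_f_map(1)[OF u] by (simp add: r norm_mult norm_f_map_of_real survives_def flip: u_def)
  assume "survives N c x y"
  then have "disc_slit c (f_map N (of_real u)) = f_map N (of_real (base_map N c u))"
    using disc_slit_f_map(2)[OF u] by (simp add: survives_def flip: u_def)
  then show "rot_slit c (f_map N (of_real x)) (f_map N (of_real y)) = f_map N (of_real (pushed N c x y))"
    by (simp add: r pushed_def f_map_rmod flip: f_map_add u_def)
qed

text \<open>A point that leaves the circle stays strictly outside under all remaining maps, so
  survival can be tested one map at a time. The reversal reconciles \<open>disc_aggregate\<close>,
  which lists the oldest particle first, with \<open>exposed\<close>.\<close>

lemma exposed_iff: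
  "norm (disc_aggregate c (map (\<lambda>x. f_map N (of_real x)) (rev xs)) (f_map N (of_real y))) = 1
    \<longleftrightarrow> exposed N c xs y"
proof (induction xs arbitrary: y)
  case (Cons x xs)
  let ?a = "map (\<lambda>x. f_map N (of_real x)) (rev xs)"
  let ?w = "rot_slit c (f_map N (of_real x)) (f_map N (of_real y))"
  have a: "\<forall>a\<in>set ?a. norm a = 1" by (auto simp: norm_f_map_of_real)
  have e: "disc_aggregate c (map (\<lambda>x. f_map N (of_real x)) (rev (x # xs))) (f_map N (of_real y))
      = disc_aggregate c ?a ?w"
    by (simp add: disc_aggregate_append)
  show ?case
  proof (cases "survives N c x y")
    case True
    then show ?thesis unfolding e by (simp add: rot_slit_f_map(2) Cons.IH)
  next
    case False
    then have "norm ?w \<noteq> 1" by (simp add: rot_slit_f_map(1))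
    moreover have "1 \<le> norm ?w" by (intro norm_rot_slit) (simp_all add: norm_f_map_of_real)
    ultimately have "1 < norm ?w" by simp
    then have "1 < norm (disc_aggregate c ?a ?w)" by (rule norm_disc_aggregate_gt[OF c a])
    then show ?thesis unfolding e using False by simp
  qed
qed (simp add: norm_f_map_of_real)

end

lemma measurable_base_map [measurable]: "base_map N c \<in> borel_measurable borel"
  unfolding base_map_def[abs_def]
  by (cases "N = 0") (auto intro!: borel_measurable_continuous_onI continuous_intros)

lemma measurable_rmod [measurable]: "(\<lambda>x. x rmod L) \<in> borel_measurable borel"
  unfolding rmod_def by measurable

lemma measurable_rmod' [measurable (raw)]:
  "f \<in> borel_measurable M \<Longrightarrow> (\<lambda>x. f x rmod L) \<in> borel_measurable M"
  by measurable

lemma measurable_survives [measurable (raw)]: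
  assumes [measurable]: "f \<in> borel_measurable M" "g \<in> borel_measurable M"
  shows "Measurable.pred M (\<lambda>x. survives N c (f x) (g x))"
  unfolding survives_def atLeastAtMost_iff by measurable

lemma measurable_pushed [measurable (raw)]:
  assumes [measurable]: "f \<in> borel_measurable M" "g \<in> borel_measurable M"
  shows "(\<lambda>x. pushed N c (f x) (g x)) \<in> borel_measurable M"
  unfolding pushed_def by measurable

section \<open>Pulling back sets of boundary angles\<close>

lemma nn_integral_shift:
  fixes F :: "real \<Rightarrow> ennreal"
  assumes [measurable]: "F \<in> borel_measurable borel"
  shows "(\<integral>\<^sup>+v. F (t + v) * indicator {a..<b} v \<partial>lborel) = (\<integral>\<^sup>+v. F v * indicator {t + a..<t + b} v \<partial>lborel)"
proof -
  have "(\<integral>\<^sup>+v. F v * indicator {t + a..<t + b} v \<partial>lborel) =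
      (\<integral>\<^sup>+v. F (t + v) * indicator {t + a..<t + b} (t + v) \<partial>lborel)"
    using nn_integral_real_affine[of "\<lambda>v. F v * indicator {t + a..<t + b} v" 1 t] by simp
  also have "\<dots> = (\<integral>\<^sup>+v. F (t + v) * indicator {a..<b} v \<partial>lborel)"
    by (intro nn_integral_cong) (simp add: indicator_def)
  finally show ?thesis ..
qed

lemma rmod_eqI: "0 \<le> z \<Longrightarrow> z < L \<Longrightarrow> x = z + of_int n * L \<Longrightarrow> x rmod L = (z::real)"
  by (rule rmod_unique[of z L x n]) auto

text \<open>The interval is cut where the rotated angle passes L; on each piece the rotation is a
  translation, and the two images tile the interval again.\<close>

lemma nn_integral_rotate:
  fixes F :: "real \<Rightarrow> ennreal"
  assumes [measurable]: "F \<in> borel_measurable borel" and L: "0 < L"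
  shows "(\<integral>\<^sup>+v. F ((x + v) rmod L) * indicator {0..<L} v \<partial>lborel) = (\<integral>\<^sup>+v. F v * indicator {0..<L} v \<partial>lborel)"
proof -
  define r where "r = x rmod L"
  have r: "0 \<le> r" "r < L" using L by (auto simp: r_def rmod_nonneg rmod_less)
  have x: "(x + v) rmod L = (r + v) rmod L" for v
    using rmod_add[of r L v] rmod_add[of x L v] by (simp add: r_def)
  have "(\<integral>\<^sup>+v. F ((x + v) rmod L) * indicator {0..<L} v \<partial>lborel) =
      (\<integral>\<^sup>+v. F (r + v) * indicator {0..<L - r} v + F ((r - L) + v) * indicator {L - r..<L} v \<partial>lborel)"
  proof (intro nn_integral_cong)
    fix v :: real
    consider "v < 0 \<or> L \<le> v" | "0 \<le> v" "v < L - r" | "L - r \<le> v" "v < L" by linarith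
    then show "F ((x + v) rmod L) * indicator {0..<L} v =
        F (r + v) * indicator {0..<L - r} v + F ((r - L) + v) * indicator {L - r..<L} v"
    proof cases
      case 2
      then have "(r + v) rmod L = r + v" using r by (intro rmod_idem) auto
      then show ?thesis using 2 r by (simp add: x indicator_def)
    next
      case 3
      then have "(r + v) rmod L = r - L + v" using r by (intro rmod_eqI[of _ _ _ 1]) auto
      then show ?thesis using 3 r by (simp add: x indicator_def)
    qed (use r in \<open>auto simp: indicator_def\<close>)
  qed
  also have "\<dots> = (\<integral>\<^sup>+v. F (r + v) * indicator {0..<L - r} v \<partial>lborel) +
      (\<integral>\<^sup>+v. F ((r - L) + v) * indicator {L - r..<L} v \<partial>lborel)"
    by (intro nn_integral_add) auto
  also have "\<dots> = (\<integral>\<^sup>+v. F v * indicator {r..<L} v \<partial>lborel) + (\<integral>\<^sup>+v. F v * indicator {0..<r} v \<partial>lborel)"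
    by (simp add: nn_integral_shift)
  also have "\<dots> = (\<integral>\<^sup>+v. F v * indicator {r..<L} v + F v * indicator {0..<r} v \<partial>lborel)"
    by (intro nn_integral_add[symmetric]) auto
  also have "\<dots> = (\<integral>\<^sup>+v. F v * indicator {0..<L} v \<partial>lborel)"
    by (intro nn_integral_cong) (use r in \<open>auto simp: indicator_def\<close>)
  finally show ?thesis .
qed

lemma emeasure_rotate:
  assumes [measurable]: "A \<in> sets borel" and L: "0 < L"
  shows "(\<integral>\<^sup>+v. indicator A ((x + v) rmod L) * indicator {0..<L} v \<partial>lborel) = emeasure lborel (A \<inter> {0..<L})"
  unfolding nn_integral_rotate[OF borel_measurable_indicator[OF assms(1)] L]
  by (simp flip: indicator_inter_arith)

definition pull_back :: "nat \<Rightarrow> real \<Rightarrow> real \<Rightarrow> real set \<Rightarrow> real set" where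
  "pull_back N c x A = {y \<in> {0..<2 * pi * real N}. survives N c x y \<and> pushed N c x y \<in> A}"

context
  fixes N :: nat and c L h :: real
  assumes N: "1 \<le> N" and c: "1 < c"
  defines "L \<equiv> 2 * pi * real N" and "h \<equiv> arc_radius N c"
begin

lemma L_pos: "0 < L" using N by (simp add: L_def)

lemma h_bounds: "0 < h" "2 * h < L"
  unfolding h_def L_def using arc_radius_bounds[OF N c] .

lemma sets_pull_back [measurable]:
  assumes [measurable]: "A \<in> sets borel"
  shows "pull_back N c x A \<in> sets borel"
  unfolding pull_back_def by measurable

text \<open>Rotating to the offset u = y - x makes the set of surviving offsets independent of x, so
  that x enters only as a shift. This is the form to which Fubini applies.\<close>

lemma emeasure_pull_back:
  assumes [measurable]: "A \<in> sets borel"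
  shows "emeasure lborel (pull_back N c x A) =
    (\<integral>\<^sup>+u. indicator {h..L - h} u * indicator A ((x + base_map N c u) rmod L) \<partial>lborel)"
proof -
  define F :: "real \<Rightarrow> ennreal"
    where "F = (\<lambda>u. indicator {h..L - h} u * indicator A ((x + base_map N c u) rmod L))"
  have [measurable]: "F \<in> borel_measurable borel" unfolding F_def by measurable
  have "emeasure lborel (pull_back N c x A) = (\<integral>\<^sup>+y. indicator (pull_back N c x A) y \<partial>lborel)"
    by simp
  also have "\<dots> = (\<integral>\<^sup>+y. F ((- x + y) rmod L) * indicator {0..<L} y \<partial>lborel)"
    by (intro nn_integral_cong)
      (auto simp: indicator_def pull_back_def survives_def pushed_def F_def simp flip: L_def h_def)
  also have "\<dots> = (\<integral>\<^sup>+u. F u * indicator {0..<L} u \<partial>lborel)"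
    by (rule nn_integral_rotate) (use L_pos in auto)
  also have "\<dots> = (\<integral>\<^sup>+u. F u \<partial>lborel)"
    by (intro nn_integral_cong) (use h_bounds in \<open>auto simp: F_def indicator_def\<close>)
  finally show ?thesis unfolding F_def .
qed

text \<open>After exchanging the integrals, u is fixed and x runs over the circle, so x +
  \<open>base_map N c u\<close> runs over it uniformly and contributes the length of A. The
  surviving offsets have total length L - 2h.\<close>

lemma nn_integral_emeasure_pull_back:
  assumes A [measurable]: "A \<in> sets borel"
  shows "(\<integral>\<^sup>+x. emeasure lborel (pull_back N c x A) * indicator {0..<L} x \<partial>lborel) =
    ennreal (L - 2 * h) * emeasure lborel (A \<inter> {0..<L})"
proof -
  have "(\<integral>\<^sup>+x. emeasure lborel (pull_back N c x A) * indicator {0..<L} x \<partial>lborel) =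
    (\<integral>\<^sup>+x. (\<integral>\<^sup>+u. indicator {h..L - h} u * indicator A ((x + base_map N c u) rmod L) * indicator {0..<L} x \<partial>lborel) \<partial>lborel)"
    by (simp add: emeasure_pull_back nn_integral_multc)
  also have "\<dots> = (\<integral>\<^sup>+u. (\<integral>\<^sup>+x. indicator {h..L - h} u * indicator A ((x + base_map N c u) rmod L) * indicator {0..<L} x \<partial>lborel) \<partial>lborel)"
    by (rule lborel_pair.Fubini') measurable
  also have "\<dots> = (\<integral>\<^sup>+u. indicator {h..L - h} u * emeasure lborel (A \<inter> {0..<L}) \<partial>lborel)"
  proof (intro nn_integral_cong)
    fix u :: real
    have "(\<integral>\<^sup>+x. indicator {h..L - h} u * indicator A ((x + base_map N c u) rmod L) * indicator {0..<L} x \<partial>lborel)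
        = indicator {h..L - h} u * (\<integral>\<^sup>+x. indicator A ((base_map N c u + x) rmod L) * indicator {0..<L} x \<partial>lborel)"
      by (subst nn_integral_cmult[symmetric]) (simp_all add: mult.assoc add.commute)
    then show "(\<integral>\<^sup>+x. indicator {h..L - h} u * indicator A ((x + base_map N c u) rmod L) * indicator {0..<L} x \<partial>lborel)
        = indicator {h..L - h} u * emeasure lborel (A \<inter> {0..<L})"
      by (simp add: emeasure_rotate[OF A L_pos])
  qed
  also have "\<dots> = ennreal (L - 2 * h) * emeasure lborel (A \<inter> {0..<L})"
    using h_bounds by (simp add: nn_integral_multc)
  finally show ?thesis .
qed

text \<open>The inverse of \<^const>\<open>base_map\<close> is smooth with derivative at most \<open>1\<close>, so particles only
  contract the exposed set.\<close>

lemma emeasure_pull_back_le: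
  assumes A [measurable]: "A \<in> sets borel"
  shows "emeasure lborel (pull_back N c x A) \<le> emeasure lborel (A \<inter> {0..<L})"
proof -
  define n where "n = 2 * real N"
  have n: "n > 0" "L = n * pi" using N by (auto simp: n_def L_def)
  \<comment> \<open>T inverts \<open>base_map\<close> and maps [0, L] onto [h, L - h]; it is the
    substitution that turns the pulled-back length into an integral over the whole circle with
    weight T'.\<close>
  define T where "T = (\<lambda>v. n * arccos (cos (v / n) / c))"
  define T' where "T' = (\<lambda>v. sin (v / n) / (c * sqrt (1 - (cos (v / n) / c)\<^sup>2)))"
  have cc: "\<bar>cos t / c\<bar> < 1" for t
  proof -
    have "\<bar>cos t\<bar> < c" using abs_cos_le_one[of t] c by linarith
    then show ?thesis using c by simp
  qed
  have sq: "0 < 1 - (cos t / c)\<^sup>2" for t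
    using cc[of t] by (simp add: abs_square_less_1)
  define F :: "real \<Rightarrow> ennreal" where "F = (\<lambda>u. indicator A ((x + base_map N c u) rmod L))"
  have [measurable]: "F \<in> borel_measurable borel" unfolding F_def by measurable
  have T0: "T 0 = h" by (simp add: T_def h_def arc_radius_def n_def)
  have TL: "T L = L - h"
  proof -
    have "0 < 1 / c" "1 / c < 1" using c by auto
    then have "arccos (- (1 / c)) = pi - arccos (1 / c)" by (intro arccos_minus) linarith+
    then show ?thesis
      using n(1) by (simp add: T_def n(2) h_def arc_radius_def right_diff_distrib flip: n_def)
  qed
  have der: "(T has_real_derivative T' v) (at v)" for v
  proof -
    define s where "s = sqrt (1 - (cos (v / n) / c)\<^sup>2)"
    have s: "0 < s" using sq[of "v / n"] by (simp add: s_def)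
    have 1: "((\<lambda>v. cos (v / n) / c) has_real_derivative - (sin (v / n) / (n * c))) (at v)"
      using n c by (auto intro!: derivative_eq_intros)
    have "(arccos has_real_derivative inverse (- s)) (at (cos (v / n) / c))"
      unfolding s_def using cc[of "v / n"] by (intro DERIV_arccos) linarith+
    from DERIV_cmult[OF DERIV_chain2[OF this 1], of n]
    have "(T has_real_derivative n * (inverse (- s) * - (sin (v / n) / (n * c)))) (at v)"
      by (simp only: T_def)
    also have "n * (inverse (- s) * - (sin (v / n) / (n * c))) = T' v"
    proof -
      have "T' v = sin (v / n) / (c * s)" by (simp only: T'_def s_def)
      then show ?thesis using n(1) c s by (simp add: field_simps)
    qed
    finally show ?thesis .
  qed
  have T'0: "0 \<le> T' v" if "v \<in> {0..L}" for v
    unfolding T'_def using that c sq[of "v / n"] n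
    by (intro divide_nonneg_nonneg sin_ge_zero mult_nonneg_nonneg) (auto simp: field_simps)
  \<comment> \<open>After squaring, the bound reads sin^2 \<le> c^2 - cos^2, which is 1 \<le>
    c^2.\<close>
  have T'1: "T' v \<le> 1" for v
  proof -
    let ?t = "v / n"
    have "(sin ?t)\<^sup>2 \<le> c\<^sup>2 - (cos ?t)\<^sup>2"
      using one_le_power[of c 2] c sin_cos_squared_add[of ?t] by linarith
    also have "\<dots> = (c * sqrt (1 - (cos ?t / c)\<^sup>2))\<^sup>2"
      using sq[of ?t] c by (simp add: power_mult_distrib right_diff_distrib power_divide)
    finally have le: "(sin ?t)\<^sup>2 \<le> (c * sqrt (1 - (cos ?t / c)\<^sup>2))\<^sup>2" .
    have pos: "0 < c * sqrt (1 - (cos ?t / c)\<^sup>2)"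
      using c sq[of ?t] by simp
    have "sin ?t \<le> c * sqrt (1 - (cos ?t / c)\<^sup>2)"
      by (rule power2_le_imp_le[OF le less_imp_le[OF pos]])
    then show ?thesis
      unfolding T'_def by (simp only: divide_le_eq_1 pos simp_thms)
  qed
  have inv: "base_map N c (T v) = v" if "v \<in> {0..L}" for v
  proof -
    have "T v / n = arccos (cos (v / n) / c)" using n by (simp add: T_def)
    then have "c * cos (T v / n) = cos (v / n)" 
    proof -
      have "cos (arccos (cos (v / n) / c)) = cos (v / n) / c"
        by (rule cos_arccos) (use cc[of "v / n"] in linarith)+
      then show ?thesis using \<open>T v / n = _\<close> c by simp
    qed
    then have "base_map N c (T v) = n * arccos (cos (v / n))"
      by (simp add: base_map_def flip: n_def)
    also have "arccos (cos (v / n)) = v / n"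
      using that n by (intro arccos_cos) (auto simp: field_simps)
    finally show ?thesis using n by simp
  qed
  have "emeasure lborel (pull_back N c x A) = (\<integral>\<^sup>+u. F u * indicator {T 0..T L} u \<partial>lborel)"
    unfolding emeasure_pull_back[OF A] T0 TL F_def by (simp add: mult.commute)
  also have "\<dots> = (\<integral>\<^sup>+v. F (T v) * ennreal (T' v) * indicator {0..L} v \<partial>lborel)"
  proof (rule nn_integral_substitution_aux)
    show "continuous_on {0..L} T'"
    proof -
      have "c * sqrt (1 - (cos (v / n) / c)\<^sup>2) \<noteq> 0" for v
        using c sq[of "v / n"] by simp
      then show ?thesis
        unfolding T'_def using c n by (intro continuous_intros) auto
    qed
  qed (use der T'0 L_pos in auto)
  also have "\<dots> \<le> (\<integral>\<^sup>+v. indicator A ((x + v) rmod L) * indicator {0..L} v \<partial>lborel)"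
  proof (intro nn_integral_mono)
    fix v :: real
    show "F (T v) * ennreal (T' v) * indicator {0..L} v \<le> indicator A ((x + v) rmod L) * indicator {0..L} v"
      using T'1[of v] inv[of v] by (auto simp: F_def indicator_def)
  qed
  also have "\<dots> = (\<integral>\<^sup>+v. indicator A ((x + v) rmod L) * indicator {0..<L} v \<partial>lborel)"
  proof (rule nn_integral_cong_AE)
    show "AE v in lborel. indicator A ((x + v) rmod L) * indicator {0..L} v =
        (indicator A ((x + v) rmod L) * indicator {0..<L} v :: ennreal)"
      using AE_lborel_singleton[of L] by eventually_elim (auto simp: indicator_def)
  qed
  also have "\<dots> = emeasure lborel (A \<inter> {0..<L})"
    by (rule emeasure_rotate[OF A L_pos])
  finally show ?thesis .
qed

lemma emeasure_pull_back_add_Compl: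
  assumes [measurable]: "A \<in> sets borel"
  shows "emeasure lborel (pull_back N c x A) + emeasure lborel (pull_back N c x (- A)) = ennreal (L - 2 * h)"
proof -
  have "emeasure lborel (pull_back N c x A) + emeasure lborel (pull_back N c x (- A)) =
    (\<integral>\<^sup>+u. indicator {h..L - h} u * indicator A ((x + base_map N c u) rmod L) +
       indicator {h..L - h} u * indicator (- A) ((x + base_map N c u) rmod L) \<partial>lborel)"
    by (simp add: emeasure_pull_back nn_integral_add)
  also have "\<dots> = (\<integral>\<^sup>+u. indicator {h..L - h} u \<partial>lborel)"
    by (intro nn_integral_cong) (auto simp: indicator_def)
  also have "\<dots> = ennreal (L - 2 * h)" using h_bounds by simp
  finally show ?thesis .
qed

text \<open>Contraction is applied to the complement: A and its complement together lose exactly 2h,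
  and the complement gains nothing, so A alone loses at most 2h.\<close>

lemma emeasure_le_pull_back_add:
  assumes [measurable]: "A \<in> sets borel"
  shows "emeasure lborel (A \<inter> {0..<L}) \<le> emeasure lborel (pull_back N c x A) + ennreal (2 * h)"
proof -
  have "emeasure lborel (A \<inter> {0..<L}) + emeasure lborel (- A \<inter> {0..<L}) = ennreal L"
    using L_pos by (subst plus_emeasure) (auto simp: Int_Un_distrib2[symmetric])
  also have "\<dots> = ennreal (L - 2 * h) + ennreal (2 * h)"
    using h_bounds by (simp flip: ennreal_plus)
  also have "\<dots> = emeasure lborel (pull_back N c x A) + ennreal (2 * h) + emeasure lborel (pull_back N c x (- A))"
    by (subst emeasure_pull_back_add_Compl[OF assms, of x, symmetric]) (simp add: ac_simps)
  also have "\<dots> \<le> emeasure lborel (pull_back N c x A) + ennreal (2 * h) + emeasure lborel (- A \<inter> {0..<L})"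
    by (intro add_left_mono emeasure_pull_back_le) auto
  finally have "emeasure lborel (- A \<inter> {0..<L}) + emeasure lborel (A \<inter> {0..<L}) \<le>
      emeasure lborel (- A \<inter> {0..<L}) + (emeasure lborel (pull_back N c x A) + ennreal (2 * h))"
    by (simp add: ac_simps)
  moreover have "emeasure lborel (- A \<inter> {0..<L}) \<noteq> \<infinity>"
    using emeasure_mono[of "- A \<inter> {0..<L}" "{0..<L}" lborel] L_pos by (auto simp: top_unique)
  ultimately show ?thesis
    by (simp add: ennreal_add_left_cancel_le)
qed

end

section \<open>A Markov chain of exposed sets\<close>

text \<open>The \<open>k\<close>-th entry of \<open>\<xi>\<close> is the position of the particle arriving at step \<open>k\<close>; entries outside
  \<open>[0, 2\<pi>N)\<close> stand for steps without arrival.\<close>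

fun chain_exposed :: "nat \<Rightarrow> real \<Rightarrow> nat \<Rightarrow> (nat \<Rightarrow> real) \<Rightarrow> real \<Rightarrow> bool" where
  "chain_exposed N c 0 \<xi> y \<longleftrightarrow> True"
| "chain_exposed N c (Suc k) \<xi> y \<longleftrightarrow>
    (if \<xi> k \<in> {0..<2 * pi * real N} then survives N c (\<xi> k) y \<and> chain_exposed N c k \<xi> (pushed N c (\<xi> k) y)
     else chain_exposed N c k \<xi> y)"

definition exposed_set :: "nat \<Rightarrow> real \<Rightarrow> nat \<Rightarrow> (nat \<Rightarrow> real) \<Rightarrow> real set" where
  "exposed_set N c k \<xi> = {y \<in> {0..<2 * pi * real N}. chain_exposed N c k \<xi> y}"

lemma chain_exposed_cong:
  "(\<And>i. i < k \<Longrightarrow> \<xi> i = \<zeta> i) \<Longrightarrow> chain_exposed N c k \<xi> y = chain_exposed N c k \<zeta> y"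
  by (induction k arbitrary: y) auto

lemma exposed_set_cong:
  "(\<And>i. i < k \<Longrightarrow> \<xi> i = \<zeta> i) \<Longrightarrow> exposed_set N c k \<xi> = exposed_set N c k \<zeta>"
  using chain_exposed_cong[of k \<xi> \<zeta>] by (simp add: exposed_set_def)

lemma measurable_chain_exposed [measurable (raw)]:
  assumes [measurable]: "\<And>i. i < k \<Longrightarrow> (\<lambda>w. f w i) \<in> borel_measurable M"
    and "g \<in> borel_measurable M"
  shows "Measurable.pred M (\<lambda>w. chain_exposed N c k (f w) (g w))"
  using assms
proof (induction k arbitrary: g)
  case (Suc k)
  have [measurable]: "(\<lambda>w. f w k) \<in> borel_measurable M" "g \<in> borel_measurable M"
    using Suc.prems by auto
  have [measurable]: "Measurable.pred M (\<lambda>w. chain_exposed N c k (f w) (pushed N c (f w k) (g w)))"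
    "Measurable.pred M (\<lambda>w. chain_exposed N c k (f w) (g w))"
    using Suc.prems by (intro Suc.IH; measurable)+
  show ?case unfolding chain_exposed.simps by measurable
qed simp

lemma sets_exposed_set [measurable]: "exposed_set N c k \<xi> \<in> sets borel"
  unfolding exposed_set_def by measurable

lemma measurable_emeasure_exposed_set [measurable (raw)]:
  assumes [measurable]: "\<And>i. i < k \<Longrightarrow> (\<lambda>w. f w i) \<in> borel_measurable M"
  shows "(\<lambda>w. emeasure lborel (exposed_set N c k (f w))) \<in> borel_measurable M"
proof -
  have "(\<lambda>w. \<integral>\<^sup>+y. indicator {y \<in> {0..<2 * pi * real N}. chain_exposed N c k (f w) y} y \<partial>lborel)
      \<in> borel_measurable M"
    unfolding indicator_def by (rule lborel.borel_measurable_nn_integral) measurable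
  moreover have "emeasure lborel (exposed_set N c k (f w)) =
      (\<integral>\<^sup>+y. indicator {y \<in> {0..<2 * pi * real N}. chain_exposed N c k (f w) y} y \<partial>lborel)" for w
    unfolding exposed_set_def[symmetric] by simp
  ultimately show ?thesis by simp
qed

lemma measurable_measure_exposed_set [measurable (raw)]:
  assumes [measurable]: "\<And>i. i < k \<Longrightarrow> (\<lambda>w. f w i) \<in> borel_measurable M"
  shows "(\<lambda>w. measure lborel (exposed_set N c k (f w))) \<in> borel_measurable M"
  unfolding measure_def by measurable

text \<open>One step stands for one thin slab: q is the density of the position of a lone particle,
  and 1 - qL the probability that the step counts as empty. The law is prescribed only inside [0,
  L), since the chain treats all other values alike.\<close>

locale particle_chain = prob_space +
  fixes N :: nat and c q :: real and K :: nat and \<Xi> :: "nat \<Rightarrow> 'a \<Rightarrow> real" and L h :: real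
  assumes N: "1 \<le> N" and c: "1 < c"
  defines "L \<equiv> 2 * pi * real N" and "h \<equiv> arc_radius N c"
  assumes q: "0 < q" "q * L \<le> 1"
    and measurable_\<Xi> [measurable]: "\<And>k. \<Xi> k \<in> borel_measurable M"
    and indep: "indep_vars (\<lambda>_. borel) \<Xi> {..<K}"
    and law: "\<And>k B. k < K \<Longrightarrow> B \<in> sets borel \<Longrightarrow> B \<subseteq> {0..<L} \<Longrightarrow>
      prob {w \<in> space M. \<Xi> k w \<in> B} = q * measure lborel B"
begin

abbreviation \<xi> :: "'a \<Rightarrow> nat \<Rightarrow> real" where "\<xi> w \<equiv> \<lambda>i. \<Xi> i w"

abbreviation area :: "nat \<Rightarrow> 'a \<Rightarrow> real" where
  "area k w \<equiv> measure lborel (exposed_set N c k (\<xi> w))"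

lemma L_gt_0: "0 < L" using L_pos[OF N c] by (simp add: L_def)

lemma h_gt_0: "0 < h" "2 * h < L" using h_bounds[OF N c] by (simp_all add: L_def h_def)

lemma emeasure_exposed_set: "emeasure lborel (exposed_set N c k \<zeta>) = ennreal (measure lborel (exposed_set N c k \<zeta>))"
  and measure_exposed_set_le: "measure lborel (exposed_set N c k \<zeta>) \<le> L"
proof -
  have "exposed_set N c k \<zeta> \<subseteq> {0..<L}" by (auto simp: exposed_set_def L_def)
  then have le: "emeasure lborel (exposed_set N c k \<zeta>) \<le> emeasure lborel {0..<L}"
    by (intro emeasure_mono) auto
  also have "\<dots> = ennreal L" using L_gt_0 by simp
  finally have le: "emeasure lborel (exposed_set N c k \<zeta>) \<le> ennreal L" .
  then have "emeasure lborel (exposed_set N c k \<zeta>) \<noteq> \<infinity>" by (auto simp: top_unique)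
  then show e: "emeasure lborel (exposed_set N c k \<zeta>) = ennreal (measure lborel (exposed_set N c k \<zeta>))"
    by (intro emeasure_eq_ennreal_measure) auto
  show "measure lborel (exposed_set N c k \<zeta>) \<le> L"
    using le L_gt_0 by (simp add: e)
qed

text \<open>Conditioning on the past: w' plays the role of an independent copy used for entry k
  alone. The congruence assumption says that F reads only the first k entries, so it can be
  evaluated on their restriction.\<close>

lemma nn_integral_next:
  fixes F :: "(nat \<Rightarrow> real) \<Rightarrow> real \<Rightarrow> ennreal"
  assumes k: "k < K"
    and [measurable]: "case_prod F \<in> borel_measurable (PiM {..<k} (\<lambda>_. borel) \<Otimes>\<^sub>M borel)"
    and cong: "\<And>\<zeta> \<zeta>' x. (\<And>i. i < k \<Longrightarrow> \<zeta> i = \<zeta>' i) \<Longrightarrow> F \<zeta> x = F \<zeta>' x"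
  shows "(\<integral>\<^sup>+w. F (\<xi> w) (\<Xi> k w) \<partial>M) = (\<integral>\<^sup>+w. (\<integral>\<^sup>+w'. F (\<xi> w) (\<Xi> k w') \<partial>M) \<partial>M)"
proof -
  let ?P = "PiM {..<k} (\<lambda>_. borel) :: (nat \<Rightarrow> real) measure"
  let ?X = "\<lambda>w. restrict (\<xi> w) {..<k}"
  have X [measurable]: "?X \<in> measurable M ?P"
    by (intro measurable_restrict) auto
  \<comment> \<open>The single entry is also packed as a function on an index block, the form in
    which \<open>indep_var_restrict\<close> delivers independence.\<close>
  let ?Q = "PiM {k} (\<lambda>_. borel) :: (nat \<Rightarrow> real) measure"
  let ?Y = "\<lambda>w. restrict (\<xi> w) {k}"
  have Y' [measurable]: "?Y \<in> measurable M ?Q"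
    by (intro measurable_restrict) auto
  have "indep_var ?P ?X ?Q ?Y"
    using k by (intro indep_var_restrict[OF indep]) auto
  then have eq: "distr M ?P ?X \<Otimes>\<^sub>M distr M ?Q ?Y = distr M (?P \<Otimes>\<^sub>M ?Q) (\<lambda>w. (?X w, ?Y w))"
    by (simp add: indep_var_distribution_eq)
  interpret Y: prob_space "distr M ?Q ?Y" by (intro prob_space_distr) simp
  have Fr: "F (\<xi> w) x = F (?X w) x" for w x by (rule cong) simp
  have [measurable]: "(\<lambda>p. F (fst p) (snd p k)) \<in> borel_measurable (?P \<Otimes>\<^sub>M ?Q)"
    by measurable
  have "(\<integral>\<^sup>+w. F (\<xi> w) (\<Xi> k w) \<partial>M) = (\<integral>\<^sup>+w. (\<lambda>p. F (fst p) (snd p k)) (?X w, ?Y w) \<partial>M)"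
    by (simp add: Fr)
  also have "\<dots> = (\<integral>\<^sup>+p. F (fst p) (snd p k) \<partial>distr M (?P \<Otimes>\<^sub>M ?Q) (\<lambda>w. (?X w, ?Y w)))"
    by (subst nn_integral_distr) auto
  also have "\<dots> = (\<integral>\<^sup>+\<zeta>. (\<integral>\<^sup>+\<eta>. F \<zeta> (\<eta> k) \<partial>distr M ?Q ?Y) \<partial>distr M ?P ?X)"
    unfolding eq[symmetric] by (subst Y.nn_integral_fst[symmetric]) auto
  also have "\<dots> = (\<integral>\<^sup>+w. (\<integral>\<^sup>+\<eta>. F (?X w) (\<eta> k) \<partial>distr M ?Q ?Y) \<partial>M)"
    by (subst nn_integral_distr) (auto intro!: Y.borel_measurable_nn_integral)
  also have "\<dots> = (\<integral>\<^sup>+w. (\<integral>\<^sup>+w'. F (\<xi> w) (\<Xi> k w') \<partial>M) \<partial>M)"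
  proof (intro nn_integral_cong)
    fix w assume w: "w \<in> space M"
    have "?X w \<in> space ?P" using measurable_space[OF X w] .
    then have [measurable]: "F (?X w) \<in> borel_measurable borel"
      by measurable
    show "(\<integral>\<^sup>+\<eta>. F (?X w) (\<eta> k) \<partial>distr M ?Q ?Y) = (\<integral>\<^sup>+w'. F (\<xi> w) (\<Xi> k w') \<partial>M)"
      by (subst nn_integral_distr) (simp_all add: Fr)
  qed
  finally show ?thesis .
qed

lemma nn_integral_law:
  assumes k: "k < K" and [measurable]: "f \<in> borel_measurable borel"
  shows "(\<integral>\<^sup>+w. f (\<Xi> k w) * indicator {0..<L} (\<Xi> k w) \<partial>M) =
    ennreal q * (\<integral>\<^sup>+x. f x * indicator {0..<L} x \<partial>lborel)"
proof -
  let ?D = "density (distr M borel (\<Xi> k)) (indicator {0..<L})"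
  have "?D = density lborel (\<lambda>x. ennreal q * indicator {0..<L} x)"
  proof (rule measure_eqI)
    fix B assume "B \<in> sets ?D"
    then have B [measurable]: "B \<in> sets borel" by simp
    have fin: "emeasure lborel (B \<inter> {0..<L}) \<noteq> \<infinity>"
      using emeasure_mono[of "B \<inter> {0..<L}" "{0..<L}" lborel] L_gt_0 by (auto simp: top_unique)
    have "emeasure ?D B = (\<integral>\<^sup>+x. indicator {0..<L} x * indicator B x \<partial>distr M borel (\<Xi> k))"
      by (subst emeasure_density) auto
    also have "\<dots> = emeasure (distr M borel (\<Xi> k)) (B \<inter> {0..<L})"
      by (simp add: Int_commute flip: indicator_inter_arith)
    also have "\<dots> = emeasure M {w \<in> space M. \<Xi> k w \<in> B \<inter> {0..<L}}"
      by (subst emeasure_distr) (auto intro!: arg_cong[where f = "emeasure M"])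
    also have "\<dots> = ennreal (q * measure lborel (B \<inter> {0..<L}))"
      unfolding emeasure_eq_measure by (subst law[OF k]) auto
    also have "\<dots> = ennreal q * emeasure lborel (B \<inter> {0..<L})"
      using q fin by (simp add: emeasure_eq_ennreal_measure ennreal_mult)
    also have "\<dots> = emeasure (density lborel (\<lambda>x. ennreal q * indicator {0..<L} x)) B"
      by (subst emeasure_density)
        (auto simp: mult.assoc nn_integral_cmult Int_commute simp flip: indicator_inter_arith)
    finally show "emeasure ?D B = emeasure (density lborel (\<lambda>x. ennreal q * indicator {0..<L} x)) B" .
  qed simp
  then have "(\<integral>\<^sup>+x. f x \<partial>?D) = (\<integral>\<^sup>+x. f x \<partial>density lborel (\<lambda>x. ennreal q * indicator {0..<L} x))"
    by simp
  then have "(\<integral>\<^sup>+x. f x * indicator {0..<L} x \<partial>distr M borel (\<Xi> k)) =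
      ennreal q * (\<integral>\<^sup>+x. f x * indicator {0..<L} x \<partial>lborel)"
    by (simp add: nn_integral_density nn_integral_cmult mult.assoc mult.left_commute mult.commute[of "indicator {0..<L} _"])
  then show ?thesis
    by (simp add: nn_integral_distr)
qed

lemma prob_no_arrival:
  assumes "k < K"
  shows "emeasure M {w \<in> space M. \<Xi> k w \<notin> {0..<L}} = ennreal (1 - q * L)"
proof -
  have "prob {w \<in> space M. \<Xi> k w \<in> {0..<L}} = q * L"
    using law[OF assms, of "{0..<L}"] L_gt_0 by simp
  then show ?thesis
    using prob_neg[of "\<lambda>w. \<Xi> k w \<in> {0..<L}"] by (simp add: emeasure_eq_measure)
qed

lemma exposed_set_Suc:
  "exposed_set N c (Suc k) \<zeta> =
    (if \<zeta> k \<in> {0..<L} then pull_back N c (\<zeta> k) (exposed_set N c k \<zeta>) else exposed_set N c k \<zeta>)"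
proof -
  have "pushed N c x y \<in> {0..<L}" for x y
    using L_gt_0 rmod_nonneg[of L] rmod_less[of L] by (simp add: pushed_def flip: L_def)
  then show ?thesis
    by (auto simp: exposed_set_def pull_back_def L_def)
qed

end

text \<open>The exposed set is the one before step k. It lies in [0, L), so an empty step never
  counts as a birth.\<close>

definition birth :: "nat \<Rightarrow> real \<Rightarrow> (nat \<Rightarrow> real) \<Rightarrow> nat \<Rightarrow> bool" where
  "birth N c \<zeta> k \<longleftrightarrow> \<zeta> k \<in> exposed_set N c k \<zeta>"

lemma measurable_birth [measurable (raw)]:
  assumes [measurable]: "\<And>i. i \<le> k \<Longrightarrow> (\<lambda>w. f w i) \<in> borel_measurable M"
  shows "Measurable.pred M (\<lambda>w. birth N c (f w) k)"
  unfolding birth_def exposed_set_def mem_Collect_eq by measurable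

lemma birth_cong: "(\<And>i. i \<le> k \<Longrightarrow> \<xi> i = \<zeta> i) \<Longrightarrow> birth N c \<xi> k = birth N c \<zeta> k"
  using exposed_set_cong[of k \<xi> \<zeta>] by (simp add: birth_def)

section \<open>Moments of the exposed length\<close>

context particle_chain
begin

text \<open>The mean factor per step: 1 - 2hq = (1 - qL) + q (L - 2h), an empty step keeping the
  length and a particle shortening it on average by the factor 1 - 2h/L.\<close>

definition r :: real where "r = 1 - 2 * h * q"

lemma r_bounds: "0 < r" "r < 1"
proof -
  have "2 * h * q < L * q" using h_gt_0 q by (intro mult_strict_right_mono) auto
  then show "0 < r" using q(2) mult.commute[of q L] by (simp add: r_def)
  show "r < 1" using h_gt_0 q by (simp add: r_def)
qed

lemma nn_integral_law_split:
  assumes k: "k < K" and [measurable]: "f \<in> borel_measurable borel"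
    and d: "\<And>x. x \<notin> {0..<L} \<Longrightarrow> f x = d"
  shows "(\<integral>\<^sup>+w. f (\<Xi> k w) \<partial>M) =
    ennreal (1 - q * L) * d + ennreal q * (\<integral>\<^sup>+x. f x * indicator {0..<L} x \<partial>lborel)"
proof -
  have "(\<integral>\<^sup>+w. f (\<Xi> k w) \<partial>M) = (\<integral>\<^sup>+w. d * indicator {w \<in> space M. \<Xi> k w \<notin> {0..<L}} w +
      f (\<Xi> k w) * indicator {0..<L} (\<Xi> k w) \<partial>M)"
    using d by (intro nn_integral_cong) (auto simp: indicator_def)
  also have "\<dots> = d * emeasure M {w \<in> space M. \<Xi> k w \<notin> {0..<L}} +
      (\<integral>\<^sup>+w. f (\<Xi> k w) * indicator {0..<L} (\<Xi> k w) \<partial>M)"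
    by (subst nn_integral_add) (auto simp: nn_integral_cmult_indicator)
  finally show ?thesis
    using nn_integral_law[OF k, of f] prob_no_arrival[OF k] by (simp add: mult.commute)
qed

text \<open>One transition of the chain, for a general G so that it serves both the first and the
  second moment.\<close>

lemma nn_integral_area_Suc:
  fixes G :: "real \<Rightarrow> ennreal"
  assumes k: "k < K" and [measurable]: "G \<in> borel_measurable borel"
  shows "(\<integral>\<^sup>+w. G (area (Suc k) w) \<partial>M) = (\<integral>\<^sup>+w. ennreal (1 - q * L) * G (area k w) +
    ennreal q * (\<integral>\<^sup>+x. G (measure lborel (pull_back N c x (exposed_set N c k (\<xi> w)))) * indicator {0..<L} x \<partial>lborel) \<partial>M)"
proof -
  \<comment> \<open>Overwriting entry k by x separates the new position from the past, as
    \<open>nn_integral_next\<close> requires.\<close>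
  define F where "F = (\<lambda>\<zeta> x. G (measure lborel (exposed_set N c (Suc k) (\<zeta>(k := x)))))"
  have upd: "exposed_set N c k (\<zeta>(k := x)) = exposed_set N c k \<zeta>" for \<zeta> x
    by (rule exposed_set_cong) simp
  have F: "F \<zeta> x = G (measure lborel (if x \<in> {0..<L} then pull_back N c x (exposed_set N c k \<zeta>) else exposed_set N c k \<zeta>))" for \<zeta> x
    by (simp add: F_def exposed_set_Suc upd)
  have meas: "case_prod F \<in> borel_measurable (PiM {..<k} (\<lambda>_. borel) \<Otimes>\<^sub>M borel)"
  proof -
    have "(\<lambda>p. ((fst p)(k := snd p)) i) \<in> borel_measurable (PiM {..<k} (\<lambda>_. borel) \<Otimes>\<^sub>M borel)"
      if "i < Suc k" for i
    proof (cases "i = k")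
      case False
      then have "i \<in> {..<k}" using that by simp
      then show ?thesis using False by simp
    qed simp
    then show ?thesis unfolding F_def case_prod_beta' by measurable
  qed
  have "(\<integral>\<^sup>+w. G (area (Suc k) w) \<partial>M) = (\<integral>\<^sup>+w. F (\<xi> w) (\<Xi> k w) \<partial>M)"
    by (simp add: F_def fun_upd_idem)
  also have "\<dots> = (\<integral>\<^sup>+w. (\<integral>\<^sup>+w'. F (\<xi> w) (\<Xi> k w') \<partial>M) \<partial>M)"
  proof (rule nn_integral_next[OF k meas])
    fix \<zeta> \<zeta>' :: "nat \<Rightarrow> real" and x assume "\<And>i. i < k \<Longrightarrow> \<zeta> i = \<zeta>' i"
    then show "F \<zeta> x = F \<zeta>' x" using exposed_set_cong[of k \<zeta> \<zeta>'] by (simp add: F)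
  qed
  also have "\<dots> = (\<integral>\<^sup>+w. ennreal (1 - q * L) * G (area k w) +
    ennreal q * (\<integral>\<^sup>+x. G (measure lborel (pull_back N c x (exposed_set N c k (\<xi> w)))) * indicator {0..<L} x \<partial>lborel) \<partial>M)"
  proof (intro nn_integral_cong)
    fix w assume "w \<in> space M"
    have [measurable]: "F (\<xi> w) \<in> borel_measurable borel"
    proof -
      have "(\<lambda>x. ((\<xi> w)(k := x)) i) \<in> borel_measurable borel" for i by (cases "i = k") auto
      then show ?thesis unfolding F_def by measurable
    qed
    have "(\<integral>\<^sup>+x. F (\<xi> w) x * indicator {0..<L} x \<partial>lborel) =
        (\<integral>\<^sup>+x. G (measure lborel (pull_back N c x (exposed_set N c k (\<xi> w)))) * indicator {0..<L} x \<partial>lborel)"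
      by (intro nn_integral_cong) (simp add: F indicator_def)
    then show "(\<integral>\<^sup>+w'. F (\<xi> w) (\<Xi> k w') \<partial>M) = ennreal (1 - q * L) * G (area k w) +
      ennreal q * (\<integral>\<^sup>+x. G (measure lborel (pull_back N c x (exposed_set N c k (\<xi> w)))) * indicator {0..<L} x \<partial>lborel)"
      by (subst nn_integral_law_split[OF k, where d = "G (area k w)"]) (auto simp: F)
  qed
  finally show ?thesis .
qed

lemma
  fixes \<zeta> x k defines "A \<equiv> exposed_set N c k \<zeta>"
  shows emeasure_pull_back_exposed: "emeasure lborel (pull_back N c x A) = ennreal (measure lborel (pull_back N c x A))"
    and measure_pull_back_le: "measure lborel (pull_back N c x A) \<le> measure lborel A"
    and measure_le_pull_back_add: "measure lborel A \<le> measure lborel (pull_back N c x A) + 2 * h"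
proof -
  have A [measurable]: "A \<in> sets borel" by (simp add: A_def)
  have AL: "A \<inter> {0..<2 * pi * real N} = A" by (auto simp: A_def exposed_set_def)
  have eA: "emeasure lborel A = ennreal (measure lborel A)"
    unfolding A_def by (rule emeasure_exposed_set)
  have le: "emeasure lborel (pull_back N c x A) \<le> emeasure lborel A"
    using emeasure_pull_back_le[OF N c A, of x] by (simp only: AL)
  then show e: "emeasure lborel (pull_back N c x A) = ennreal (measure lborel (pull_back N c x A))"
    unfolding eA by (intro emeasure_eq_ennreal_measure) (auto simp: top_unique)
  show "measure lborel (pull_back N c x A) \<le> measure lborel A"
    using le unfolding e eA by simp
  have "emeasure lborel A \<le> emeasure lborel (pull_back N c x A) + ennreal (2 * h)"
    using emeasure_le_pull_back_add[OF N c A, of x] by (simp only: AL h_def)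
  then show "measure lborel A \<le> measure lborel (pull_back N c x A) + 2 * h"
    unfolding e eA using h_gt_0 by (simp flip: ennreal_plus)
qed

lemma area_Suc_le: "area (Suc k) w \<le> area k w"
  using measure_pull_back_le by (simp add: exposed_set_Suc)

lemma measurable_measure_pull_back [measurable]:
  "(\<lambda>x. measure lborel (pull_back N c x (exposed_set N c k \<zeta>))) \<in> borel_measurable borel"
proof -
  have "(\<lambda>x. \<integral>\<^sup>+y. indicator {y \<in> {0..<2 * pi * real N}. survives N c x y \<and> pushed N c x y \<in> exposed_set N c k \<zeta>} y \<partial>lborel)
      \<in> borel_measurable borel"
    unfolding indicator_def by (rule lborel.borel_measurable_nn_integral) measurable
  moreover have "(\<integral>\<^sup>+y. indicator {y \<in> {0..<2 * pi * real N}. survives N c x y \<and> pushed N c x y \<in> exposed_set N c k \<zeta>} y \<partial>lborel)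
      = emeasure lborel (pull_back N c x (exposed_set N c k \<zeta>))" for x
    unfolding pull_back_def[symmetric] using sets_pull_back[OF N c sets_exposed_set] by simp
  ultimately have [measurable]: "(\<lambda>x. emeasure lborel (pull_back N c x (exposed_set N c k \<zeta>))) \<in> borel_measurable borel"
    by (simp only:)
  then show ?thesis unfolding measure_def by measurable
qed

lemma nn_integral_measure_pull_back:
  "(\<integral>\<^sup>+x. ennreal (measure lborel (pull_back N c x (exposed_set N c k \<zeta>))) * indicator {0..<L} x \<partial>lborel) =
    ennreal ((L - 2 * h) * measure lborel (exposed_set N c k \<zeta>))"
proof -
  have AL: "exposed_set N c k \<zeta> \<inter> {0..<L} = exposed_set N c k \<zeta>"
    by (auto simp: exposed_set_def L_def)
  show ?thesis
    unfolding emeasure_pull_back_exposed[symmetric]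
    using nn_integral_emeasure_pull_back[OF N c sets_exposed_set, of N c k \<zeta>] h_gt_0
    by (simp add: AL emeasure_exposed_set ennreal_mult flip: L_def h_def)
qed

lemma nn_integral_area:
  "k \<le> K \<Longrightarrow> (\<integral>\<^sup>+w. ennreal (area k w) \<partial>M) = ennreal (L * r ^ k)"
proof (induction k)
  case 0
  have "exposed_set N c 0 \<zeta> = {0..<L}" for \<zeta> by (auto simp: exposed_set_def L_def)
  then show ?case using L_gt_0 by (simp add: emeasure_space_1)
next
  case (Suc k)
  have "(\<integral>\<^sup>+w. ennreal (area (Suc k) w) \<partial>M) =
    (\<integral>\<^sup>+w. ennreal (1 - q * L) * ennreal (area k w) + ennreal q * ennreal ((L - 2 * h) * area k w) \<partial>M)"
    using Suc.prems by (subst nn_integral_area_Suc) (simp_all add: nn_integral_measure_pull_back)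
  also have "\<dots> = (\<integral>\<^sup>+w. ennreal r * ennreal (area k w) \<partial>M)"
  proof (intro nn_integral_cong)
    fix w
    have "ennreal (1 - q * L) * ennreal (area k w) + ennreal q * ennreal ((L - 2 * h) * area k w)
      = ennreal ((1 - q * L) * area k w + q * ((L - 2 * h) * area k w))"
      using q h_gt_0 by (subst ennreal_plus) (auto simp: ennreal_mult)
    also have "(1 - q * L) * area k w + q * ((L - 2 * h) * area k w) = r * area k w"
      by (simp add: r_def algebra_simps)
    finally show "ennreal (1 - q * L) * ennreal (area k w) + ennreal q * ennreal ((L - 2 * h) * area k w) =
        ennreal r * ennreal (area k w)"
      using r_bounds by (simp add: ennreal_mult)
  qed
  also have "\<dots> = ennreal r * ennreal (L * r ^ k)"
    using Suc by (subst nn_integral_cmult) auto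
  also have "\<dots> = ennreal (L * r ^ Suc k)"
    using r_bounds L_gt_0 by (simp add: mult.left_commute flip: ennreal_mult)
  finally show ?case .
qed

text \<open>Each particle decreases the exposed length by at most \<open>2h\<close>, so the square of the decrement is
  controlled by the decrement itself.\<close>

lemma nn_integral_pull_back_power2_le:
  fixes \<zeta> k defines "a \<equiv> measure lborel (exposed_set N c k \<zeta>)"
  shows "ennreal (1 - q * L) * ennreal (a\<^sup>2) +
    ennreal q * (\<integral>\<^sup>+x. ennreal ((measure lborel (pull_back N c x (exposed_set N c k \<zeta>)))\<^sup>2) * indicator {0..<L} x \<partial>lborel)
    \<le> ennreal (r\<^sup>2 * a\<^sup>2 + 4 * h\<^sup>2 * q * a)"
proof -
  define b where "b = (\<lambda>x. measure lborel (pull_back N c x (exposed_set N c k \<zeta>)))"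
  have [measurable]: "b \<in> borel_measurable borel" unfolding b_def by measurable
  have b: "0 \<le> b x" "b x \<le> a" "a \<le> b x + 2 * h" for x
    unfolding a_def b_def by (auto intro: measure_pull_back_le measure_le_pull_back_add)
  have a: "0 \<le> a" by (simp add: a_def)
  define J where "J = (\<integral>\<^sup>+x. ennreal ((b x)\<^sup>2) * indicator {0..<L} x \<partial>lborel)"
  have Jle: "J \<le> (\<integral>\<^sup>+x. ennreal (a\<^sup>2) * indicator {0..<L} x \<partial>lborel)"
    unfolding J_def using b by (intro nn_integral_mono mult_right_mono ennreal_leI power_mono) auto
  also have "\<dots> = ennreal (a\<^sup>2 * L)"
    using L_gt_0 by (simp add: nn_integral_cmult_indicator ennreal_mult)
  finally have "J < top" by (metis ennreal_less_top le_less_trans)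
  then obtain j where j: "J = ennreal j" "0 \<le> j" by (cases J) auto
  have bint: "(\<integral>\<^sup>+x. ennreal (b x) * indicator {0..<L} x \<partial>lborel) = ennreal ((L - 2 * h) * a)"
    unfolding a_def b_def by (rule nn_integral_measure_pull_back)
  have "(\<integral>\<^sup>+x. ennreal ((b x)\<^sup>2) * indicator {0..<L} x + (ennreal (a\<^sup>2) * indicator {0..<L} x +
      ennreal (2 * h) * (ennreal (b x) * indicator {0..<L} x)) \<partial>lborel)
    \<le> (\<integral>\<^sup>+x. ennreal (2 * h * a) * indicator {0..<L} x + ennreal (2 * a) * (ennreal (b x) * indicator {0..<L} x) \<partial>lborel)"
  proof (intro nn_integral_mono)
    fix x
    \<comment> \<open>The decrement a - b lies between 0 and 2h, so its square is at most 2h times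
      itself. The inequality is then rearranged into sums of nonnegative terms, because subtraction
      of extended nonnegative reals truncates.\<close>
    have "(a - b x) * (a - b x) \<le> 2 * h * (a - b x)"
      using b[of x] by (intro mult_right_mono) auto
    then have "(b x)\<^sup>2 + (a\<^sup>2 + 2 * h * b x) \<le> 2 * h * a + 2 * a * b x"
      by (simp add: power2_eq_square algebra_simps)
    then have "ennreal ((b x)\<^sup>2) + (ennreal (a\<^sup>2) + ennreal (2 * h) * ennreal (b x))
      \<le> ennreal (2 * h * a) + ennreal (2 * a) * ennreal (b x)"
      using a b[of x] h_gt_0 by (simp flip: ennreal_mult ennreal_plus)
    then show "ennreal ((b x)\<^sup>2) * indicator {0..<L} x + (ennreal (a\<^sup>2) * indicator {0..<L} x +
      ennreal (2 * h) * (ennreal (b x) * indicator {0..<L} x)) \<le>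
      ennreal (2 * h * a) * indicator {0..<L} x + ennreal (2 * a) * (ennreal (b x) * indicator {0..<L} x)"
      by (simp add: indicator_def)
  qed
  also have "\<dots> = ennreal (2 * h * a * L) + ennreal (2 * a) * ennreal ((L - 2 * h) * a)"
    using L_gt_0 a h_gt_0 by (simp add: nn_integral_add nn_integral_cmult nn_integral_cmult_indicator bint ennreal_mult)
  also have "\<dots> = ennreal (2 * h * a * L + 2 * a * ((L - 2 * h) * a))"
    using L_gt_0 a h_gt_0 by (simp flip: ennreal_mult ennreal_plus)
  also have "(\<integral>\<^sup>+x. ennreal ((b x)\<^sup>2) * indicator {0..<L} x + (ennreal (a\<^sup>2) * indicator {0..<L} x +
      ennreal (2 * h) * (ennreal (b x) * indicator {0..<L} x)) \<partial>lborel)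
    = J + (ennreal (a\<^sup>2 * L) + ennreal (2 * h) * ennreal ((L - 2 * h) * a))"
    unfolding J_def using L_gt_0 a h_gt_0
    by (simp add: nn_integral_add nn_integral_cmult nn_integral_cmult_indicator bint ennreal_mult)
  also have "\<dots> = ennreal (j + (a\<^sup>2 * L + 2 * h * ((L - 2 * h) * a)))"
    using L_gt_0 a h_gt_0 j(2) by (simp add: j(1) flip: ennreal_mult ennreal_plus)
  finally have "j + (a\<^sup>2 * L + 2 * h * ((L - 2 * h) * a)) \<le> 2 * h * a * L + 2 * a * ((L - 2 * h) * a)"
    using L_gt_0 a h_gt_0 by (subst (asm) ennreal_le_iff) auto
  then have "j \<le> a\<^sup>2 * (L - 4 * h) + 4 * h\<^sup>2 * a"
    by (simp add: power2_eq_square algebra_simps)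
  then have "q * j \<le> q * (a\<^sup>2 * (L - 4 * h) + 4 * h\<^sup>2 * a)"
    using q by (intro mult_left_mono) auto
  then have "(1 - q * L) * a\<^sup>2 + q * j \<le> (1 - 4 * h * q) * a\<^sup>2 + 4 * h\<^sup>2 * q * a"
    by (simp add: algebra_simps)
  \<comment> \<open>The coefficient 1 - 4hq is r^2 up to the nonnegative term (2hq)^2. Passing to
    r^2 makes the recursion match the square of the mean.\<close>
  also have "\<dots> \<le> r\<^sup>2 * a\<^sup>2 + 4 * h\<^sup>2 * q * a"
  proof -
    have "r\<^sup>2 = (1 - 4 * h * q) + (2 * h * q)\<^sup>2"
      by (simp add: r_def power2_eq_square algebra_simps)
    then have "1 - 4 * h * q \<le> r\<^sup>2" by simp
    then show ?thesis by (simp add: mult_right_mono)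
  qed
  finally have "ennreal ((1 - q * L) * a\<^sup>2 + q * j) \<le> ennreal (r\<^sup>2 * a\<^sup>2 + 4 * h\<^sup>2 * q * a)"
    by (rule ennreal_leI)
  moreover have "ennreal ((1 - q * L) * a\<^sup>2 + q * j) = ennreal (1 - q * L) * ennreal (a\<^sup>2) + ennreal q * J"
    using q j by (subst ennreal_plus) (auto simp: ennreal_mult)
  ultimately show ?thesis by (simp add: J_def b_def)
qed

text \<open>The first term is the squared mean, so the second bounds the variance. Its constant V =
  2hL/r is chosen to reproduce itself in the induction: r^2 V + 2h(1 - r)L = r V.\<close>

lemma nn_integral_area_power2:
  "k \<le> K \<Longrightarrow> (\<integral>\<^sup>+w. ennreal ((area k w)\<^sup>2) \<partial>M) \<le> ennreal (L\<^sup>2 * r ^ (2 * k) + 2 * h * L / r * r ^ k)"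
proof (induction k)
  case 0
  have "exposed_set N c 0 \<zeta> = {0..<L}" for \<zeta> by (auto simp: exposed_set_def L_def)
  moreover have "0 \<le> 2 * h * L / r" using L_gt_0 h_gt_0 r_bounds by simp
  ultimately show ?case using L_gt_0 by (simp add: emeasure_space_1)
next
  case (Suc k)
  have "(\<integral>\<^sup>+w. ennreal ((area (Suc k) w)\<^sup>2) \<partial>M) \<le>
    (\<integral>\<^sup>+w. ennreal (r\<^sup>2 * (area k w)\<^sup>2 + 4 * h\<^sup>2 * q * area k w) \<partial>M)"
    using Suc.prems
    by (subst nn_integral_area_Suc) (auto intro!: nn_integral_mono nn_integral_pull_back_power2_le)
  also have "\<dots> = (\<integral>\<^sup>+w. ennreal (r\<^sup>2) * ennreal ((area k w)\<^sup>2) + ennreal (4 * h\<^sup>2 * q) * ennreal (area k w) \<partial>M)"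
    using q by (intro nn_integral_cong) (simp add: ennreal_mult)
  also have "\<dots> = ennreal (r\<^sup>2) * (\<integral>\<^sup>+w. ennreal ((area k w)\<^sup>2) \<partial>M) + ennreal (4 * h\<^sup>2 * q) * ennreal (L * r ^ k)"
    using Suc.prems by (simp add: nn_integral_add nn_integral_cmult nn_integral_area)
  also have "\<dots> \<le> ennreal (r\<^sup>2) * ennreal (L\<^sup>2 * r ^ (2 * k) + 2 * h * L / r * r ^ k) + ennreal (4 * h\<^sup>2 * q) * ennreal (L * r ^ k)"
    using Suc by (intro add_right_mono mult_left_mono) auto
  also have "\<dots> = ennreal (r\<^sup>2 * (L\<^sup>2 * r ^ (2 * k) + 2 * h * L / r * r ^ k) + 4 * h\<^sup>2 * q * (L * r ^ k))"
    using L_gt_0 h_gt_0 r_bounds q by (simp flip: ennreal_mult ennreal_plus)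
  also have "r\<^sup>2 * (L\<^sup>2 * r ^ (2 * k) + 2 * h * L / r * r ^ k) + 4 * h\<^sup>2 * q * (L * r ^ k) =
      L\<^sup>2 * r ^ (2 * Suc k) + 2 * h * L / r * r ^ Suc k"
  proof -
    have "4 * h\<^sup>2 * q = 2 * h * (1 - r)" by (simp add: r_def power2_eq_square)
    then show ?thesis
      using r_bounds by (simp only:) (simp add: field_simps power2_eq_square)
  qed
  finally show ?case .
qed

text \<open>Chebyshev with a deviation of half the mean; the factor 8 is 2 from the variance bound
  times 4 from the square of one half.\<close>

lemma prob_area_small:
  assumes "k \<le> K"
  shows "prob {w \<in> space M. area k w < L * r ^ k / 2} \<le> 8 * h / (L * r ^ Suc k)"
proof -
  have bnd: "0 \<le> area k w" "area k w \<le> L" for w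
    using measure_exposed_set_le by auto
  have int: "integrable M (area k)" "integrable M (\<lambda>w. (area k w)\<^sup>2)"
    using bnd by (intro integrable_const_bound[of _ L] integrable_const_bound[of _ "L\<^sup>2"]; simp add: power_mono)+
  have mean: "expectation (area k) = L * r ^ k"
    using nn_integral_area[OF assms] L_gt_0 r_bounds by (subst integral_eq_nn_integral) auto
  have "ennreal (expectation (\<lambda>w. (area k w)\<^sup>2)) \<le> ennreal (L\<^sup>2 * r ^ (2 * k) + 2 * h * L / r * r ^ k)"
    using nn_integral_area_power2[OF assms] by (subst nn_integral_eq_integral[symmetric]) (use int in auto)
  then have "expectation (\<lambda>w. (area k w)\<^sup>2) \<le> L\<^sup>2 * r ^ (2 * k) + 2 * h * L / r * r ^ k"
    using L_gt_0 h_gt_0 r_bounds by (subst (asm) ennreal_le_iff) auto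
  then have var: "variance (area k) \<le> 2 * h * L / r * r ^ k"
    using int by (subst variance_eq) (auto simp: mean power_mult_distrib power_even_eq)
  have pos: "0 < L * r ^ k / 2" using L_gt_0 r_bounds by simp
  have "prob {w \<in> space M. area k w < L * r ^ k / 2} \<le> prob {w \<in> space M. L * r ^ k / 2 \<le> \<bar>area k w - expectation (area k)\<bar>}"
  proof (rule finite_measure_mono)
    show "{w \<in> space M. area k w < L * r ^ k / 2} \<subseteq> {w \<in> space M. L * r ^ k / 2 \<le> \<bar>area k w - expectation (area k)\<bar>}"
    proof clarify
      fix w assume "area k w < L * r ^ k / 2"
      then show "L * r ^ k / 2 \<le> \<bar>area k w - expectation (area k)\<bar>"
        unfolding mean by linarith
    qed
  qed measurable
  also have "\<dots> \<le> variance (area k) / (L * r ^ k / 2)\<^sup>2"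
    by (rule Chebyshev_inequality) (use int pos in auto)
  also have "\<dots> \<le> (2 * h * L / r * r ^ k) / (L * r ^ k / 2)\<^sup>2"
    using var by (intro divide_right_mono) auto
  also have "\<dots> = 8 * h / (L * r ^ Suc k)"
    using L_gt_0 r_bounds by (simp add: field_simps power2_eq_square)
  finally show ?thesis .
qed

section \<open>Probabilities of births along the chain\<close>

lemma nn_integral_indicator_exposed:
  "(\<integral>\<^sup>+x. indicator (exposed_set N c k \<zeta>) x * indicator {0..<L} x \<partial>lborel) = ennreal (measure lborel (exposed_set N c k \<zeta>))"
proof -
  have "exposed_set N c k \<zeta> \<inter> {0..<L} = exposed_set N c k \<zeta>" by (auto simp: exposed_set_def L_def)
  then show ?thesis by (simp add: emeasure_exposed_set flip: indicator_inter_arith)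
qed

lemma measurable_indicator_exposed:
  "(\<lambda>(\<zeta>, x). indicator (exposed_set N c k \<zeta>) x :: ennreal) \<in> borel_measurable (PiM {..<k} (\<lambda>_. borel) \<Otimes>\<^sub>M borel)"
proof -
  have [measurable]: "(\<lambda>p. fst p i) \<in> borel_measurable (PiM {..<k} (\<lambda>_. borel) \<Otimes>\<^sub>M borel)" if "i < k" for i
    using that by simp
  show ?thesis unfolding indicator_def case_prod_beta' exposed_set_def mem_Collect_eq by measurable
qed

text \<open>Given the past, a birth has probability q times the exposed length, and the mean of that
  length is known exactly.\<close>

lemma emeasure_birth:
  assumes k: "k < K"
  shows "emeasure M {w \<in> space M. birth N c (\<xi> w) k} = ennreal (q * L * r ^ k)"
proof -
  have "emeasure M {w \<in> space M. birth N c (\<xi> w) k} = (\<integral>\<^sup>+w. indicator {w \<in> space M. birth N c (\<xi> w) k} w \<partial>M)"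
    by (rule nn_integral_indicator[symmetric]) measurable
  also have "\<dots> = (\<integral>\<^sup>+w. indicator (exposed_set N c k (\<xi> w)) (\<Xi> k w) \<partial>M)"
    by (intro nn_integral_cong) (auto simp: indicator_def birth_def)
  also have "\<dots> = (\<integral>\<^sup>+w. (\<integral>\<^sup>+w'. indicator (exposed_set N c k (\<xi> w)) (\<Xi> k w') \<partial>M) \<partial>M)"
    by (rule nn_integral_next[OF k measurable_indicator_exposed]) (use exposed_set_cong in metis)
  also have "\<dots> = (\<integral>\<^sup>+w. ennreal q * ennreal (area k w) \<partial>M)"
  proof (intro nn_integral_cong)
    fix w
    have "indicator (exposed_set N c k (\<xi> w)) x = (0::ennreal)" if "x \<notin> {0..<L}" for x
      using that by (auto simp: exposed_set_def L_def)
    then show "(\<integral>\<^sup>+w'. indicator (exposed_set N c k (\<xi> w)) (\<Xi> k w') \<partial>M) = ennreal q * ennreal (area k w)"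
      by (subst nn_integral_law_split[OF k, where d = 0]) (simp_all add: nn_integral_indicator_exposed)
  qed
  also have "\<dots> = ennreal q * ennreal (L * r ^ k)"
    using k by (simp add: nn_integral_cmult nn_integral_area)
  finally show ?thesis
    using q L_gt_0 r_bounds by (simp add: mult.assoc flip: ennreal_mult)
qed

text \<open>The lower bound \<alpha> is imposed only at the end of the window. Since the length
  never increases, it also holds at each earlier step, and each step then misses the exposed set
  with conditional probability at most 1 - q\<alpha>.\<close>

lemma prob_no_birth_le:
  assumes \<alpha>: "0 \<le> \<alpha>" "\<alpha> \<le> L" and kj: "k0 + j \<le> K"
  shows "emeasure M {w \<in> space M. (\<forall>i\<in>{k0..<k0 + j}. \<not> birth N c (\<xi> w) i) \<and> \<alpha> \<le> area (k0 + j) w} \<le> ennreal ((1 - q * \<alpha>) ^ j)"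
  using kj
proof (induction j)
  case 0
  then show ?case by (simp add: emeasure_le_1)
next
  case (Suc j)
  define k where "k = k0 + j"
  have k: "k < K" using Suc.prems by (simp add: k_def)
  define S where "S = (\<lambda>\<zeta>. (\<forall>i\<in>{k0..<k}. \<not> birth N c \<zeta> i) \<and> \<alpha> \<le> measure lborel (exposed_set N c k \<zeta>))"
  have S_M [measurable]: "Measurable.pred M (\<lambda>w. S (\<xi> w))"
    unfolding S_def by measurable
  have S_cong: "S \<zeta> = S \<zeta>'" if "\<And>i. i < k \<Longrightarrow> \<zeta> i = \<zeta>' i" for \<zeta> \<zeta>'
    using that exposed_set_cong[of k \<zeta> \<zeta>'] birth_cong[of _ \<zeta> \<zeta>'] unfolding S_def by auto
  define F :: "(nat \<Rightarrow> real) \<Rightarrow> real \<Rightarrow> ennreal"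
    where "F = (\<lambda>\<zeta> x. indicator {\<zeta>. S \<zeta>} \<zeta> * indicator (- exposed_set N c k \<zeta>) x)"
  have F_meas: "case_prod F \<in> borel_measurable (PiM {..<k} (\<lambda>_. borel) \<Otimes>\<^sub>M borel)"
  proof -
    have [measurable]: "(\<lambda>p. fst p i) \<in> borel_measurable (PiM {..<k} (\<lambda>_. borel) \<Otimes>\<^sub>M borel)" if "i < k" for i
      using that by simp
    have [measurable]: "Measurable.pred (PiM {..<k} (\<lambda>_. borel) \<Otimes>\<^sub>M borel) (\<lambda>p. S (fst p))"
      unfolding S_def by measurable
    show ?thesis
      unfolding F_def indicator_def case_prod_beta' exposed_set_def mem_Collect_eq Compl_iff by measurable
  qed
  have F_cong: "F \<zeta> x = F \<zeta>' x" if "\<And>i. i < k \<Longrightarrow> \<zeta> i = \<zeta>' i" for \<zeta> \<zeta>' x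
    using S_cong[OF that] exposed_set_cong[of k \<zeta> \<zeta>'] that by (simp add: F_def indicator_def)
  have "{w \<in> space M. (\<forall>i\<in>{k0..<k0 + Suc j}. \<not> birth N c (\<xi> w) i) \<and> \<alpha> \<le> area (k0 + Suc j) w} \<in> events"
    by measurable
  then have "emeasure M {w \<in> space M. (\<forall>i\<in>{k0..<k0 + Suc j}. \<not> birth N c (\<xi> w) i) \<and> \<alpha> \<le> area (k0 + Suc j) w}
      = (\<integral>\<^sup>+w. indicator {w \<in> space M. (\<forall>i\<in>{k0..<k0 + Suc j}. \<not> birth N c (\<xi> w) i) \<and> \<alpha> \<le> area (k0 + Suc j) w} w \<partial>M)"
    by (rule nn_integral_indicator[symmetric])
  also have "\<dots> \<le> (\<integral>\<^sup>+w. F (\<xi> w) (\<Xi> k w) \<partial>M)"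
  proof (intro nn_integral_mono)
    fix w
    show "indicator {w \<in> space M. (\<forall>i\<in>{k0..<k0 + Suc j}. \<not> birth N c (\<xi> w) i) \<and> \<alpha> \<le> area (k0 + Suc j) w} w
        \<le> F (\<xi> w) (\<Xi> k w)"
      using area_Suc_le[of k w] by (auto simp: F_def indicator_def S_def birth_def k_def)
  qed
  also have "\<dots> = (\<integral>\<^sup>+w. (\<integral>\<^sup>+w'. F (\<xi> w) (\<Xi> k w') \<partial>M) \<partial>M)"
    by (rule nn_integral_next[OF k F_meas F_cong])
  also have "\<dots> \<le> (\<integral>\<^sup>+w. ennreal (1 - q * \<alpha>) * indicator {w \<in> space M. S (\<xi> w)} w \<partial>M)"
  proof (intro nn_integral_mono)
    fix w assume w: "w \<in> space M"
    let ?A = "exposed_set N c k (\<xi> w)"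
    have "(\<integral>\<^sup>+w'. indicator (- ?A) (\<Xi> k w') \<partial>M) = ennreal (1 - q * L) * 1 +
        ennreal q * (\<integral>\<^sup>+x. indicator (- ?A) x * indicator {0..<L} x \<partial>lborel)"
      by (rule nn_integral_law_split[OF k]) (auto simp: exposed_set_def L_def)
    also have "(\<integral>\<^sup>+x. indicator (- ?A) x * indicator {0..<L} x \<partial>lborel) = emeasure lborel ({0..<L} - ?A)"
    proof -
      have "- ?A \<inter> {0..<L} = {0..<L} - ?A" by auto
      then show ?thesis by (simp flip: indicator_inter_arith)
    qed
    also have "\<dots> = ennreal (L - area k w)"
    proof -
      have "?A \<subseteq> {0..<L}" by (auto simp: exposed_set_def L_def)
      then show ?thesis
        using L_gt_0 by (subst emeasure_Diff) (auto simp: emeasure_exposed_set ennreal_minus)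
    qed
    also have "ennreal (1 - q * L) * 1 + ennreal q * ennreal (L - area k w) = ennreal (1 - q * area k w)"
    proof -
      have "0 \<le> q * (L - area k w)" "0 \<le> 1 - q * L"
        using q measure_exposed_set_le[of k "\<xi> w"] by auto
      moreover have "1 - q * area k w = (1 - q * L) + q * (L - area k w)" by (simp add: algebra_simps)
      ultimately show ?thesis
        using q measure_exposed_set_le[of k "\<xi> w"] by (simp only: ennreal_plus) (simp add: ennreal_mult)
    qed
    finally have e: "(\<integral>\<^sup>+w'. indicator (- ?A) (\<Xi> k w') \<partial>M) = ennreal (1 - q * area k w)" .
    show "(\<integral>\<^sup>+w'. F (\<xi> w) (\<Xi> k w') \<partial>M) \<le> ennreal (1 - q * \<alpha>) * indicator {w \<in> space M. S (\<xi> w)} w"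
    proof (cases "S (\<xi> w)")
      case True
      then have "(\<integral>\<^sup>+w'. F (\<xi> w) (\<Xi> k w') \<partial>M) = ennreal (1 - q * area k w)"
        by (simp add: F_def e)
      also have "\<dots> \<le> ennreal (1 - q * \<alpha>)"
        using True q by (intro ennreal_leI) (simp add: S_def)
      finally show ?thesis using True w by simp
    qed (simp add: F_def)
  qed
  also have "\<dots> = ennreal (1 - q * \<alpha>) * emeasure M {w \<in> space M. S (\<xi> w)}"
    by (intro nn_integral_cmult_indicator) measurable
  also have "\<dots> \<le> ennreal (1 - q * \<alpha>) * ennreal ((1 - q * \<alpha>) ^ j)"
    using Suc.IH Suc.prems by (intro mult_left_mono) (simp_all add: S_def k_def)
  also have "\<dots> = ennreal ((1 - q * \<alpha>) ^ Suc j)"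
  proof -
    have "q * \<alpha> \<le> q * L" using q \<alpha> by (intro mult_left_mono) auto
    then have "q * \<alpha> \<le> 1" using q(2) by linarith
    then show ?thesis by (simp flip: ennreal_mult)
  qed
  finally show ?case .
qed

end

section \<open>Arrivals in thin time slabs\<close>

text \<open>This makes the definite description in \<open>arrivals\<close> denote. Asymmetry of R
  rules out repetitions, so equal sets suffice.\<close>

lemma sorted_wrt_unique:
  assumes "\<And>x y. R x y \<Longrightarrow> \<not> R y x"
  shows "sorted_wrt R xs \<Longrightarrow> sorted_wrt R ys \<Longrightarrow> set xs = set ys \<Longrightarrow> xs = ys"
proof (induction xs arbitrary: ys)
  case (Cons x xs)
  then obtain y ys' where ys: "ys = y # ys'" by (cases ys) auto
  have "x = y"
  proof (rule ccontr)
    assume ne: "x \<noteq> y"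
    then have "x \<in> set ys'" "y \<in> set xs" using Cons.prems(3) by (auto simp: ys)
    then have "R y x" "R x y" using Cons.prems by (auto simp: ys)
    then show False using assms by blast
  qed
  have "\<not> R z z" for z using assms by blast
  then have "x \<notin> set xs" "y \<notin> set ys'"
    using Cons.prems(1,2) by (auto simp: ys)
  then have "set xs = set ys'" using Cons.prems(3) \<open>x = y\<close> by (auto simp: ys)
  then show ?case using Cons.IH[of ys'] Cons.prems \<open>x = y\<close> by (simp add: ys)
qed simp

lemma arrivals_eqI:
  assumes "sorted_wrt (\<lambda>p q. fst p < fst q) ps" "set ps = {p \<in> Q. fst p \<le> t}"
  shows "arrivals Q t = ps"
  unfolding arrivals_def
proof (rule the_equality)
  fix qs assume "sorted_wrt (\<lambda>p q. fst p < fst q) qs \<and> set qs = {p \<in> Q. fst p \<le> t}"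
  then show "qs = ps"
    using assms by (intro sorted_wrt_unique[of "\<lambda>p q. fst p < fst q"]) auto
qed (use assms in simp)

definition tree_born :: "nat \<Rightarrow> real \<Rightarrow> (real \<times> real) set \<Rightarrow> real \<Rightarrow> bool" where
  "tree_born N lam Q t \<longleftrightarrow> 0 < t \<and> (\<forall>\<^sub>F s in at_left t. num_trees N lam Q s < num_trees N lam Q t)"

text \<open>Half-open on the left, so that the slabs tile the positive times without overlap and
  every integer time is the end of a slab.\<close>

definition slab :: "nat \<Rightarrow> nat \<Rightarrow> real set \<Rightarrow> (real \<times> real) set" where
  "slab m k I = {real k / real m<..real (Suc k) / real m} \<times> I"

definition slab_points :: "nat \<Rightarrow> (real \<times> real) set \<Rightarrow> nat \<Rightarrow> nat \<Rightarrow> (real \<times> real) set" where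
  "slab_points N Q m k = Q \<inter> slab m k {0..<2 * pi * real N}"

text \<open>The value -1 lies outside [0, 2 pi N) and codes an empty step. A slab with several
  particles also receives it, which distorts the process only on the event
  \<open>crowded\<close>.\<close>

definition slab_position :: "nat \<Rightarrow> (real \<times> real) set \<Rightarrow> nat \<Rightarrow> nat \<Rightarrow> real" where
  "slab_position N Q m k =
    (if card (slab_points N Q m k) = 1 then snd (the_elem (slab_points N Q m k)) else -1)"

definition slab_arrivals :: "nat \<Rightarrow> (real \<times> real) set \<Rightarrow> nat \<Rightarrow> nat \<Rightarrow> (real \<times> real) list" where
  "slab_arrivals N Q m k =
    map (\<lambda>i. the_elem (slab_points N Q m i)) (filter (\<lambda>i. card (slab_points N Q m i) = 1) [0..<k])"

lemma slab_arrivals_Suc: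
  "slab_arrivals N Q m (Suc k) = slab_arrivals N Q m k @
    (if card (slab_points N Q m k) = 1 then [the_elem (slab_points N Q m k)] else [])"
  by (simp add: slab_arrivals_def)

lemma obtain_slab:
  assumes "0 < t" "1 \<le> m"
  obtains k where "t \<in> {real k / real m<..real (Suc k) / real m}"
proof
  define k where "k = nat (\<lceil>t * real m\<rceil> - 1)"
  have "0 < t * real m" using assms by simp
  then have "1 \<le> \<lceil>t * real m\<rceil>" by linarith
  then have "real k = of_int \<lceil>t * real m\<rceil> - 1" by (simp add: k_def)
  then have "real k < t * real m" "t * real m \<le> real (Suc k)" by linarith+
  then show "t \<in> {real k / real m<..real (Suc k) / real m}"
    using assms by (simp add: field_simps)
qed

context
  fixes N :: nat and lam :: real and Q :: "(real \<times> real) set" and m H :: nat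
  assumes N: "1 \<le> N" and lam: "0 < lam" and m: "1 \<le> m"
    and Q: "Q \<subseteq> {0..} \<times> {0..<2 * pi * real N}"
    and Q0: "\<And>p. p \<in> Q \<Longrightarrow> fst p \<noteq> 0"
    and fin: "\<And>k. k < H * m \<Longrightarrow> finite (slab_points N Q m k)"
    and card_le: "\<And>k. k < H * m \<Longrightarrow> card (slab_points N Q m k) \<le> 1"
begin

lemma slab_points_cases:
  assumes "k < H * m"
  obtains "slab_points N Q m k = {}" | p where "slab_points N Q m k = {p}"
    "real k / real m < fst p" "fst p \<le> real (Suc k) / real m" "snd p \<in> {0..<2 * pi * real N}" "p \<in> Q"
proof (cases "slab_points N Q m k = {}")
  case False
  then obtain p where p: "p \<in> slab_points N Q m k" by auto
  have "slab_points N Q m k = {p}"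
    using p card_le[OF assms] fin[OF assms] by (metis card_le_Suc0_iff_eq One_nat_def is_singletonI' is_singleton_the_elem singletonD False)
  moreover have "real k / real m < fst p" "fst p \<le> real (Suc k) / real m" "snd p \<in> {0..<2 * pi * real N}" "p \<in> Q"
    using p by (auto simp: slab_points_def slab_def)
  ultimately show ?thesis using that(2) by blast
qed (use that(1) in blast)

lemma slab_arrivals_set:
  assumes "k \<le> H * m"
  shows "set (slab_arrivals N Q m k) = {p \<in> Q. fst p \<le> real k / real m}"
  using assms
proof (induction k)
  case 0
  have "{p \<in> Q. fst p \<le> 0} = {}" using Q Q0 by force
  then show ?case by (simp add: slab_arrivals_def)
next
  case (Suc k)
  have split: "{p \<in> Q. fst p \<le> real (Suc k) / real m} = {p \<in> Q. fst p \<le> real k / real m} \<union> slab_points N Q m k"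
  proof -
    have "real k / real m \<le> real (Suc k) / real m" by (simp add: divide_right_mono)
    then show ?thesis using Q by (force simp: slab_points_def slab_def)
  qed
  have "k < H * m" using Suc.prems by simp
  then show ?case
    unfolding split slab_arrivals_Suc by (rule slab_points_cases) (use Suc in auto)
qed

lemma slab_arrivals_sorted:
  assumes "k \<le> H * m"
  shows "sorted_wrt (\<lambda>p q. fst p < fst q) (slab_arrivals N Q m k)"
  using assms
proof (induction k)
  case (Suc k)
  have "k < H * m" using Suc.prems by simp
  then show ?case
  proof (rule slab_points_cases)
    fix p assume p: "slab_points N Q m k = {p}" "real k / real m < fst p"
    have "fst q < fst p" if "q \<in> set (slab_arrivals N Q m k)" for q
      using that p(2) Suc.prems by (auto simp: slab_arrivals_set)
    then show ?thesis using Suc p(1) by (simp add: slab_arrivals_Suc sorted_wrt_append)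
  qed (use Suc in \<open>simp add: slab_arrivals_Suc\<close>)
qed (simp add: slab_arrivals_def)

lemma arrivals_slab:
  assumes "k < H * m" "real k / real m \<le> s" "s \<le> real (Suc k) / real m"
  shows "arrivals Q s = slab_arrivals N Q m k @
    (if \<exists>p\<in>slab_points N Q m k. fst p \<le> s then [the_elem (slab_points N Q m k)] else [])"
proof (rule arrivals_eqI)
  have split: "{p \<in> Q. fst p \<le> s} = {p \<in> Q. fst p \<le> real k / real m} \<union> {p \<in> slab_points N Q m k. fst p \<le> s}"
    using Q assms by (force simp: slab_points_def slab_def)
  have set_k: "set (slab_arrivals N Q m k) = {p \<in> Q. fst p \<le> real k / real m}"
    using assms by (intro slab_arrivals_set) simp
  have sort_k: "sorted_wrt (\<lambda>p q. fst p < fst q) (slab_arrivals N Q m k)"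
    using assms by (intro slab_arrivals_sorted) simp
  show "set (slab_arrivals N Q m k @
      (if \<exists>p\<in>slab_points N Q m k. fst p \<le> s then [the_elem (slab_points N Q m k)] else [])) = {p \<in> Q. fst p \<le> s}"
    unfolding split by (rule slab_points_cases[OF assms(1)]) (auto simp: set_k)
  show "sorted_wrt (\<lambda>p q. fst p < fst q) (slab_arrivals N Q m k @
      (if \<exists>p\<in>slab_points N Q m k. fst p \<le> s then [the_elem (slab_points N Q m k)] else []))"
    by (rule slab_points_cases[OF assms(1)]) (auto simp: set_k sort_k sorted_wrt_append)
qed

lemma chain_exposed_slab:
  assumes "k \<le> H * m"
  shows "chain_exposed N c k (slab_position N Q m) y \<longleftrightarrow> exposed N c (rev (map snd (slab_arrivals N Q m k))) y"
  using assms
proof (induction k arbitrary: y)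
  case (Suc k)
  have k: "k < H * m" using Suc.prems by simp
  show ?case
    by (rule slab_points_cases[OF k])
      (use Suc k in \<open>auto simp: slab_arrivals_Suc slab_position_def\<close>)
qed (simp add: slab_arrivals_def)

text \<open>The number of trees can change only at an arrival. Just before the arrival the particle
  list is \<open>slab_arrivals\<close>, at the arrival it has one more entry, so
  \<open>disc_trees_increase_iff\<close> and \<open>exposed_iff\<close> decide.\<close>

lemma birth_iff_tree_born:
  assumes k: "k < H * m"
  shows "birth N (slit_factor N lam) (slab_position N Q m) k \<longleftrightarrow>
    (\<exists>t\<in>{real k / real m<..real (Suc k) / real m}. tree_born N lam Q t)"
proof -
  let ?c = "slit_factor N lam"
  let ?a = "\<lambda>ps. map (\<lambda>p. f_map N (of_real (snd p))) ps"
  have c: "1 < ?c" using slit_factor_gt_1[OF N lam] .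
  have norm_a: "\<forall>a\<in>set (?a ps). norm a = 1" for ps
    using norm_f_map_of_real[OF N c] by auto
  have num: "num_trees N lam Q s = card (disc_trees ?c (?a (arrivals Q s)))" for s
    using num_trees_eq[OF N lam] by (simp add: attachment_points_def[OF N lam])
  have no_point: "\<not> tree_born N lam Q t"
    if t: "t \<in> {real k / real m<..real (Suc k) / real m}" and np: "\<And>p. p \<in> slab_points N Q m k \<Longrightarrow> fst p \<noteq> t" for t
  proof
    assume "tree_born N lam Q t"
    then have ev: "\<forall>\<^sub>F s in at_left t. num_trees N lam Q s < num_trees N lam Q t"
      by (simp add: tree_born_def)
    \<comment> \<open>b is the arrival of this slab if it precedes t, and the left end of the slab
      otherwise. No particle arrives in (b, t], so the tree count is constant there and cannot
      increase at t.\<close>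
    obtain b where b: "b < t" "real k / real m \<le> b" "\<And>p. p \<in> slab_points N Q m k \<Longrightarrow> fst p < t \<Longrightarrow> fst p \<le> b"
    proof (rule slab_points_cases[OF k])
      assume "slab_points N Q m k = {}"
      then show ?thesis using that[of "real k / real m"] t by auto
    next
      fix p assume p: "slab_points N Q m k = {p}" "real k / real m < fst p"
      show ?thesis
      proof (cases "fst p < t")
        case True
        then show ?thesis using that[of "fst p"] p by auto
      next
        case False
        then show ?thesis using that[of "real k / real m"] p t by auto
      qed
    qed
    have "\<forall>\<^sub>F s in at_left t. s \<in> {b<..<t}"
      using b(1) by (rule eventually_at_left_real)
    with ev have "\<forall>\<^sub>F s in at_left t. False"
    proof eventually_elim
      case (elim s)
      have "arrivals Q s = arrivals Q t"
      proof -
        have "(\<exists>p\<in>slab_points N Q m k. fst p \<le> s) \<longleftrightarrow> (\<exists>p\<in>slab_points N Q m k. fst p \<le> t)"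
          using b(3) np elim(2) by (smt (verit) greaterThanLessThan_iff)
        then show ?thesis
          using arrivals_slab[OF k, of s] arrivals_slab[OF k, of t] t b elim(2) by simp
      qed
      then show False using elim(1) by (simp add: num)
    qed
    then show False by simp
  qed
  show ?thesis
  proof (rule slab_points_cases[OF k])
    assume e: "slab_points N Q m k = {}"
    then have "\<not> birth N ?c (slab_position N Q m) k"
      by (simp add: birth_def exposed_set_def slab_position_def)
    then show ?thesis using no_point e by auto
  next
    fix p assume p: "slab_points N Q m k = {p}" "real k / real m < fst p" "fst p \<le> real (Suc k) / real m"
      "snd p \<in> {0..<2 * pi * real N}" "p \<in> Q"
    let ?ps = "slab_arrivals N Q m k"
    have pos: "slab_position N Q m k = snd p" by (simp add: slab_position_def p(1))
    have "birth N ?c (slab_position N Q m) k \<longleftrightarrow> exposed N ?c (rev (map snd ?ps)) (snd p)"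
      using p(4) k by (simp add: birth_def exposed_set_def pos chain_exposed_slab)
    also have "\<dots> \<longleftrightarrow> norm (disc_aggregate ?c (?a ?ps) (f_map N (of_real (snd p)))) = 1"
      using exposed_iff[OF N c, of "rev (map snd ?ps)" "snd p"] by (simp add: o_def)
    also have "\<dots> \<longleftrightarrow> card (disc_trees ?c (?a ?ps)) < card (disc_trees ?c (?a ?ps @ [f_map N (of_real (snd p))]))"
      using disc_trees_increase_iff[OF c norm_a[of ?ps] norm_f_map_of_real[OF N c]] by simp
    also have "\<dots> \<longleftrightarrow> tree_born N lam Q (fst p)"
    proof -
      have "arrivals Q (fst p) = ?ps @ [p]"
        using arrivals_slab[OF k, of "fst p"] p by simp
      then have np: "num_trees N lam Q (fst p) = card (disc_trees ?c (?a ?ps @ [f_map N (of_real (snd p))]))"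
        by (simp add: num)
      have ns: "num_trees N lam Q s = card (disc_trees ?c (?a ?ps))" if "real k / real m < s" "s < fst p" for s
        using arrivals_slab[OF k, of s] p that by (simp add: num)
      have near: "\<forall>\<^sub>F s in at_left (fst p). s \<in> {real k / real m<..<fst p}"
        using p(2) by (rule eventually_at_left_real)
      have "0 \<le> real k / real m" by simp
      then have "0 < fst p" using p(2) by linarith
      moreover have "(\<forall>\<^sub>F s in at_left (fst p). num_trees N lam Q s < num_trees N lam Q (fst p)) \<longleftrightarrow>
          (\<forall>\<^sub>F s in at_left (fst p). card (disc_trees ?c (?a ?ps)) < card (disc_trees ?c (?a ?ps @ [f_map N (of_real (snd p))])))"
        by (rule eventually_cong[OF near]) (simp add: ns np)
      ultimately show ?thesis by (simp add: tree_born_def)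
    qed
    also have "\<dots> \<longleftrightarrow> (\<exists>t\<in>{real k / real m<..real (Suc k) / real m}. tree_born N lam Q t)"
      using p no_point by force
    finally show ?thesis .
  qed
qed

end

section \<open>The Poisson process seen through slabs\<close>

lemma measure_space_time:
  assumes [measurable]: "I \<in> sets borel" and I: "I \<subseteq> {0..<2 * pi * real N}" and ab: "0 \<le> a" "a \<le> b"
  shows "{a<..b} \<times> I \<in> sets (space_time N)"
    and "emeasure (space_time N) ({a<..b} \<times> I) = ennreal ((b - a) * measure lborel I)"
proof -
  have S: "({0..} \<times> {0..<2 * pi * real N} :: (real \<times> real) set) \<in> sets borel"
    by (intro borel_Times) auto
  have B: "({a<..b} \<times> I) \<in> sets borel" by (intro borel_Times) auto
  have sub: "{a<..b} \<times> I \<subseteq> {0..} \<times> {0..<2 * pi * real N}" using I ab by auto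
  show "{a<..b} \<times> I \<in> sets (space_time N)"
    unfolding space_time_def using S B sub by (subst sets_restrict_space_iff) auto
  have "emeasure lborel I \<le> emeasure lborel {0..<2 * pi * real N}"
    using I by (intro emeasure_mono) auto
  then have fin: "emeasure lborel I \<noteq> \<infinity>" by (auto simp: top_unique)
  have "emeasure (space_time N) ({a<..b} \<times> I) = emeasure lborel ({a<..b} \<times> I)"
    unfolding space_time_def using S sub by (subst emeasure_restrict_space) auto
  also have "\<dots> = emeasure lborel {a<..b} * emeasure lborel I"
    by (simp add: lborel.emeasure_pair_measure_Times flip: lborel_prod)
  also have "\<dots> = ennreal ((b - a) * measure lborel I)"
    using ab fin by (simp add: emeasure_eq_ennreal_measure ennreal_mult)
  finally show "emeasure (space_time N) ({a<..b} \<times> I) = ennreal ((b - a) * measure lborel I)" .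
qed

lemma emeasure_space_time_0:
  "{0} \<times> {0..<2 * pi * real N} \<in> sets (space_time N)"
  "emeasure (space_time N) ({0} \<times> {0..<2 * pi * real N}) = 0"
proof -
  have S: "({0..} \<times> {0..<2 * pi * real N} :: (real \<times> real) set) \<in> sets borel"
    by (intro borel_Times) auto
  have B: "({0} \<times> {0..<2 * pi * real N} :: (real \<times> real) set) \<in> sets borel" by (intro borel_Times) auto
  show "{0} \<times> {0..<2 * pi * real N} \<in> sets (space_time N)"
    unfolding space_time_def using S B by (subst sets_restrict_space_iff) auto
  have "emeasure (space_time N) ({0} \<times> {0..<2 * pi * real N}) = emeasure lborel ({0::real} \<times> {0..<2 * pi * real N})"
    unfolding space_time_def using S by (subst emeasure_restrict_space) auto
  then show "emeasure (space_time N) ({0} \<times> {0..<2 * pi * real N}) = 0"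
    by (simp add: lborel.emeasure_pair_measure_Times flip: lborel_prod)
qed

lemma slab_space_time:
  assumes "I \<in> sets borel" "I \<subseteq> {0..<2 * pi * real N}" "1 \<le> m"
  shows "slab m k I \<in> sets (space_time N)"
    and "emeasure (space_time N) (slab m k I) = ennreal (measure lborel I / real m)"
proof -
  have d: "real (Suc k) / real m - real k / real m = 1 / real m"
    using assms(3) by (simp add: field_simps)
  have le: "0 \<le> real k / real m" "real k / real m \<le> real (Suc k) / real m"
    by (simp_all add: divide_right_mono)
  show "slab m k I \<in> sets (space_time N)"
    "emeasure (space_time N) (slab m k I) = ennreal (measure lborel I / real m)"
    unfolding slab_def using measure_space_time[OF assms(1,2) le] by (simp_all only: d) simp_all
qed

lemma slab_disjoint:
  assumes "k < l" "1 \<le> m"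
  shows "slab m k I \<inter> slab m l I' = {}"
proof -
  have "real (Suc k) / real m \<le> real l / real m"
    using assms by (intro divide_right_mono) auto
  then show ?thesis by (force simp: slab_def)
qed

locale poisson_process =
  fixes N :: nat and M :: "'w measure" and P :: "'w \<Rightarrow> (real \<times> real) set" and L :: real
  assumes N: "1 \<le> N" and ppp: "poisson_point_process M (space_time N) P"
  defines "L \<equiv> 2 * pi * real N"
begin

sublocale prob_space M using ppp by (simp add: poisson_point_process_def)

lemma L_positive: "0 < L" using N by (simp add: L_def)

lemma P_subset: "w \<in> space M \<Longrightarrow> P w \<subseteq> {0..} \<times> {0..<L}"
  using ppp by (auto simp: poisson_point_process_def space_time_def space_restrict_space L_def)

lemma
  assumes "A \<in> sets (space_time N)" "emeasure (space_time N) A < \<infinity>"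
  shows AE_finite_points: "AE w in M. finite (P w \<inter> A)"
    and measurable_count: "(\<lambda>w. card (P w \<inter> A)) \<in> measurable M (count_space UNIV)"
    and prob_count: "prob {w \<in> space M. card (P w \<inter> A) = n} =
      measure (space_time N) A ^ n / fact n * exp (- measure (space_time N) A)"
  using ppp assms by (auto simp: poisson_point_process_def)

text \<open>In the definition of the process, counts are indexed by the sets themselves, so an
  indexed family has to be injective first. For disjoint sets this can fail only through repeated
  empty sets; these are split off, their counts being 0 everywhere.\<close>

lemma prob_counts:
  assumes J: "finite J" and A: "\<And>j. j \<in> J \<Longrightarrow> A j \<in> sets (space_time N)"
    "\<And>j. j \<in> J \<Longrightarrow> emeasure (space_time N) (A j) < \<infinity>" and dj: "disjoint_family_on A J"
  shows "prob {w \<in> space M. \<forall>j\<in>J. card (P w \<inter> A j) = n j} = (\<Prod>j\<in>J. prob {w \<in> space M. card (P w \<inter> A j) = n j})"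
proof -
  define J' where "J' = {j \<in> J. A j \<noteq> {}}"
  have J': "J' \<subseteq> J" "finite J'" using J by (auto simp: J'_def)
  have inj: "inj_on A J'"
    using dj by (auto simp: J'_def inj_on_def disjoint_family_on_def)
  have empty: "prob {w \<in> space M. card (P w \<inter> A j) = n j} = (if n j = 0 then 1 else 0)" if "j \<in> J - J'" for j
    using that by (auto simp: J'_def prob_space)
  show ?thesis
  proof (cases "\<exists>j\<in>J - J'. n j \<noteq> 0")
    case True
    then obtain j where j: "j \<in> J - J'" "n j \<noteq> 0" by auto
    have "card (P w \<inter> A j) \<noteq> n j" for w using j by (simp add: J'_def)
    then have "{w \<in> space M. \<forall>j\<in>J. card (P w \<inter> A j) = n j} = {}"
      using j(1) by blast
    moreover have "(\<Prod>j\<in>J. prob {w \<in> space M. card (P w \<inter> A j) = n j}) = 0"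
      using j J empty[OF j(1)] by (intro prod_zero) auto
    ultimately show ?thesis by (simp only: measure_empty)
  next
    case False
    have "(\<Prod>j\<in>J. prob {w \<in> space M. card (P w \<inter> A j) = n j}) = (\<Prod>j\<in>J'. prob {w \<in> space M. card (P w \<inter> A j) = n j})"
      using False J' J empty by (intro prod.mono_neutral_right) auto
    also have "\<dots> = prob {w \<in> space M. \<forall>j\<in>J'. card (P w \<inter> A j) = n j}"
    proof (cases "J' = {}")
      case False
      have "indep_vars (\<lambda>_. count_space UNIV) (\<lambda>a w. card (P w \<inter> a)) (A ` J')"
      proof -
        have "disjoint (A ` J')"
          by (rule disjoint_family_on_disjoint_image[OF disjoint_family_on_mono[OF J'(1) dj]])
        then have "finite (A ` J') \<and> disjoint (A ` J') \<and>
            (\<forall>a\<in>A ` J'. a \<in> sets (space_time N) \<and> emeasure (space_time N) a < \<infinity>)"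
          using J' A by auto
        then show ?thesis
          using ppp unfolding poisson_point_process_def by blast
      qed
      then have "prob (\<Inter>a\<in>A ` J'. (\<lambda>w. card (P w \<inter> a)) -` {n (inv_into J' A a)} \<inter> space M) =
          (\<Prod>a\<in>A ` J'. prob ((\<lambda>w. card (P w \<inter> a)) -` {n (inv_into J' A a)} \<inter> space M))"
        using False J' by (intro indep_varsD) auto
      also have "\<dots> = (\<Prod>j\<in>J'. prob {w \<in> space M. card (P w \<inter> A j) = n j})"
        unfolding prod.reindex[OF inj] using inj
        by (intro prod.cong refl) (auto intro!: arg_cong[where f = prob] simp: inv_into_f_f)
      also have "(\<Inter>a\<in>A ` J'. (\<lambda>w. card (P w \<inter> a)) -` {n (inv_into J' A a)} \<inter> space M) =
          {w \<in> space M. \<forall>j\<in>J'. card (P w \<inter> A j) = n j}"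
        using False inj by (auto simp: inv_into_f_f)
      finally show ?thesis by simp
    qed (simp add: prob_space)
    also have "{w \<in> space M. \<forall>j\<in>J'. card (P w \<inter> A j) = n j} = {w \<in> space M. \<forall>j\<in>J. card (P w \<inter> A j) = n j}"
      using False by (auto simp: J'_def)
    finally show ?thesis by simp
  qed
qed

lemma measurable_slab_count [measurable]:
  assumes "I \<in> sets borel" "I \<subseteq> {0..<L}" "1 \<le> m"
  shows "(\<lambda>w. card (P w \<inter> slab m k I)) \<in> measurable M (count_space UNIV)"
  using slab_space_time[OF assms[unfolded L_def]] by (intro measurable_count) auto

lemma prob_slab_count:
  assumes "I \<in> sets borel" "I \<subseteq> {0..<L}" "1 \<le> m"
  shows "prob {w \<in> space M. card (P w \<inter> slab m k I) = n} =
    (measure lborel I / real m) ^ n / fact n * exp (- (measure lborel I / real m))"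
proof -
  have e: "emeasure (space_time N) (slab m k I) = ennreal (measure lborel I / real m)"
    by (rule slab_space_time(2)) (use assms in \<open>simp_all add: L_def\<close>)
  have "measure (space_time N) (slab m k I) = measure lborel I / real m"
    unfolding measure_def[of "space_time N"] e by simp
  then show ?thesis
    using prob_count[of "slab m k I" n] slab_space_time(1)[of I N m k] e assms by (simp add: L_def)
qed

text \<open>Since \<open>card\<close> is 0 on infinite sets, counts can be added and a zero count
  read as emptiness only once finiteness is known.\<close>

lemma AE_finite_slabs: "AE w in M. \<forall>m\<ge>1. \<forall>k. finite (slab_points N (P w) m k)"
proof -
  have "AE w in M. finite (slab_points N (P w) m k)" if "1 \<le> m" for m k
    unfolding slab_points_def
    using slab_space_time[of "{0..<2 * pi * real N}" N m k] that by (intro AE_finite_points) auto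
  then show ?thesis by (simp add: AE_all_countable)
qed

lemma AE_no_point_at_0: "AE w in M. \<forall>p\<in>P w. fst p \<noteq> 0"
proof -
  let ?A = "{0::real} \<times> {0..<2 * pi * real N}"
  have A: "?A \<in> sets (space_time N)" "emeasure (space_time N) ?A < \<infinity>" "measure (space_time N) ?A = 0"
    using emeasure_space_time_0[of N] by (auto simp: measure_def)
  have "prob {w \<in> space M. card (P w \<inter> ?A) = 0} = 1"
    using prob_count[OF A(1,2), of 0] A(3) by simp
  then have "AE w in M. card (P w \<inter> ?A) = 0"
    using measurable_count[OF A(1,2)] by (subst (asm) prob_Collect_eq_1) auto
  with AE_finite_points[OF A(1,2)] AE_space show ?thesis
  proof eventually_elim
    case (elim w)
    then have "P w \<inter> ?A = {}" by simp
    then show ?case using P_subset[OF elim(2)] by (force simp: L_def)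
  qed
qed

abbreviation position :: "nat \<Rightarrow> nat \<Rightarrow> 'w \<Rightarrow> real" where
  "position m k w \<equiv> slab_position N (P w) m k"

text \<open>The position of a lone particle lies in B iff the strip over B contains exactly one
  particle as well. Thus the event is expressed by two measurable counts, and by the default value
  otherwise.\<close>

lemma measurable_position [measurable]:
  assumes m: "1 \<le> m"
  shows "position m k \<in> borel_measurable M"
proof (rule measurableI)
  fix B :: "real set" assume B [measurable]: "B \<in> sets borel"
  let ?C1 = "\<lambda>w. card (P w \<inter> slab m k (B \<inter> {0..<L}))" and ?C = "\<lambda>w. card (P w \<inter> slab m k {0..<L})"
  have [measurable]: "?C1 \<in> measurable M (count_space UNIV)" "?C \<in> measurable M (count_space UNIV)"
    using m by (auto intro!: measurable_slab_count)
  have "position m k w \<in> B \<longleftrightarrow> (?C1 w = 1 \<and> ?C w = 1) \<or> (?C w \<noteq> 1 \<and> -1 \<in> B)" for w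
  proof (cases "?C w = 1")
    case True
    then obtain p where p: "P w \<inter> slab m k {0..<L} = {p}" by (auto simp: card_1_singleton_iff)
    have "P w \<inter> slab m k (B \<inter> {0..<L}) = {q \<in> P w \<inter> slab m k {0..<L}. snd q \<in> B}"
      by (auto simp: slab_def)
    also have "\<dots> = (if snd p \<in> B then {p} else {})" unfolding p by auto
    finally show ?thesis using p by (simp add: slab_position_def slab_points_def flip: L_def)
  qed (simp add: slab_position_def slab_points_def flip: L_def)
  then have "position m k -` B \<inter> space M = {w \<in> space M. (?C1 w = 1 \<and> ?C w = 1) \<or> (?C w \<noteq> 1 \<and> -1 \<in> B)}"
    by auto
  also have "\<dots> \<in> events" by measurable
  finally show "position m k -` B \<inter> space M \<in> events" .
qed simp

text \<open>The density in x of the event that the slab contains exactly one particle and that it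
  sits above x: intensity 1/m times the probability exp(-L/m) of no further particle.\<close>

definition rate :: "nat \<Rightarrow> real" where "rate m = exp (- (L / real m)) / real m"

text \<open>The position lies in I j iff the strip over I j has one particle and the complementary
  strip none. All these strips are disjoint, so the counts are independent, and the two exponentials
  of each slab multiply to exp(-L/m).\<close>

lemma prob_positions:
  assumes J: "finite J" and m: "1 \<le> m" and I: "\<And>j. j \<in> J \<Longrightarrow> I j \<in> sets borel" "\<And>j. j \<in> J \<Longrightarrow> I j \<subseteq> {0..<L}"
  shows "prob {w \<in> space M. \<forall>j\<in>J. position m j w \<in> I j} = (\<Prod>j\<in>J. rate m * measure lborel (I j))"
proof -
  define A where "A = (\<lambda>(j, b). slab m j (if b then I j else {0..<L} - I j))"
  define n :: "nat \<times> bool \<Rightarrow> nat" where "n = (\<lambda>(j, b). if b then 1 else 0)"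
  have IS: "(if b then I j else {0..<L} - I j) \<in> sets borel" "(if b then I j else {0..<L} - I j) \<subseteq> {0..<L}"
    if "j \<in> J" for j b using I[OF that] by auto
  have "AE w in M. (\<forall>j\<in>J. position m j w \<in> I j) \<longleftrightarrow> (\<forall>p\<in>J \<times> UNIV. card (P w \<inter> A p) = n p)"
    using AE_finite_slabs
  proof eventually_elim
    case (elim w)
    have "position m j w \<in> I j \<longleftrightarrow> card (P w \<inter> slab m j (I j)) = 1 \<and> card (P w \<inter> slab m j ({0..<L} - I j)) = 0"
      if j: "j \<in> J" for j
    proof -
      let ?S1 = "P w \<inter> slab m j (I j)" and ?S2 = "P w \<inter> slab m j ({0..<L} - I j)"
      have S: "slab_points N (P w) m j = ?S1 \<union> ?S2"
        using I(2)[OF j] by (auto simp: slab_points_def slab_def L_def)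
      have "finite (?S1 \<union> ?S2)" using elim m S by metis
      then have f: "finite ?S1" "finite ?S2" by auto
      have dj: "?S1 \<inter> ?S2 = {}" by (auto simp: slab_def)
      have card: "card (slab_points N (P w) m j) = card ?S1 + card ?S2"
        unfolding S by (rule card_Un_disjoint[OF f dj])
      have neg: "-1 \<notin> I j" using I(2)[OF j] by auto
      show ?thesis
      proof (cases "card (slab_points N (P w) m j) = 1")
        case True
        then obtain p where p: "slab_points N (P w) m j = {p}" by (auto simp: card_1_singleton_iff)
        have pos: "position m j w = snd p" by (simp add: slab_position_def p)
        have u: "?S1 \<union> ?S2 = {p}" using p S by simp
        have "snd p \<in> I j \<longleftrightarrow> ?S2 = {}"
        proof
          assume "snd p \<in> I j"
          then have "p \<notin> ?S2" by (auto simp: slab_def)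
          moreover have "?S2 \<subseteq> {p}"
            unfolding u[symmetric] by (rule Un_upper2)
          ultimately show "?S2 = {}" by (metis subset_singletonD insertI1)
        next
          assume "?S2 = {}"
          then have "p \<in> ?S1" using u by blast
          then show "snd p \<in> I j" by (auto simp: slab_def)
        qed
        also have "\<dots> \<longleftrightarrow> card ?S2 = 0" using f(2) by simp
        finally show ?thesis using card True by (auto simp: pos)
      next
        case False
        then show ?thesis using card neg by (auto simp: slab_position_def)
      qed
    qed
    then show ?case by (auto simp: A_def n_def)
  qed
  moreover have count: "(\<lambda>w. card (P w \<inter> A p)) \<in> measurable M (count_space UNIV)" if p_in: "p \<in> J \<times> UNIV" for p
  proof -
    obtain j b where p: "p = (j, b)" "j \<in> J" using p_in by auto
    show ?thesis
      unfolding p(1) A_def prod.case by (rule measurable_slab_count[OF IS[OF p(2)] m])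
  qed
  moreover have "{w \<in> space M. \<forall>j\<in>J. position m j w \<in> I j} \<in> events"
  proof (rule sets.sets_Collect_finite_All[OF _ J])
    fix j assume "j \<in> J"
    then have [measurable]: "I j \<in> sets borel" by (rule I(1))
    have [measurable]: "position m j \<in> borel_measurable M" by (rule measurable_position[OF m])
    show "{w \<in> space M. position m j w \<in> I j} \<in> events" by measurable
  qed
  moreover have "{w \<in> space M. \<forall>p\<in>J \<times> UNIV. card (P w \<inter> A p) = n p} \<in> events"
  proof (rule sets.sets_Collect_finite_All)
    fix p assume "p \<in> J \<times> (UNIV :: bool set)"
    then have [measurable]: "(\<lambda>w. card (P w \<inter> A p)) \<in> measurable M (count_space UNIV)" by (rule count)
    show "{w \<in> space M. card (P w \<inter> A p) = n p} \<in> events" by measurable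
  qed (use J in simp)
  ultimately have "prob {w \<in> space M. \<forall>j\<in>J. position m j w \<in> I j} = prob {w \<in> space M. \<forall>p\<in>J \<times> UNIV. card (P w \<inter> A p) = n p}"
    by (intro finite_measure_eq_AE) auto
  also have "\<dots> = (\<Prod>p\<in>J \<times> UNIV. prob {w \<in> space M. card (P w \<inter> A p) = n p})"
  proof (rule prob_counts)
    show "disjoint_family_on A (J \<times> UNIV)"
      unfolding disjoint_family_on_def
    proof (intro ballI impI)
      fix p p' :: "nat \<times> bool" assume "p \<noteq> p'"
      then have "fst p \<noteq> fst p' \<or> snd p \<noteq> snd p'" by (simp only: prod_eq_iff de_Morgan_conj)
      then consider "fst p < fst p'" | "fst p' < fst p" | "fst p = fst p'" "snd p \<noteq> snd p'"
        by linarith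
      then show "A p \<inter> A p' = {}"
      proof cases
        case 1
        then show ?thesis using slab_disjoint[OF 1 m] by (simp add: A_def case_prod_beta)
      next
        case 2
        then show ?thesis using slab_disjoint[OF 2 m] by (simp add: A_def case_prod_beta Int_commute)
      next
        case 3
        then show ?thesis by (auto simp: A_def case_prod_beta slab_def split: if_splits)
      qed
    qed
    show "A p \<in> sets (space_time N)" "emeasure (space_time N) (A p) < \<infinity>" if p_in: "p \<in> J \<times> UNIV" for p
    proof -
      obtain j b where p: "p = (j, b)" "j \<in> J" using p_in by auto
      note st = slab_space_time[OF IS[OF p(2), of b, unfolded L_def] m, of j, folded L_def]
      show "A p \<in> sets (space_time N)" "emeasure (space_time N) (A p) < \<infinity>"
        unfolding p(1) A_def prod.case by (rule st(1)) (simp only: st(2) ennreal_less_top infinity_ennreal_def)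
    qed
  qed (use J in simp)
  also have "\<dots> = (\<Prod>j\<in>J. \<Prod>b\<in>UNIV. prob {w \<in> space M. card (P w \<inter> A (j, b)) = n (j, b)})"
    by (simp add: prod.cartesian_product)
  also have "\<dots> = (\<Prod>j\<in>J. rate m * measure lborel (I j))"
  proof (intro prod.cong refl)
    fix j assume j: "j \<in> J"
    have "measure lborel ({0..<L} - I j) = L - measure lborel (I j)"
      using I[OF j] L_positive by (subst measure_Diff) (auto simp: fmeasurable_def)
    then have "(\<Prod>b\<in>UNIV. prob {w \<in> space M. card (P w \<inter> A (j, b)) = n (j, b)}) =
       measure lborel (I j) / real m * (exp (- (measure lborel (I j) / real m)) * exp (- ((L - measure lborel (I j)) / real m)))"
      using I[OF j] m by (simp add: UNIV_bool A_def n_def prob_slab_count)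
    also have "exp (- (measure lborel (I j) / real m)) * exp (- ((L - measure lborel (I j)) / real m)) = exp (- (L / real m))"
      by (simp add: diff_divide_distrib flip: exp_add)
    finally show "(\<Prod>b\<in>UNIV. prob {w \<in> space M. card (P w \<inter> A (j, b)) = n (j, b)}) = rate m * measure lborel (I j)"
      by (simp add: rate_def)
  qed
  finally show ?thesis .
qed

text \<open>The product formula is available only for events inside [0, L). They are stable under
  intersection, and they generate all events of the position because its only other value is -1,
  reached through the complement.\<close>

lemma indep_positions:
  assumes m: "1 \<le> m"
  shows "indep_vars (\<lambda>_. borel) (position m) K"
  unfolding indep_vars_def2
proof
  show "\<forall>k\<in>K. random_variable borel (position m k)" using measurable_position[OF m] by auto
  define G where "G = (\<lambda>k. {{w \<in> space M. position m k w \<in> I} |I. I \<in> sets borel \<and> I \<subseteq> {0..<L}})"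
  have "indep_sets (\<lambda>k. sigma_sets (space M) (G k)) K"
  proof (rule indep_sets_sigma)
    show "Int_stable (G k)" for k
      unfolding Int_stable_def
    proof (intro ballI)
      fix a b assume "a \<in> G k" "b \<in> G k"
      then obtain I I' where "a = {w \<in> space M. position m k w \<in> I}" "b = {w \<in> space M. position m k w \<in> I'}"
        "I \<in> sets borel" "I \<subseteq> {0..<L}" "I' \<in> sets borel" by (auto simp: G_def)
      then show "a \<inter> b \<in> G k" unfolding G_def by (intro CollectI exI[of _ "I \<inter> I'"]) auto
    qed
    show "indep_sets G K"
    proof (rule indep_setsI)
      show "G k \<subseteq> events" for k using measurable_position[OF m] by (auto simp: G_def)
      fix A J assume J: "J \<noteq> {}" "J \<subseteq> K" "finite J" "\<forall>j\<in>J. A j \<in> G j"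
      then have "\<forall>j\<in>J. \<exists>I. A j = {w \<in> space M. position m j w \<in> I} \<and> I \<in> sets borel \<and> I \<subseteq> {0..<L}"
        by (auto simp: G_def)
      then obtain I where I: "\<And>j. j \<in> J \<Longrightarrow> A j = {w \<in> space M. position m j w \<in> I j}"
        "\<And>j. j \<in> J \<Longrightarrow> I j \<in> sets borel" "\<And>j. j \<in> J \<Longrightarrow> I j \<subseteq> {0..<L}"
        by metis
      have "(\<Inter>j\<in>J. A j) = {w \<in> space M. \<forall>j\<in>J. position m j w \<in> I j}"
        using J(1) I(1) by auto
      then have "prob (\<Inter>j\<in>J. A j) = (\<Prod>j\<in>J. rate m * measure lborel (I j))"
        using prob_positions[OF J(3) m I(2,3)] by simp
      also have "\<dots> = (\<Prod>j\<in>J. prob (A j))"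
        using I prob_positions[of "{_}" m I] m by (intro prod.cong) auto
      finally show "prob (\<Inter>j\<in>J. A j) = (\<Prod>j\<in>J. prob (A j))" .
    qed
  qed
  then show "indep_sets (\<lambda>k. {position m k -` A \<inter> space M |A. A \<in> sets borel}) K"
  proof (rule indep_sets_mono_sets)
    fix k
    interpret sigma_algebra "space M" "sigma_sets (space M) (G k)"
      by (rule sigma_algebra_sigma_sets) (auto simp: G_def)
    show "{position m k -` A \<inter> space M |A. A \<in> sets borel} \<subseteq> sigma_sets (space M) (G k)"
    proof clarify
      fix B :: "real set" assume B: "B \<in> sets borel"
      have in_G: "{w \<in> space M. position m k w \<in> I} \<in> sigma_sets (space M) (G k)" if "I \<in> sets borel" "I \<subseteq> {0..<L}" for I
        using that by (intro sigma_sets.Basic) (auto simp: G_def)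
      have range: "position m k w \<in> {0..<L} \<or> position m k w = -1" if "w \<in> space M" for w
      proof (cases "card (slab_points N (P w) m k) = 1")
        case True
        then obtain p where p: "slab_points N (P w) m k = {p}" by (auto simp: card_1_singleton_iff)
        then have "p \<in> slab_points N (P w) m k" by simp
        then have "snd p \<in> {0..<L}" by (auto simp: slab_points_def slab_def L_def)
        then show ?thesis using p by (simp add: slab_position_def)
      qed (simp add: slab_position_def)
      have "position m k -` B \<inter> space M = {w \<in> space M. position m k w \<in> B \<inter> {0..<L}} \<union>
          (if -1 \<in> B then space M - {w \<in> space M. position m k w \<in> {0..<L}} else {})"
      proof (intro set_eqI)
        fix w
        show "w \<in> position m k -` B \<inter> space M \<longleftrightarrow> w \<in> {w \<in> space M. position m k w \<in> B \<inter> {0..<L}} \<union>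
          (if -1 \<in> B then space M - {w \<in> space M. position m k w \<in> {0..<L}} else {})"
          using range[of w] by (cases "position m k w \<in> {0..<L}") auto
      qed
      also have "\<dots> \<in> sigma_sets (space M) (G k)"
      proof -
        have 1: "{w \<in> space M. position m k w \<in> B \<inter> {0..<L}} \<in> sigma_sets (space M) (G k)"
          using B by (intro in_G) auto
        have 2: "{w \<in> space M. position m k w \<in> {0..<L}} \<in> sigma_sets (space M) (G k)"
          by (intro in_G) auto
        show ?thesis
          using 1 Un[OF 1 compl_sets[OF 2]] by (cases "-1 \<in> B") (simp_all only: if_True if_False Un_empty_right)
      qed
      finally show "position m k -` B \<inter> space M \<in> sigma_sets (space M) (G k)" .
    qed
  qed
qed

lemma particle_chain_positions:
  assumes m: "1 \<le> m" and c: "1 < c"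
  shows "particle_chain M N c (rate m) K (position m)"
proof
  show "0 < rate m" using m by (simp add: rate_def)
  have "L / real m \<le> exp (L / real m)" using exp_ge_add_one_self[of "L / real m"] by linarith
  then have "L / real m * exp (- (L / real m)) \<le> exp (L / real m) * exp (- (L / real m))"
    by (intro mult_right_mono) auto
  then have "L / real m * exp (- (L / real m)) \<le> 1" by (simp flip: exp_add)
  then show "rate m * (2 * pi * real N) \<le> 1" by (simp add: rate_def L_def mult.commute)
  show "prob {w \<in> space M. position m k w \<in> B} = rate m * measure lborel B"
    if "B \<in> sets borel" "B \<subseteq> {0..<2 * pi * real N}" for k B
    using prob_positions[of "{k}" m "\<lambda>_. B"] that m by (simp add: L_def)
qed (use N c indep_positions[OF m] measurable_position[OF m] in auto)

section \<open>Slabs with several particles\<close>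

definition crowded :: "nat \<Rightarrow> nat \<Rightarrow> 'w set" where
  "crowded m H = {w \<in> space M. \<exists>k<H * m. 2 \<le> card (P w \<inter> slab m k {0..<L})}"

text \<open>A Poisson variable of mean x is at least 2 with probability 1 - exp(-x)(1 + x), which is
  at most 1 - (1 - x)(1 + x) = x^2. With x = L/m, the sum over H m slabs is of order 1/m.\<close>

lemma crowded:
  assumes m: "1 \<le> m"
  shows sets_crowded: "crowded m H \<in> events"
    and prob_crowded: "prob (crowded m H) \<le> real H * L\<^sup>2 / real m"
proof -
  let ?B = "\<lambda>k. {w \<in> space M. 2 \<le> card (P w \<inter> slab m k {0..<L})}"
  have [measurable]: "(\<lambda>w. card (P w \<inter> slab m k {0..<L})) \<in> measurable M (count_space UNIV)" for k
    using m by (intro measurable_slab_count) auto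
  have U: "crowded m H = (\<Union>k<H * m. ?B k)" by (auto simp: crowded_def)
  show "crowded m H \<in> events" unfolding U by measurable
  define x where "x = L / real m"
  have x: "0 \<le> x" using L_positive by (simp add: x_def)
  have B: "prob (?B k) \<le> x\<^sup>2" for k
  proof -
    let ?E = "\<lambda>n. {w \<in> space M. card (P w \<inter> slab m k {0..<L}) = n}"
    have p: "prob (?E 0) = exp (- x)" "prob (?E 1) = x * exp (- x)"
      using prob_slab_count[of "{0..<L}" m k 0] prob_slab_count[of "{0..<L}" m k 1] m L_positive
      by (simp_all add: x_def)
    have "?B k = space M - (?E 0 \<union> ?E 1)" by auto
    then have "prob (?B k) = 1 - prob (?E 0 \<union> ?E 1)"
      by (simp only:) (rule prob_compl, measurable)
    also have "prob (?E 0 \<union> ?E 1) = prob (?E 0) + prob (?E 1)"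
      by (rule finite_measure_Union) auto
    also have "1 - (prob (?E 0) + prob (?E 1)) = 1 - exp (- x) * (1 + x)"
      unfolding p by (simp add: algebra_simps)
    also have "\<dots> \<le> 1 - (1 - x) * (1 + x)"
      using exp_ge_add_one_self[of "- x"] x by (intro diff_left_mono mult_right_mono) auto
    also have "\<dots> = x\<^sup>2" by (simp add: power2_eq_square algebra_simps)
    finally show ?thesis .
  qed
  have "prob (crowded m H) \<le> (\<Sum>k<H * m. prob (?B k))"
    unfolding U by (rule finite_measure_subadditive_finite) auto
  also have "\<dots> \<le> (\<Sum>k<H * m. x\<^sup>2)" by (intro sum_mono B)
  also have "\<dots> = real H * L\<^sup>2 / real m"
    using m by (simp add: x_def power2_eq_square)
  finally show "prob (crowded m H) \<le> real H * L\<^sup>2 / real m" .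
qed

end

section \<open>Tree births in a unit time window\<close>

context poisson_process
begin

context
  fixes lam :: real and c h :: real
  assumes lam: "0 < lam"
  defines "c \<equiv> slit_factor N lam" and "h \<equiv> arc_radius N c"
begin

lemma c_gt_1: "1 < c" using slit_factor_gt_1[OF N lam] by (simp add: c_def)

lemma h_positive: "0 < h" using arc_radius_bounds[OF N c_gt_1] by (simp add: h_def)

definition born_in :: "nat \<Rightarrow> 'w \<Rightarrow> bool" where
  "born_in T w \<longleftrightarrow> (\<exists>t\<in>{real T<..real (Suc T)}. tree_born N lam (P w) t)"

definition chain_born :: "nat \<Rightarrow> nat \<Rightarrow> 'w set" where
  "chain_born m T = {w \<in> space M. \<exists>k\<in>{T * m..<T * m + m}. birth N c (\<lambda>i. position m i w) k}"

text \<open>All slabs up to time T + 1 have to be uncrowded, since the exposed set depends on the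
  whole past and not only on the window. The null set is common to all m and T, which later allows
  intersecting over m.\<close>

lemma AE_born_in_iff:
  "AE w in M. \<forall>m\<ge>1. \<forall>T. w \<notin> crowded m (Suc T) \<longrightarrow> (born_in T w \<longleftrightarrow> w \<in> chain_born m T)"
  using AE_finite_slabs AE_no_point_at_0 AE_space
proof eventually_elim
  case (elim w)
  show ?case
  proof (intro allI impI)
    fix m T :: nat assume m: "1 \<le> m" and nc: "w \<notin> crowded m (Suc T)"
    have iff: "birth N c (\<lambda>i. position m i w) k \<longleftrightarrow>
        (\<exists>t\<in>{real k / real m<..real (Suc k) / real m}. tree_born N lam (P w) t)" if k: "k < Suc T * m" for k
      unfolding c_def
    proof (rule birth_iff_tree_born[OF N lam m _ _ _ _ k])
      show "P w \<subseteq> {0..} \<times> {0..<2 * pi * real N}" using P_subset[OF elim(3)] by (simp add: L_def)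
      show "card (slab_points N (P w) m k) \<le> 1" if "k < Suc T * m" for k
        using nc elim(3) that by (auto simp: crowded_def slab_points_def L_def not_le)
    qed (use elim m in auto)
    show "born_in T w \<longleftrightarrow> w \<in> chain_born m T"
    proof
      assume "born_in T w"
      then obtain t where t: "real T < t" "t \<le> real (Suc T)" "tree_born N lam (P w) t"
        by (auto simp: born_in_def)
      then obtain k where k: "t \<in> {real k / real m<..real (Suc k) / real m}"
        using obtain_slab[of t m] m by (metis le_less_trans of_nat_0_le_iff)
      have "real k / real m < real (Suc T)" "real T < real (Suc k) / real m" using k t by auto
      then have "real k < real (Suc T * m)" "real (T * m) < real (Suc k)"
        using m by (simp_all add: field_simps)
      then have k': "k < Suc T * m" "T * m \<le> k" by (simp_all only: of_nat_less_iff less_Suc_eq_le)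
      then have "birth N c (\<lambda>i. position m i w) k" using iff k t(3) by blast
      then show "w \<in> chain_born m T" using k' elim(3) by (auto simp: chain_born_def add.commute)
    next
      assume "w \<in> chain_born m T"
      then obtain k where k: "T * m \<le> k" "k < T * m + m" "birth N c (\<lambda>i. position m i w) k"
        by (auto simp: chain_born_def)
      then obtain t where t: "real k / real m < t" "t \<le> real (Suc k) / real m" "tree_born N lam (P w) t"
        using iff[of k] by auto
      have "real T \<le> real k / real m" "real (Suc k) / real m \<le> real (Suc T)"
      proof -
        have "real (T * m) \<le> real k" "real (Suc k) \<le> real (Suc T * m)"
          using k by (simp_all only: of_nat_le_iff) simp
        then show "real T \<le> real k / real m" "real (Suc k) / real m \<le> real (Suc T)"
          using m by (simp_all only: of_nat_mult) (simp_all add: field_simps)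
      qed
      then have "t \<in> {real T<..real (Suc T)}" using t by auto
      then show "born_in T w" using t(3) by (auto simp: born_in_def)
    qed
  qed
qed

lemma sets_chain_born:
  assumes m: "1 \<le> m"
  shows "chain_born m T \<in> events"
proof -
  have [measurable]: "position m i \<in> borel_measurable M" for i by (rule measurable_position[OF m])
  show ?thesis unfolding chain_born_def by measurable
qed

lemma rate_le: "1 \<le> m \<Longrightarrow> real m * rate m \<le> 1"
  using L_positive by (simp add: rate_def)

text \<open>A union bound over the m slabs of the window, each birth probability being at most the
  one at the start of the window; \<open>rate_le\<close> absorbs the number of slabs.\<close>

lemma prob_chain_born_le:
  assumes m: "1 \<le> m"
  shows "prob (chain_born m T) \<le> L * (1 - 2 * h * rate m) ^ (T * m)"
proof -
  interpret C: particle_chain M N c "rate m" "T * m + m" "position m" L h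
    using particle_chain_positions[OF m c_gt_1] by (simp_all add: L_def h_def)
  have [measurable]: "position m i \<in> borel_measurable M" for i by (rule measurable_position[OF m])
  let ?B = "\<lambda>k. {w \<in> space M. birth N c (\<lambda>i. position m i w) k}"
  have r: "C.r = 1 - 2 * h * rate m" by (simp add: C.r_def)
  have rp: "0 < C.r" "C.r < 1" by (rule C.r_bounds)+
  have B: "prob (?B k) = rate m * L * C.r ^ k" if "k < T * m + m" for k
    using C.emeasure_birth[OF that] rp L_positive by (simp add: emeasure_eq_measure rate_def)
  have "chain_born m T = (\<Union>k\<in>{T * m..<T * m + m}. ?B k)" by (auto simp: chain_born_def)
  then have "prob (chain_born m T) \<le> (\<Sum>k\<in>{T * m..<T * m + m}. prob (?B k))"
    by (simp only:) (rule finite_measure_subadditive_finite, auto)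
  also have "\<dots> \<le> (\<Sum>k\<in>{T * m..<T * m + m}. rate m * L * C.r ^ (T * m))"
  proof (rule sum_mono)
    fix k assume k: "k \<in> {T * m..<T * m + m}"
    have "C.r ^ k \<le> C.r ^ (T * m)" using rp k by (intro power_decreasing) auto
    moreover have "0 \<le> rate m * L" using L_positive by (simp add: rate_def)
    ultimately have "rate m * L * C.r ^ k \<le> rate m * L * C.r ^ (T * m)" by (rule mult_left_mono)
    then show "prob (?B k) \<le> rate m * L * C.r ^ (T * m)" using B k by simp
  qed
  also have "\<dots> = (real m * rate m) * (L * C.r ^ (T * m))" by simp
  also have "\<dots> \<le> 1 * (L * C.r ^ (T * m))"
    using rate_le[OF m] rp L_positive by (intro mult_right_mono) auto
  finally show ?thesis by (simp add: r)
qed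

text \<open>Without a birth, either the exposed length at the end of the window is below half its
  mean, which \<open>prob_area_small\<close> controls, or it is at least that and all m slabs missed
  the exposed set.\<close>

lemma prob_chain_born_ge:
  assumes m: "1 \<le> m"
  defines "\<rho> \<equiv> 1 - 2 * h * rate m"
  shows "1 - (exp (- (real m * rate m * (L * \<rho> ^ (Suc T * m) / 2))) + 8 * h / (L * (\<rho> * \<rho> ^ (Suc T * m))))
    \<le> prob (chain_born m T)"
proof -
  interpret C: particle_chain M N c "rate m" "T * m + m" "position m" L h
    using particle_chain_positions[OF m c_gt_1] by (simp_all add: L_def h_def)
  have [measurable]: "position m i \<in> borel_measurable M" for i by (rule measurable_position[OF m])
  have r: "C.r = \<rho>" by (simp add: C.r_def \<rho>_def)
  have rp: "0 < \<rho>" "\<rho> < 1" using C.r_bounds by (simp_all add: r)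
  define K where "K = T * m + m"
  have K: "Suc T * m = K" by (simp add: K_def)
  define \<alpha> where "\<alpha> = L * \<rho> ^ K / 2"
  have \<alpha>: "0 \<le> \<alpha>" "\<alpha> \<le> L"
  proof -
    have "\<rho> ^ K \<le> 1" using rp by (intro power_le_one) auto
    then have "L * \<rho> ^ K \<le> L * 1" using L_positive by (intro mult_left_mono) auto
    moreover have "0 \<le> L * \<rho> ^ K" using L_positive rp by simp
    ultimately show "0 \<le> \<alpha>" "\<alpha> \<le> L" using L_positive by (simp_all add: \<alpha>_def)
  qed
  have q\<alpha>: "rate m * \<alpha> \<le> 1"
    using C.q \<alpha> mult_left_mono[of \<alpha> L "rate m"] by linarith
  let ?S = "{w \<in> space M. (\<forall>i\<in>{T * m..<T * m + m}. \<not> birth N c (\<lambda>i. position m i w) i) \<and> \<alpha> \<le> C.area K w}"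
  let ?A = "{w \<in> space M. C.area K w < \<alpha>}"
  have "emeasure M ?S \<le> ennreal ((1 - rate m * \<alpha>) ^ m)"
    using C.prob_no_birth_le[OF \<alpha>, of "T * m" m] by (simp add: K_def)
  then have S: "prob ?S \<le> (1 - rate m * \<alpha>) ^ m"
    using q\<alpha> by (simp add: emeasure_eq_measure)
  also have "\<dots> \<le> exp (- (rate m * \<alpha>)) ^ m"
    using q\<alpha> exp_ge_add_one_self[of "- (rate m * \<alpha>)"] by (intro power_mono) auto
  also have "\<dots> = exp (- (real m * rate m * \<alpha>))"
    by (simp add: mult.assoc flip: exp_of_nat_mult)
  finally have S: "prob ?S \<le> exp (- (real m * rate m * \<alpha>))" .
  have A: "prob ?A \<le> 8 * h / (L * (\<rho> * \<rho> ^ K))"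
    using C.prob_area_small[of K] by (simp add: \<alpha>_def r K_def)
  have "1 - prob (chain_born m T) = prob (space M - chain_born m T)"
    by (rule prob_compl[symmetric, OF sets_chain_born[OF m]])
  also have "\<dots> \<le> prob (?S \<union> ?A)"
    by (intro finite_measure_mono) (auto simp: chain_born_def not_le)
  also have "\<dots> \<le> prob ?S + prob ?A"
    by (rule measure_Un_le) measurable
  finally show ?thesis using S A unfolding K \<alpha>_def[symmetric] by linarith
qed

text \<open>The per-slab quantities in the limit of thin slabs: arrivals regain intensity 1, and
  geometric decay over T m slabs becomes exponential decay in time.\<close>

lemma rate_limits:
  shows "(\<lambda>m. (1 - 2 * h * rate m) ^ (T * m)) \<longlonglongrightarrow> exp (- (2 * h * real T))"
    and "(\<lambda>m. 1 - 2 * h * rate m) \<longlonglongrightarrow> 1"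
    and "(\<lambda>m. real m * rate m) \<longlonglongrightarrow> 1"
proof -
  have L: "0 < L" and h: "0 < h" using L_positive h_positive .
  have "(\<lambda>m. (1 - 2 * h * (exp (- (L / real m)) / real m)) ^ m) \<longlonglongrightarrow> exp (- (2 * h))"
    using L h by real_asymp
  then have "(\<lambda>m. ((1 - 2 * h * rate m) ^ m) ^ T) \<longlonglongrightarrow> exp (- (2 * h)) ^ T"
    unfolding rate_def by (rule tendsto_power)
  moreover have "exp (- (2 * h)) ^ T = exp (- (2 * h * real T))"
    by (simp add: mult.commute flip: exp_of_nat_mult)
  ultimately show "(\<lambda>m. (1 - 2 * h * rate m) ^ (T * m)) \<longlonglongrightarrow> exp (- (2 * h * real T))"
    by (simp add: mult.commute[of T] flip: power_mult)
  show "(\<lambda>m. 1 - 2 * h * rate m) \<longlonglongrightarrow> 1"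
    unfolding rate_def using L h by real_asymp
  show "(\<lambda>m. real m * rate m) \<longlonglongrightarrow> 1"
    unfolding rate_def using L h by real_asymp
qed

lemma crowded_limit: "(\<lambda>m. real (Suc T) * L\<^sup>2 / real m) \<longlonglongrightarrow> 0"
  by real_asymp

text \<open>D is a measurable cover of the birth event. For each m the birth event is almost surely
  contained in \<open>chain_born\<close> together with \<open>crowded\<close>; intersecting over all
  m lets the bound pass to the limit.\<close>

lemma born_in_upper:
  "\<exists>D\<in>events. (AE w in M. born_in T w \<longrightarrow> w \<in> D) \<and> prob D \<le> L * exp (- (2 * h * real T))"
proof -
  define E where "E = (\<lambda>m. chain_born m T \<union> crowded m (Suc T))"
  define D where "D = (\<Inter>m\<in>{1..}. E m)"
  have E: "E m \<in> events" if "1 \<le> m" for m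
    using sets_chain_born[OF that] sets_crowded[OF that] by (simp add: E_def)
  have D: "D \<in> events" unfolding D_def using E by (intro sets.countable_INT) auto
  have "AE w in M. born_in T w \<longrightarrow> w \<in> D"
    using AE_born_in_iff by eventually_elim (auto simp: D_def E_def)
  moreover have "prob D \<le> L * exp (- (2 * h * real T))"
  proof (rule LIMSEQ_le_const)
    show "(\<lambda>m. L * (1 - 2 * h * rate m) ^ (T * m) + real (Suc T) * L\<^sup>2 / real m) \<longlonglongrightarrow> L * exp (- (2 * h * real T))"
      using tendsto_add[OF tendsto_mult[OF tendsto_const[of L] rate_limits(1)[of T]] crowded_limit[of T]] by simp
    show "\<exists>n. \<forall>m\<ge>n. prob D \<le> L * (1 - 2 * h * rate m) ^ (T * m) + real (Suc T) * L\<^sup>2 / real m"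
    proof (intro exI allI impI)
      fix m :: nat assume m: "1 \<le> m"
      have "prob D \<le> prob (E m)"
        using m E by (intro finite_measure_mono) (auto simp: D_def)
      also have "\<dots> \<le> prob (chain_born m T) + prob (crowded m (Suc T))"
        unfolding E_def by (rule measure_Un_le[OF sets_chain_born[OF m] sets_crowded[OF m]])
      also have "\<dots> \<le> L * (1 - 2 * h * rate m) ^ (T * m) + real (Suc T) * L\<^sup>2 / real m"
        by (intro add_mono prob_chain_born_le prob_crowded m)
      finally show "prob D \<le> L * (1 - 2 * h * rate m) ^ (T * m) + real (Suc T) * L\<^sup>2 / real m" .
    qed
  qed
  ultimately show ?thesis using D by blast
qed

text \<open>An inner approximation needs only one sufficiently large m, at the cost of the slack
  \<epsilon>.\<close>

lemma born_in_lower: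
  assumes \<epsilon>: "0 < \<epsilon>"
  shows "\<exists>D\<in>events. (AE w in M. w \<in> D \<longrightarrow> born_in T w) \<and>
    1 - (exp (- (L * exp (- (2 * h * real (Suc T))) / 2)) + 8 * h * exp (2 * h * real (Suc T)) / L) - \<epsilon> \<le> prob D"
proof -
  define \<rho> where "\<rho> = (\<lambda>m. 1 - 2 * h * rate m)"
  define e where "e = exp (- (2 * h * real (Suc T)))"
  have L: "0 < L" by (rule L_positive)
  define B where "B = (\<lambda>m. 1 - (exp (- (real m * rate m * (L * \<rho> m ^ (Suc T * m) / 2))) + 8 * h / (L * (\<rho> m * \<rho> m ^ (Suc T * m))))
      - real (Suc T) * L\<^sup>2 / real m)"
  have "B \<longlonglongrightarrow> 1 - (exp (- (1 * (L * e / 2))) + 8 * h / (L * (1 * e))) - 0"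
    unfolding B_def \<rho>_def e_def using L
    by (intro tendsto_intros rate_limits crowded_limit) auto
  moreover have "8 * h / (L * (1 * e)) = 8 * h * exp (2 * h * real (Suc T)) / L"
    unfolding e_def exp_minus by (simp add: field_simps)
  ultimately have lim: "B \<longlonglongrightarrow> 1 - (exp (- (L * e / 2)) + 8 * h * exp (2 * h * real (Suc T)) / L)"
    by simp
  have "\<forall>\<^sub>F m in sequentially. 1 - (exp (- (L * e / 2)) + 8 * h * exp (2 * h * real (Suc T)) / L) - \<epsilon> < B m"
    using \<epsilon> by (intro order_tendstoD(1)[OF lim]) simp
  then obtain m where m: "1 \<le> m" "1 - (exp (- (L * e / 2)) + 8 * h * exp (2 * h * real (Suc T)) / L) - \<epsilon> < B m"
    using eventually_happens'[OF _ eventually_conj[OF eventually_ge_at_top[of 1]]] by (metis sequentially_bot)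
  define D where "D = chain_born m T - crowded m (Suc T)"
  have D: "D \<in> events" using sets_chain_born[OF m(1)] sets_crowded[OF m(1)] by (simp add: D_def)
  have "AE w in M. w \<in> D \<longrightarrow> born_in T w"
    using AE_born_in_iff by eventually_elim (use m(1) in \<open>auto simp: D_def\<close>)
  moreover have "B m \<le> prob D"
  proof -
    have "prob (chain_born m T) \<le> prob (D \<union> crowded m (Suc T))"
      by (intro finite_measure_mono sets.Un D sets_crowded[OF m(1)]) (auto simp: D_def)
    also have "\<dots> \<le> prob D + prob (crowded m (Suc T))"
      by (rule measure_Un_le[OF D sets_crowded[OF m(1)]])
    finally show ?thesis
      using prob_chain_born_ge[OF m(1), of T] prob_crowded[OF m(1), of "Suc T"] by (simp add: B_def \<rho>_def)
  qed
  ultimately show ?thesis using D m(2) unfolding e_def by (intro bexI[of _ D]) auto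
qed

end

end

section \<open>Bounds for the mean tree-completion time\<close>

lemma tree_completion_time_eq:
  "tree_completion_time N lam Q = (SUP t\<in>{t. tree_born N lam Q t}. ennreal t)"
  by (simp add: tree_completion_time_def tree_born_def)

context poisson_process
begin

context
  fixes lam :: real and h :: real
  assumes lam: "0 < lam"
  defines "h \<equiv> arc_radius N (slit_factor N lam)"
begin

text \<open>A birth at time t in (T + n, T + n + 1] has t \<le> T + (n + 1), so the completion time
  is at most T plus the sum of n + 1 over the windows with a birth after T. The series of (n + 1)
  \<rho>^n gives the factor 1 / (1 - \<rho>)^2.\<close>

lemma completion_time_upper:
  "(\<integral>\<^sup>+w. tree_completion_time N lam (P w) \<partial>M) \<le>
    ennreal (real T + L * exp (- (2 * h * real T)) * (1 / (1 - exp (- (2 * h)))\<^sup>2))"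
proof -
  have h: "0 < h" using h_positive[OF lam] by (simp add: h_def)
  define \<rho> where "\<rho> = exp (- (2 * h))"
  have \<rho>: "0 < \<rho>" "\<rho> < 1" using h by (simp_all add: \<rho>_def)
  have "\<forall>T. \<exists>D\<in>events. (AE w in M. born_in lam T w \<longrightarrow> w \<in> D) \<and> prob D \<le> L * exp (- (2 * h * real T))"
    using born_in_upper[OF lam] by (simp add: h_def)
  then obtain D where D: "\<And>T. D T \<in> events" "\<And>T. AE w in M. born_in lam T w \<longrightarrow> w \<in> D T"
    "\<And>T. prob (D T) \<le> L * exp (- (2 * h * real T))"
    by metis
  have [measurable]: "D n \<in> events" for n by (rule D(1))
  define \<kappa> where "\<kappa> = (\<lambda>n. ennreal (real (Suc n)))"
  have "AE w in M. \<forall>n. born_in lam n w \<longrightarrow> w \<in> D n"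
    using D(2) by (simp add: AE_all_countable)
  then have "AE w in M. tree_completion_time N lam (P w) \<le>
      ennreal (real T) + (\<Sum>n. \<kappa> n * indicator (D (T + n)) w)"
  proof eventually_elim
    case (elim w)
    show ?case
      unfolding tree_completion_time_eq
    proof (rule SUP_least)
      fix t assume "t \<in> {t. tree_born N lam (P w) t}"
      then have t: "tree_born N lam (P w) t" "0 < t" by (auto simp: tree_born_def)
      show "ennreal t \<le> ennreal (real T) + (\<Sum>n. \<kappa> n * indicator (D (T + n)) w)"
      proof (cases "t \<le> real T")
        case True
        then show ?thesis by (intro order_trans[OF ennreal_leI[OF True]]) simp
      next
        case False
        obtain k where k: "real k < t" "t \<le> real (Suc k)"
          using obtain_slab[of t 1] t(2) by auto
        then have "real T < real (Suc k)" using False by linarith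
        then have "T \<le> k" by simp
        then obtain n where n: "k = T + n" using le_Suc_ex by blast
        have "born_in lam k w"
          using k t(1) by (auto simp: born_in_def[OF lam])
        then have w: "w \<in> D (T + n)" using elim n by auto
        have "ennreal t \<le> ennreal (real T + real (Suc n))"
          using k n by (intro ennreal_leI) simp
        also have "\<dots> = ennreal (real T) + \<kappa> n * indicator (D (T + n)) w"
          using w by (simp add: \<kappa>_def)
        also have "\<dots> \<le> ennreal (real T) + (\<Sum>n. \<kappa> n * indicator (D (T + n)) w)"
        proof (rule add_left_mono)
          have "f n \<le> suminf f" for f :: "nat \<Rightarrow> ennreal"
            using sum_le_suminf[of f "{n}"] by (simp add: summableI)
          then show "\<kappa> n * indicator (D (T + n)) w \<le> (\<Sum>n. \<kappa> n * indicator (D (T + n)) w)" .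
        qed
        finally show ?thesis .
      qed
    qed
  qed
  then have "(\<integral>\<^sup>+w. tree_completion_time N lam (P w) \<partial>M) \<le>
      (\<integral>\<^sup>+w. ennreal (real T) + (\<Sum>n. \<kappa> n * indicator (D (T + n)) w) \<partial>M)"
    by (rule nn_integral_mono_AE)
  also have "\<dots> = ennreal (real T) + (\<Sum>n. \<kappa> n * emeasure M (D (T + n)))"
    by (simp add: nn_integral_add nn_integral_suminf nn_integral_cmult_indicator emeasure_space_1)
  also have "\<dots> \<le> ennreal (real T) + (\<Sum>n. ennreal (L * exp (- (2 * h * real T)) * (real (Suc n) * \<rho> ^ n)))"
  proof (intro add_left_mono suminf_le)
    fix n
    have "prob (D (T + n)) \<le> L * (exp (- (2 * h * real T)) * \<rho> ^ n)"
    proof -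
      have "exp (- (2 * h * real (T + n))) = exp (- (2 * h * real T)) * exp (real n * - (2 * h))"
        unfolding exp_add[symmetric] by (rule arg_cong[of _ _ exp]) (simp add: algebra_simps)
      also have "exp (real n * - (2 * h)) = \<rho> ^ n"
        unfolding \<rho>_def by (rule exp_of_nat_mult)
      finally show ?thesis using D(3)[of "T + n"] by simp
    qed
    then have "real (Suc n) * prob (D (T + n)) \<le> real (Suc n) * (L * (exp (- (2 * h * real T)) * \<rho> ^ n))"
      by (intro mult_left_mono) auto
    also have "\<dots> = L * exp (- (2 * h * real T)) * (real (Suc n) * \<rho> ^ n)"
      by (simp only: mult_ac)
    finally have "ennreal (real (Suc n) * prob (D (T + n))) \<le> ennreal (L * exp (- (2 * h * real T)) * (real (Suc n) * \<rho> ^ n))"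
      by (rule ennreal_leI)
    then show "\<kappa> n * emeasure M (D (T + n)) \<le> ennreal (L * exp (- (2 * h * real T)) * (real (Suc n) * \<rho> ^ n))"
      unfolding \<kappa>_def emeasure_eq_measure by (subst ennreal_mult[symmetric]) auto
  qed auto
  also have "(\<Sum>n. ennreal (L * exp (- (2 * h * real T)) * (real (Suc n) * \<rho> ^ n))) =
      ennreal (L * exp (- (2 * h * real T)) * (1 / (1 - \<rho>)\<^sup>2))"
  proof (rule suminf_ennreal_eq)
    show "(\<lambda>n. L * exp (- (2 * h * real T)) * (real (Suc n) * \<rho> ^ n)) sums
        (L * exp (- (2 * h * real T)) * (1 / (1 - \<rho>)\<^sup>2))"
      using \<rho> by (intro sums_mult geometric_deriv_sums) simp
  qed (use \<rho> L_positive in auto)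
  also have "ennreal (real T) + ennreal (L * exp (- (2 * h * real T)) * (1 / (1 - \<rho>)\<^sup>2)) =
      ennreal (real T + L * exp (- (2 * h * real T)) * (1 / (1 - \<rho>)\<^sup>2))"
    using L_positive by simp
  finally show ?thesis by (simp add: \<rho>_def)
qed

text \<open>A birth in (T, T + 1] forces the completion time to exceed T, so the mean is at least T
  times the probability of such a birth. The slack \<delta> pays for \<epsilon> in
  \<open>born_in_lower\<close> and is removed at the end.\<close>

lemma completion_time_lower:
  "ennreal (real T * (1 - (exp (- (L * exp (- (2 * h * real (Suc T))) / 2)) + 8 * h * exp (2 * h * real (Suc T)) / L)))
    \<le> (\<integral>\<^sup>+w. tree_completion_time N lam (P w) \<partial>M)"
proof -
  define e where "e = exp (- (L * exp (- (2 * h * real (Suc T))) / 2)) + 8 * h * exp (2 * h * real (Suc T)) / L"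
  have eps: "ennreal (real T * (1 - e)) \<le> (\<integral>\<^sup>+w. tree_completion_time N lam (P w) \<partial>M) + ennreal \<delta>" if \<delta>: "0 < \<delta>" for \<delta>
  proof -
    \<comment> \<open>Dividing by T + 1 instead of T keeps the case T = 0 meaningful and still gives
      T \<epsilon> \<le> \<delta>.\<close>
    define \<epsilon> where "\<epsilon> = \<delta> / real (Suc T)"
    have \<epsilon>: "0 < \<epsilon>" using \<delta> by (simp add: \<epsilon>_def)
    obtain D where D [measurable]: "D \<in> events" and AE: "AE w in M. w \<in> D \<longrightarrow> born_in lam T w"
      and p: "1 - e - \<epsilon> \<le> prob D"
      using born_in_lower[OF lam \<epsilon>, of T] unfolding e_def h_def by blast
    have "real T * \<epsilon> \<le> \<delta>" using \<delta> by (simp add: \<epsilon>_def field_simps)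
    moreover have "real T * (1 - e - \<epsilon>) \<le> real T * prob D" using p by (intro mult_left_mono) auto
    ultimately have "real T * (1 - e) \<le> real T * prob D + \<delta>" by (simp add: algebra_simps)
    then have "ennreal (real T * (1 - e)) \<le> ennreal (real T * prob D + \<delta>)" by (rule ennreal_leI)
    also have "\<dots> = ennreal (real T) * emeasure M D + ennreal \<delta>"
      using \<delta> by (simp add: emeasure_eq_measure ennreal_mult)
    also have "ennreal (real T) * emeasure M D = (\<integral>\<^sup>+w. ennreal (real T) * indicator D w \<partial>M)"
      by (simp add: nn_integral_cmult_indicator)
    also have "\<dots> \<le> (\<integral>\<^sup>+w. tree_completion_time N lam (P w) \<partial>M)"
    proof (rule nn_integral_mono_AE)
      show "AE w in M. ennreal (real T) * indicator D w \<le> tree_completion_time N lam (P w)"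
        using AE
      proof eventually_elim
        case (elim w)
        show ?case
        proof (cases "w \<in> D")
          case True
          then obtain t where t: "real T < t" "tree_born N lam (P w) t"
            using elim by (auto simp: born_in_def[OF lam])
          have "ennreal (real T) \<le> ennreal t" using t by (intro ennreal_leI) simp
          also have "\<dots> \<le> tree_completion_time N lam (P w)"
            unfolding tree_completion_time_eq using t(2) by (intro SUP_upper) simp
          finally show ?thesis using True by simp
        qed simp
      qed
    qed
    finally show ?thesis by (simp add: add_right_mono)
  qed
  show ?thesis unfolding e_def[symmetric] by (rule ennreal_le_epsilon) (rule eps)
qed

end

end

section \<open>Asymptotics for N tending to infinity\<close>

lemma arc_radius_tendsto:
  assumes lam: "0 < lam"
  shows "(\<lambda>N. arc_radius N (slit_factor N lam)) \<longlonglongrightarrow> lam"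
proof -
  \<comment> \<open>Two forms of the Gudermannian function. The second is smooth at 0 with
    derivative 1, whereas \<open>arccos\<close> is singular at the limiting argument 1.\<close>
  have "arccos (1 / cosh x) = arctan (sinh x)" if "0 \<le> x" for x :: real
  proof -
    have a: "0 \<le> arctan (sinh x)" "arctan (sinh x) \<le> pi"
    proof -
      show "0 \<le> arctan (sinh x)" using that by simp
      show "arctan (sinh x) \<le> pi" using arctan_ubound[of "sinh x"] pi_gt_zero by linarith
    qed
    have "cos (arctan (sinh x)) = 1 / cosh x"
    proof -
      have "sqrt (1 + (sinh x)\<^sup>2) = cosh x"
        by (rule real_sqrt_unique) (simp_all add: cosh_square_eq add.commute)
      then show ?thesis by (simp add: cos_arctan)
    qed
    then show ?thesis using arccos_cos[OF a] by simp
  qed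
  then have "arc_radius N (slit_factor N lam) = 2 * real N * arctan (sinh (lam / (2 * real N)))" for N
    using lam by (simp add: arc_radius_def slit_factor_def)
  moreover have "(\<lambda>N. 2 * real N * arctan (sinh (lam / (2 * real N)))) \<longlonglongrightarrow> lam"
    using lam by real_asymp
  ultimately show ?thesis by simp
qed

theorem theorem1p4:
  fixes lam :: real
    and M :: "nat \<Rightarrow> 'w measure"
    and P :: "nat \<Rightarrow> 'w \<Rightarrow> (real \<times> real) set"
  assumes "0 < lam"
    and "\<And>N. N \<ge> 1 \<Longrightarrow> poisson_point_process (M N) (space_time N) (P N)"
  shows "(\<lambda>N. (\<integral>\<^sup>+ w. tree_completion_time N lam (P N w) \<partial>M N) / ennreal (ln (real N)))
           \<longlonglongrightarrow> ennreal (1 / (2 * lam))"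
proof -
  note lam = assms(1)
  define h where "h = (\<lambda>N. arc_radius N (slit_factor N lam))"
  define x where "x = (\<lambda>N. ln (real N))"
  define W where "W = (\<lambda>N. \<integral>\<^sup>+ w. tree_completion_time N lam (P N w) \<partial>M N)"
  have h_lim: "h \<longlonglongrightarrow> lam" unfolding h_def by (rule arc_radius_tendsto[OF lam])
  have pp: "poisson_process N (M N) (P N)" if "1 \<le> N" for N
    using that assms(2) by unfold_locales
  have hp: "0 < h N" if "1 \<le> N" for N
    unfolding h_def by (rule poisson_process.h_positive[OF pp[OF that] lam])
  have x: "0 < x N" "exp (x N) = real N" if "3 \<le> N" for N
    using that by (auto simp: x_def)

  define up where "up = (\<lambda>N. (x N / (2 * h N) + 1 + 2 * pi * (1 / (1 - exp (- (2 * h N)))\<^sup>2)) / x N)"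
  have up: "W N / ennreal (x N) \<le> ennreal (up N)" if N: "3 \<le> N" for N
  proof -
    have N1: "1 \<le> N" using N by simp
    \<comment> \<open>The least integer T with 2 h T \<ge> ln N. Then L exp(-2 h T) is at most 2 pi,
      so the tail after time T contributes only a bounded amount.\<close>
    define T where "T = nat \<lceil>x N / (2 * h N)\<rceil>"
    have "0 < x N / (2 * h N)" using hp[OF N1] x[OF N] by simp
    then have T: "x N / (2 * h N) \<le> real T" "real T \<le> x N / (2 * h N) + 1"
      unfolding T_def by linarith+
    have "x N \<le> 2 * h N * real T"
      using T(1) hp[OF N1] by (simp add: field_simps)
    then have "exp (- (2 * h N * real T)) \<le> exp (- x N)" by simp
    then have "2 * pi * real N * exp (- (2 * h N * real T)) \<le> 2 * pi * real N * exp (- x N)"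
      by (intro mult_left_mono) auto
    also have "\<dots> = 2 * pi"
      using x(2)[OF N] N by (simp add: exp_minus)
    finally have "2 * pi * real N * exp (- (2 * h N * real T)) * (1 / (1 - exp (- (2 * h N)))\<^sup>2)
        \<le> 2 * pi * (1 / (1 - exp (- (2 * h N)))\<^sup>2)"
      by (intro mult_right_mono) auto
    then have "real T + 2 * pi * real N * exp (- (2 * h N * real T)) * (1 / (1 - exp (- (2 * h N)))\<^sup>2) \<le> up N * x N"
      using T(2) x[OF N] by (simp add: up_def)
    then have "W N \<le> ennreal (up N * x N)"
      unfolding W_def h_def
      by (intro order_trans[OF poisson_process.completion_time_upper[OF pp[OF N1] lam, of T]] ennreal_leI)
    then have "W N / ennreal (x N) \<le> ennreal (up N * x N) / ennreal (x N)"
      by (rule divide_right_mono_ennreal)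
    also have "0 \<le> up N"
      using x[OF N] hp[OF N1] by (simp add: up_def)
    then have "ennreal (up N * x N) / ennreal (x N) = ennreal (up N)"
      using x[OF N] by (subst divide_ennreal) auto
    finally show ?thesis .
  qed

  \<comment> \<open>The choice of T below stops sqrt(ln N) short of ln N in the exponent: the mean
    exposed length at time T + 1 is still at least 2 pi exp(sqrt(ln N) - 4 lam), which tends to
    infinity, while sqrt(ln N) is negligible against ln N. \<open>err\<close> bounds the two failure
    probabilities of the lower bound.\<close>
  define err where "err = (\<lambda>N. exp (- (pi * exp (- (4 * lam)) * exp (sqrt (x N)))) +
    8 * lam / pi * exp (4 * lam) * exp (- sqrt (x N)))"
  define low where "low = (\<lambda>N. ((x N - sqrt (x N)) / (2 * h N) - 1) * (1 - err N) / x N)"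
  have low: "ennreal (low N) \<le> W N / ennreal (x N)" if N: "3 \<le> N" and h2: "h N < 2 * lam" and e1: "err N < 1" for N
  proof -
    have N1: "1 \<le> N" using N by simp
    define s where "s = (x N - sqrt (x N)) / (2 * h N)"
    \<comment> \<open>This is where N \<ge> 3 enters: ln N \<ge> 1 yields sqrt(ln N) \<le> ln N, so
      s is nonnegative and its floor is a natural number.\<close>
    have "1 \<le> x N"
    proof -
      have "exp 1 \<le> real N" using exp_le N by linarith
      then show ?thesis unfolding x_def using N by (simp add: ln_ge_iff)
    qed
    then have s0: "0 \<le> s" using hp[OF N1] by (simp add: s_def real_sqrt_le_iff' real_le_lsqrt power2_eq_square)
    define T where "T = nat \<lfloor>s\<rfloor>"
    have T: "real T \<le> s" "s - 1 \<le> real T" unfolding T_def using s0 by linarith+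
    have L: "2 * pi * real N = 2 * pi * exp (x N)" using x[OF N] by simp
    have "2 * h N * real (Suc T) \<le> 2 * h N * (s + 1)"
      using T(1) hp[OF N1] by (intro mult_left_mono) auto
    also have "\<dots> = x N - sqrt (x N) + 2 * h N"
      using hp[OF N1] by (simp add: s_def field_simps)
    \<comment> \<open>The term 2h is the price for T + 1 in place of T; the assumption h < 2 lam
      turns it into a constant independent of N.\<close>
    also have "\<dots> \<le> x N - sqrt (x N) + 4 * lam" using h2 by simp
    finally have hT: "2 * h N * real (Suc T) \<le> x N - sqrt (x N) + 4 * lam" .
    define y where "y = 2 * h N * real (Suc T)"
    have "8 * h N * exp y / (2 * pi * real N) \<le> 8 * (2 * lam) * exp (x N - sqrt (x N) + 4 * lam) / (2 * pi * real N)"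
      using h2 hp[OF N1] hT lam unfolding y_def by (intro divide_right_mono mult_mono) auto
    also have "\<dots> = 8 * lam / pi * exp (4 * lam) * exp (- sqrt (x N))"
      unfolding L by (simp add: exp_add exp_diff exp_minus field_simps)
    finally have e2: "8 * h N * exp y / (2 * pi * real N) \<le> 8 * lam / pi * exp (4 * lam) * exp (- sqrt (x N))" .
    have "pi * exp (- (4 * lam)) * exp (sqrt (x N)) = 2 * pi * real N * exp (- (x N - sqrt (x N) + 4 * lam)) / 2"
      unfolding L by (simp add: exp_add exp_diff exp_minus field_simps)
    also have "\<dots> \<le> 2 * pi * real N * exp (- y) / 2"
      using hT unfolding y_def by (intro divide_right_mono mult_left_mono) auto
    finally have e3: "exp (- (2 * pi * real N * exp (- y) / 2)) \<le> exp (- (pi * exp (- (4 * lam)) * exp (sqrt (x N))))"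
      by simp
    have e: "exp (- (2 * pi * real N * exp (- y) / 2)) + 8 * h N * exp y / (2 * pi * real N) \<le> err N"
      unfolding err_def by (rule add_mono[OF e3 e2])
    have "low N * x N = (s - 1) * (1 - err N)"
      using x[OF N] by (simp add: low_def s_def)
    also have "\<dots> \<le> real T * (1 - err N)"
      using T(2) e1 by (intro mult_right_mono) auto
    also have "\<dots> \<le> real T * (1 - (exp (- (2 * pi * real N * exp (- y) / 2)) + 8 * h N * exp y / (2 * pi * real N)))"
      using e by (intro mult_left_mono) auto
    finally have "ennreal (low N * x N) \<le> W N"
      unfolding W_def y_def h_def
      by (rule order_trans[OF ennreal_leI poisson_process.completion_time_lower[OF pp[OF N1] lam]])
    then have "ennreal (low N * x N) / ennreal (x N) \<le> W N / ennreal (x N)"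
      by (rule divide_right_mono_ennreal)
    \<comment> \<open>\<open>low\<close> may be negative; \<open>ennreal\<close> then truncates it
      to 0 and the bound is trivial.\<close>
    moreover have "ennreal (low N) \<le> ennreal (low N * x N) / ennreal (x N)"
    proof (cases "0 \<le> low N")
      case True
      then show ?thesis using x[OF N] by (subst divide_ennreal) auto
    qed (simp add: ennreal_neg)
    ultimately show ?thesis by (rule order_trans[rotated])
  qed

  have "err \<longlonglongrightarrow> 0" unfolding err_def x_def using lam by real_asymp
  moreover have "(\<lambda>N. (x N - sqrt (x N)) / x N) \<longlonglongrightarrow> 1" "(\<lambda>N. 1 / x N) \<longlonglongrightarrow> 0"
    unfolding x_def by real_asymp+
  ultimately have lim: "err \<longlonglongrightarrow> 0" "(\<lambda>N. (x N - sqrt (x N)) / x N) \<longlonglongrightarrow> 1" "(\<lambda>N. 1 / x N) \<longlonglongrightarrow> 0" .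
  have "(\<lambda>N. (((x N - sqrt (x N)) / x N) / (2 * h N) - 1 / x N) * (1 - err N)) \<longlonglongrightarrow> (1 / (2 * lam) - 0) * (1 - 0)"
    using lam by (intro tendsto_intros lim h_lim) auto
  moreover have "\<forall>\<^sub>F N in sequentially. (((x N - sqrt (x N)) / x N) / (2 * h N) - 1 / x N) * (1 - err N) = low N"
    using eventually_ge_at_top[of 3]
  proof eventually_elim
    case (elim N)
    have "(a / d / b - 1 / d) * e = (a / b - 1) * e / d" if "b \<noteq> 0" "d \<noteq> 0" for a b d e :: real
      using that by (simp add: field_simps)
    then show ?case
      unfolding low_def using x(1)[OF elim] hp[of N] elim by simp
  qed
  ultimately have low_lim: "low \<longlonglongrightarrow> 1 / (2 * lam)"
    using Lim_transform_eventually by fastforce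
  have "(\<lambda>N. 1 / (2 * h N) + (1 + 2 * pi * (1 / (1 - exp (- (2 * h N)))\<^sup>2)) * (1 / x N)) \<longlonglongrightarrow>
      1 / (2 * lam) + (1 + 2 * pi * (1 / (1 - exp (- (2 * lam)))\<^sup>2)) * 0"
    using lam by (intro tendsto_intros lim h_lim) auto
  moreover have "\<forall>\<^sub>F N in sequentially. 1 / (2 * h N) + (1 + 2 * pi * (1 / (1 - exp (- (2 * h N)))\<^sup>2)) * (1 / x N) = up N"
    using eventually_ge_at_top[of 3]
  proof eventually_elim
    case (elim N)
    have "1 / b + (1 + e) * (1 / d) = (d / b + 1 + e) / d" if "b \<noteq> 0" "d \<noteq> 0" for b d e :: real
      using that by (simp add: field_simps)
    then show ?case
      unfolding up_def using x(1)[OF elim] hp[of N] elim by simp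
  qed
  ultimately have up_lim: "up \<longlonglongrightarrow> 1 / (2 * lam)"
    using Lim_transform_eventually by fastforce
  have "\<forall>\<^sub>F N in sequentially. h N < 2 * lam" "\<forall>\<^sub>F N in sequentially. err N < 1"
    using lam by (auto intro!: order_tendstoD(2)[OF h_lim] order_tendstoD(2)[OF lim(1)])
  then have "\<forall>\<^sub>F N in sequentially. ennreal (low N) \<le> W N / ennreal (x N)"
    using eventually_ge_at_top[of 3] by eventually_elim (rule low)
  moreover have "\<forall>\<^sub>F N in sequentially. W N / ennreal (x N) \<le> ennreal (up N)"
    using eventually_ge_at_top[of 3] by eventually_elim (rule up)
  ultimately have "(\<lambda>N. W N / ennreal (x N)) \<longlonglongrightarrow> ennreal (1 / (2 * lam))"
    by (rule tendsto_sandwich) (intro tendsto_ennrealI low_lim up_lim)+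
  then show ?thesis by (simp add: W_def x_def)
qed

end
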